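(* Let $k$ be an infinite field of characteristic $p>0$, let $G$ be one of $SO_{2n+1}(k)$, $Sp_{2n}(k)$, $SO_{2n}(k)$, and let $N=2n+1,2n,2n$ respectively. Let $\lambda=(\lambda_1,\dots,\lambda_n)$ and $\mu=(\mu_1,\dots,\mu_n)$ be in $\wedge^+(n,r)$. Assume that (a) $p>2$ if $G=SO_{2n+1}(k)$ or $SO_{2n}(k)$; (b) $\lambda_n=\mu_n=0$ if $G=SO_{2n}(k)$. Then the restriction map $k[GL_N(k)]\to k[G]$ induces an injective map $$\operatorname{Hom}_{GL_N(k)}(\nabla(\lambda),\nabla(\mu))\to\operatorname{Hom}_G(\nabla_G(\overline{\lambda}),\nabla_G(\overline{\mu})).$$
   Context: $\wedge^+(n,r)$ is the set of partitions $(\lambda_1\ge\dots\ge\lambda_n\ge0)$ of $r$ with at most $n$ parts. General linear group: $B\subseteq GL_N(k)$ is the subgroup of lower triangular matrices, $T$ the subgroup of diagonal matrices, $\epsilon_i(\mathrm{diag}(t_1,\dots,t_N))=t_i$. A partition $\lambda=(\lambda_1,\dots,\lambda_n)$ is identified with the character $\lambda_1\epsilon_1+\dots+\lambda_n\epsilon_n$ of $T$, extended uniquely to $B$, and $$\nabla(\lambda)=\{f\in k[GL_N(k)]: f(bg)=\lambda(b)f(g)\ \text{for all } g\in GL_N(k),\ b\in B\},$$ a $GL_N(k)$-module under right translation $(g_1f)(g_2)=f(g_2g_1)$. Classical groups: $SO_N(k)=\{X\in SL_N(k):X^tJ_NX=J_N\}$, where $J_N$ is the $N\times N$ matrix with ones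 on the antidiagonal and zeros elsewhere; $Sp_{2n}(k)=\{X\in SL_{2n}(k):X^tJ'_{2n}X=J'_{2n}\}$ with $J'_{2n}=\begin{pmatrix}0&J_n\\-J_n&0\end{pmatrix}$. $T_G$ and $B_G$ are the subgroups of diagonal and of lower triangular matrices in $G$; $\overline{\epsilon}_i$ is the restriction of $\epsilon_i$ to $T_G$; $\overline{\lambda}=\lambda_1\overline{\epsilon}_1+\cdots+\lambda_n\overline{\epsilon}_n$, extended uniquely to a character of $B_G$; and $$\nabla_G(\overline{\lambda})=\{f\in k[G]: f(bg)=\overline{\lambda}(b)f(g)\ \text{for all } g\in G,\ b\in B_G\},$$ a $G$-module under right translation. Under assumptions (a) and (b), it is known (Donkin; Maliakas) that the restriction map $k[GL_N(k)]\to k[G]$ of coordinate rings restricts to surjective $G$-maps $\pi_\lambda:\nabla(\lambda)\to\nabla_G(\overline{\lambda})$ and $\pi_\mu:\nabla(\mu)\to\nabla_G(\overline{\mu})$. The induced map on Hom spaces sends $\phi$ to the map $\overline{\phi}$ determined by $\overline{\phi}\circ\pi_\lambda=\pi_\mu\circ\phi$; its existence is part of the assertion. *)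

theory Defs
  imports "Jordan_Normal_Form.Determinant" "HOL-Library.FuncSet"
begin

text \<open>Matrix indices are 0-based: the part \<open>lambda_i\<close> of a partition is \<open>lam ! (i - 1)\<close>, and the
  entry in row \<open>i\<close> and column \<open>j\<close> of \<open>A\<close> is \<open>A $$ (i - 1, j - 1)\<close>.\<close>

definition partitions :: "nat \<Rightarrow> nat \<Rightarrow> nat list set" where
  "partitions n r = {lam. length lam = n \<and> sorted_wrt (\<ge>) lam \<and> sum_list lam = r}"


section \<open>The groups\<close>

definition GL :: "nat \<Rightarrow> 'k::field mat set" where
  "GL N = {X \<in> carrier_mat N N. invertible_mat X}"

definition SL :: "nat \<Rightarrow> 'k::field mat set" where
  "SL N = {X \<in> carrier_mat N N. det X = 1}"

definition antidiag :: "nat \<Rightarrow> 'k::field mat" where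
  "antidiag N = mat N N (\<lambda>(i, j). if i + j + 1 = N then 1 else 0)"

definition symp_form :: "nat \<Rightarrow> 'k::field mat" where
  "symp_form n = four_block_mat (0\<^sub>m n n) (antidiag n) (- antidiag n) (0\<^sub>m n n)"

definition SO :: "nat \<Rightarrow> 'k::field mat set" where
  "SO N = {X \<in> SL N. transpose_mat X * antidiag N * X = antidiag N}"

definition Sp :: "nat \<Rightarrow> 'k::field mat set" where
  "Sp n = {X \<in> SL (2 * n). transpose_mat X * symp_form n * X = symp_form n}"

text \<open>The type of the group is kept as data rather than recovered from the set of matrices:
  in characteristic 2 the sets \<open>SO (2 * n)\<close> and \<open>Sp n\<close> coincide.\<close>

datatype classical_type = Odd_SO | Symplectic | Even_SO

fun classical_dim :: "classical_type \<Rightarrow> nat \<Rightarrow> nat" where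
  "classical_dim Odd_SO n = 2 * n + 1"
| "classical_dim Symplectic n = 2 * n"
| "classical_dim Even_SO n = 2 * n"

fun classical_group :: "classical_type \<Rightarrow> nat \<Rightarrow> 'k::field mat set" where
  "classical_group Odd_SO n = SO (2 * n + 1)"
| "classical_group Symplectic n = Sp n"
| "classical_group Even_SO n = SO (2 * n)"


section \<open>Coordinate rings and induced modules\<close>

text \<open>A function on a subset \<open>G\<close> of \<open>GL N\<close> is represented by its extension by zero to the type of
  all matrices, so that equality and the pointwise operations are those of functions on \<open>G\<close>.\<close>

definition restr :: "'k::field mat set \<Rightarrow> ('k mat \<Rightarrow> 'k) \<Rightarrow> ('k mat \<Rightarrow> 'k)" where
  "restr G f = (\<lambda>X. if X \<in> G then f X else 0)"

text \<open>The \<open>k\<close>-algebra of functions on \<open>G\<close> generated by the matrix entries and the inverse of the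
  determinant, i.e. the image of the coordinate ring of \<open>GL N\<close> under restriction to \<open>G\<close>.\<close>

inductive_set coord_ring :: "nat \<Rightarrow> 'k::field mat set \<Rightarrow> ('k mat \<Rightarrow> 'k) set"
  for N :: nat and G :: "'k mat set" where
  const: "restr G (\<lambda>X. c) \<in> coord_ring N G"
| entry: "i < N \<Longrightarrow> j < N \<Longrightarrow> restr G (\<lambda>X. X $$ (i, j)) \<in> coord_ring N G"
| inv_det: "restr G (\<lambda>X. inverse (det X)) \<in> coord_ring N G"
| add: "f \<in> coord_ring N G \<Longrightarrow> h \<in> coord_ring N G \<Longrightarrow> (\<lambda>X. f X + h X) \<in> coord_ring N G"
| mult: "f \<in> coord_ring N G \<Longrightarrow> h \<in> coord_ring N G \<Longrightarrow> (\<lambda>X. f X * h X) \<in> coord_ring N G"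

definition right_trans :: "'k::field mat set \<Rightarrow> 'k mat \<Rightarrow> ('k mat \<Rightarrow> 'k) \<Rightarrow> ('k mat \<Rightarrow> 'k)" where
  "right_trans G g f = restr G (\<lambda>X. f (X * g))"

definition borel_subgroup :: "nat \<Rightarrow> 'k::field mat set \<Rightarrow> 'k mat set" where
  "borel_subgroup N G = {b \<in> G. \<forall>i < N. \<forall>j < N. i < j \<longrightarrow> b $$ (i, j) = 0}"

text \<open>The character of the diagonal subgroup attached to \<open>lam\<close>, extended to lower triangular
  matrices. The extension is trivial on the unipotent ones, so it only reads off diagonal
  entries; those with index at least \<open>length lam\<close> do not contribute.\<close>

definition weight_char :: "nat list \<Rightarrow> 'k::field mat \<Rightarrow> 'k" where
  "weight_char lam b = (\<Prod>i < length lam. b $$ (i, i) ^ (lam ! i))"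

definition nabla :: "nat \<Rightarrow> 'k::field mat set \<Rightarrow> nat list \<Rightarrow> ('k mat \<Rightarrow> 'k) set" where
  "nabla N G lam = {f \<in> coord_ring N G.
     \<forall>g \<in> G. \<forall>b \<in> borel_subgroup N G. f (b * g) = weight_char lam b * f g}"


section \<open>Module homomorphisms\<close>

text \<open>Homomorphisms are extensional, so that equality means agreement on the source module.\<close>

definition Hom_mod :: "'k::field mat set \<Rightarrow> ('k mat \<Rightarrow> 'k) set \<Rightarrow> ('k mat \<Rightarrow> 'k) set
    \<Rightarrow> (('k mat \<Rightarrow> 'k) \<Rightarrow> ('k mat \<Rightarrow> 'k)) set" where
  "Hom_mod G V W = {\<phi> \<in> V \<rightarrow>\<^sub>E W.
     (\<forall>f \<in> V. \<forall>h \<in> V. \<phi> (\<lambda>X. f X + h X) = (\<lambda>X. \<phi> f X + \<phi> h X)) \<and>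
     (\<forall>c. \<forall>f \<in> V. \<phi> (\<lambda>X. c * f X) = (\<lambda>X. c * \<phi> f X)) \<and>
     (\<forall>g \<in> G. \<forall>f \<in> V. \<phi> (right_trans G g f) = right_trans G g (\<phi> f))}"

text \<open>\<open>\<psi>\<close> is induced by \<open>\<phi>\<close> on restriction to \<open>G\<close>: the square formed by \<open>\<phi>\<close>, \<open>\<psi>\<close> and the
  restriction maps on source and target commutes.\<close>

definition is_induced_hom :: "nat \<Rightarrow> 'k::field mat set \<Rightarrow> nat list \<Rightarrow> nat list
    \<Rightarrow> (('k mat \<Rightarrow> 'k) \<Rightarrow> ('k mat \<Rightarrow> 'k)) \<Rightarrow> (('k mat \<Rightarrow> 'k) \<Rightarrow> ('k mat \<Rightarrow> 'k)) \<Rightarrow> bool" where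
  "is_induced_hom N G lam mu \<phi> \<psi> \<longleftrightarrow>
     \<psi> \<in> Hom_mod G (nabla N G lam) (nabla N G mu) \<and>
     (\<forall>f \<in> nabla N (GL N) lam. \<psi> (restr G f) = restr G (\<phi> f))"

definition induced_hom :: "nat \<Rightarrow> 'k::field mat set \<Rightarrow> nat list \<Rightarrow> nat list
    \<Rightarrow> (('k mat \<Rightarrow> 'k) \<Rightarrow> ('k mat \<Rightarrow> 'k)) \<Rightarrow> (('k mat \<Rightarrow> 'k) \<Rightarrow> ('k mat \<Rightarrow> 'k))" where
  "induced_hom N G lam mu \<phi> = (THE \<psi>. is_induced_hom N G lam mu \<phi> \<psi>)"


section \<open>Restriction maps induced modules to induced modules\<close>

lemma SL_subset_GL: "SL N \<subseteq> (GL N :: 'k::field mat set)"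
proof
  fix X :: "'k mat" assume "X \<in> SL N"
  then have X: "X \<in> carrier_mat N N" and "det X \<noteq> 0"
    by (auto simp: SL_def)
  then have "X \<in> Units (ring_mat TYPE('k) N ())"
    by (rule det_non_zero_imp_unit)
  then obtain Y where "Y \<in> carrier_mat N N" "Y * X = 1\<^sub>m N" "X * Y = 1\<^sub>m N"
    by (auto simp: Units_def ring_mat_def)
  then show "X \<in> GL N"
    using X by (auto simp: GL_def invertible_mat_def inverts_mat_def)
qed

lemma classical_group_subset_GL: "classical_group ty n \<subseteq> GL (classical_dim ty n)"
  by (cases ty) (use SL_subset_GL in \<open>auto simp: SO_def Sp_def\<close>)

lemma form_preserved_mult:
  fixes F :: "'k::field mat"
  assumes F: "F \<in> carrier_mat N N" and X: "X \<in> carrier_mat N N" and Y: "Y \<in> carrier_mat N N"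
    and XF: "transpose_mat X * F * X = F" and YF: "transpose_mat Y * F * Y = F"
  shows "transpose_mat (X * Y) * F * (X * Y) = F"
proof -
  have tX: "transpose_mat X \<in> carrier_mat N N" and tY: "transpose_mat Y \<in> carrier_mat N N"
    using X Y by auto
  have "transpose_mat (X * Y) * F * (X * Y) = transpose_mat Y * transpose_mat X * F * (X * Y)"
    by (simp add: transpose_mult[OF X Y])
  also have "\<dots> = transpose_mat Y * (transpose_mat X * F * X) * Y"
    using F X Y tX tY by (simp add: assoc_mult_mat[of _ N N _ N _ N])
  finally show ?thesis
    by (simp add: XF YF)
qed

lemma classical_group_mult_closed:
  assumes "X \<in> classical_group ty n" "Y \<in> classical_group ty n"
  shows "X * Y \<in> classical_group ty n"
proof -
  have J: "antidiag m \<in> carrier_mat m m" for m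
    by (simp add: antidiag_def)
  have J': "symp_form n \<in> carrier_mat (2 * n) (2 * n)"
    by (auto simp: symp_form_def antidiag_def)
  have SL: "X * Y \<in> SL m" if "X \<in> SL m" "Y \<in> SL m" for m
    using that by (auto simp: SL_def det_mult)
  show ?thesis
  proof (cases ty)
    case Odd_SO
    then show ?thesis
      using assms form_preserved_mult[OF J] SL by (auto simp: SO_def SL_def)
  next
    case Symplectic
    then show ?thesis
      using assms form_preserved_mult[OF J'] SL by (auto simp: Sp_def SL_def)
  next
    case Even_SO
    then show ?thesis
      using assms form_preserved_mult[OF J] SL by (auto simp: SO_def SL_def)
  qed
qed

lemma restr_coord_ring:
  assumes G: "G \<subseteq> GL N" and "f \<in> coord_ring N (GL N)"
  shows "restr G f \<in> coord_ring N G"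
proof -
  have restr_restr: "restr G (restr (GL N) h) = restr G h" for h :: "'a mat \<Rightarrow> 'a"
    using G by (auto simp: restr_def fun_eq_iff)
  from assms(2) show ?thesis
  proof induction
    case (add f h)
    have "restr G (\<lambda>X. f X + h X) = (\<lambda>X. restr G f X + restr G h X)"
      by (auto simp: restr_def)
    with coord_ring.add[OF add.IH] show ?case by simp
  next
    case (mult f h)
    have "restr G (\<lambda>X. f X * h X) = (\<lambda>X. restr G f X * restr G h X)"
      by (auto simp: restr_def)
    with coord_ring.mult[OF mult.IH] show ?case by simp
  qed (auto simp: restr_restr intro: coord_ring.intros)
qed

lemma restr_nabla:
  assumes N: "N = classical_dim ty n" and G: "G = classical_group ty n"
    and f: "f \<in> nabla N (GL N) lam"
  shows "restr G f \<in> nabla N G lam"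
proof -
  have sub: "G \<subseteq> GL N"
    using classical_group_subset_GL N G by simp
  have "restr G f (b * g) = weight_char lam b * restr G f g"
    if "g \<in> G" "b \<in> borel_subgroup N G" for g b
  proof -
    have "b * g \<in> G"
      using that classical_group_mult_closed G by (auto simp: borel_subgroup_def)
    moreover have "b \<in> borel_subgroup N (GL N)" "g \<in> GL N"
      using that sub by (auto simp: borel_subgroup_def)
    ultimately show ?thesis
      using that f by (auto simp: nabla_def restr_def)
  qed
  then show ?thesis
    using f restr_coord_ring[OF sub] by (auto simp: nabla_def)
qed

end

theory Submission
  imports Defs "HOL-Computational_Algebra.Polynomial"
begin

text \<open>Let \<open>m\<close> be the number of parts that may be nonzero: \<open>n\<close>, or \<open>n - 1\<close> for even orthogonal
  groups. The group \<open>G\<close> contains a copy \<open>iota\<close> of \<open>GL m\<close> as a Levi factor and the one-parameter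
  group \<open>z c = diag (c, \<dots>, c, 1, \<dots>, 1, 1/c, \<dots>, 1/c)\<close>; for \<open>GL N\<close> take
  \<open>z c = diag (c, \<dots>, c, 1, \<dots>, 1)\<close> instead. If \<open>\<chi>\<close> is a homomorphism into an induced
  module, of \<open>GL N\<close> or of \<open>G\<close>, of highest weight \<open>mu\<close> of size \<open>r\<close>, then \<open>h \<mapsto> \<chi> h 1\<close> is an
  eigenfunctional of \<open>z\<close> with eigenvalue \<open>c ^ r\<close>, so it only sees the \<open>c ^ r\<close>-component of \<open>h\<close>. Since
  \<open>lam\<close> has size \<open>r\<close> too, this component is, for both groups, the function \<open>lift h\<close> that evaluates
  the polynomial extension of \<open>a \<mapsto> h (iota a)\<close> at the upper left \<open>m \<times> m\<close> block. For \<open>GL N\<close> this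
  holds because a semi-invariant depends on the first \<open>m\<close> rows only; for \<open>G\<close> it is checked on the big
  cell, which is dense.

  As \<open>lift h\<close> is a semi-invariant on all of \<open>GL N\<close>, the homomorphism induced by \<open>\<phi>\<close> has to be
  \<open>h \<mapsto> (g \<mapsto> \<phi> (lift (g \<cdot> h)) 1)\<close>, and this formula does define one; the surjectivity of the
  restriction maps is not needed. Injectivity holds because \<open>f \<mapsto> \<phi> f 1\<close> determines \<open>\<phi>\<close>.\<close>

section \<open>Polynomial functions on matrices\<close>

text \<open>Groups are sets of points over an arbitrary infinite field, so density takes an
  elementary form: a polynomial vanishes at a point once the point lies on a polynomial curve inside
  the group that reaches the good locus. This calls for explicit curves: lines for matrices,
  transvections and Eichler transformations for \<open>G\<close>. The main obstacle is that
  \<open>a \<mapsto> h (iota a)\<close> is a priori regular only on \<open>GL m\<close>, with a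
  power of \<open>det a\<close> as denominator, whereas \<open>lift h\<close> is evaluated at blocks
  that may be singular. Partitions are nonnegative weights, which makes the numerator vanish on
  singular matrices; the denominator then cancels, because a polynomial function vanishing on
  singular matrices is a multiple of the determinant. That is proved by induction on leading minors.
  A second obstacle is that \<open>\<phi>\<close> is an abstract linear map, so regularity of the
  induced functions in \<open>g\<close> is not evident; it comes from local finiteness of right
  translation.\<close>

inductive_set polyfun :: "nat \<Rightarrow> ('k::field mat \<Rightarrow> 'k) set" for N :: nat where
  const: "(\<lambda>X. c) \<in> polyfun N"
| entry: "i < N \<Longrightarrow> j < N \<Longrightarrow> (\<lambda>X. X $$ (i, j)) \<in> polyfun N"
| add: "P \<in> polyfun N \<Longrightarrow> Q \<in> polyfun N \<Longrightarrow> (\<lambda>X. P X + Q X) \<in> polyfun N"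
| mult: "P \<in> polyfun N \<Longrightarrow> Q \<in> polyfun N \<Longrightarrow> (\<lambda>X. P X * Q X) \<in> polyfun N"

lemma polyfun_uminus: "P \<in> polyfun N \<Longrightarrow> (\<lambda>X. - P X) \<in> polyfun N"
  using polyfun.mult[OF polyfun.const[of "-1"], of P N] by simp

lemma polyfun_diff:
  "P \<in> polyfun N \<Longrightarrow> Q \<in> polyfun N \<Longrightarrow> (\<lambda>X. P X - Q X) \<in> polyfun N"
  using polyfun.add[OF _ polyfun_uminus, of P N Q] by simp

lemma polyfun_power: "P \<in> polyfun N \<Longrightarrow> (\<lambda>X. P X ^ k) \<in> polyfun N"
  by (induction k) (auto intro: polyfun.intros)

lemma polyfun_sum:
  "(\<And>a. a \<in> A \<Longrightarrow> P a \<in> polyfun N) \<Longrightarrow> (\<lambda>X. \<Sum>a\<in>A. P a X) \<in> polyfun N"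
  by (induction A rule: infinite_finite_induct) (auto intro: polyfun.intros)

lemma polyfun_prod:
  "(\<And>a. a \<in> A \<Longrightarrow> P a \<in> polyfun N) \<Longrightarrow> (\<lambda>X. \<Prod>a\<in>A. P a X) \<in> polyfun N"
  by (induction A rule: infinite_finite_induct) (auto intro: polyfun.intros)

lemma polyfun_comp:
  assumes "P \<in> polyfun N" and "\<And>i j. i < N \<Longrightarrow> j < N \<Longrightarrow> (\<lambda>X. M X $$ (i, j)) \<in> polyfun N'"
  shows "(\<lambda>X. P (M X)) \<in> polyfun N'"
  using assms by induction (auto intro: polyfun.intros)

lemma polyfun_det:
  assumes "\<And>X. M X \<in> carrier_mat l l"
    and "\<And>i j. i < l \<Longrightarrow> j < l \<Longrightarrow> (\<lambda>X. M X $$ (i, j)) \<in> polyfun N"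
  shows "(\<lambda>X. det (M X)) \<in> polyfun N"
proof -
  have "(\<lambda>X. \<Sum>p \<in> {p. p permutes {0..<l}}. signof p * (\<Prod>i = 0..<l. M X $$ (i, p i))) \<in> polyfun N"
    by (intro polyfun_sum polyfun.mult polyfun.const polyfun_prod assms(2))
      (auto dest: permutes_in_image)
  then show ?thesis
    by (simp add: det_def'[OF assms(1)])
qed

section \<open>Polynomials in one variable and polynomial curves of matrices\<close>

lemma poly_eqI_infinite:
  fixes p q :: "'k::field poly"
  assumes "infinite S" and "\<And>s. s \<in> S \<Longrightarrow> poly p s = poly q s"
  shows "p = q"
proof (rule ccontr)
  assume "p \<noteq> q"
  then have "finite {s. poly (p - q) s = 0}"
    by (intro poly_roots_finite) simp
  moreover have "S \<subseteq> {s. poly (p - q) s = 0}"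
    using assms(2) by auto
  ultimately show False
    using assms(1) finite_subset by blast
qed

definition poly_map :: "('k::field \<Rightarrow> 'k) \<Rightarrow> bool" where
  "poly_map \<phi> \<longleftrightarrow> (\<exists>p. \<forall>s. \<phi> s = poly p s)"

lemma poly_map_const: "poly_map (\<lambda>s. c)"
  unfolding poly_map_def by (intro exI[of _ "[:c:]"]) simp

lemma poly_map_ident: "poly_map (\<lambda>s. s)"
  unfolding poly_map_def by (intro exI[of _ "[:0, 1:]"]) simp

lemma poly_map_add: "poly_map \<phi> \<Longrightarrow> poly_map \<psi> \<Longrightarrow> poly_map (\<lambda>s. \<phi> s + \<psi> s)"
  unfolding poly_map_def by (metis poly_add)

lemma poly_map_diff: "poly_map \<phi> \<Longrightarrow> poly_map \<psi> \<Longrightarrow> poly_map (\<lambda>s. \<phi> s - \<psi> s)"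
  unfolding poly_map_def by (metis poly_diff)

lemma poly_map_mult: "poly_map \<phi> \<Longrightarrow> poly_map \<psi> \<Longrightarrow> poly_map (\<lambda>s. \<phi> s * \<psi> s)"
  unfolding poly_map_def by (metis poly_mult)

lemma poly_map_power: "poly_map \<phi> \<Longrightarrow> poly_map (\<lambda>s. \<phi> s ^ k)"
  unfolding poly_map_def by (metis poly_power)

lemma poly_map_sum: "(\<And>a. a \<in> A \<Longrightarrow> poly_map (\<phi> a)) \<Longrightarrow> poly_map (\<lambda>s. \<Sum>a\<in>A. \<phi> a s)"
  by (induction A rule: infinite_finite_induct) (auto intro: poly_map_const poly_map_add)

lemma poly_map_prod: "(\<And>a. a \<in> A \<Longrightarrow> poly_map (\<phi> a)) \<Longrightarrow> poly_map (\<lambda>s. \<Prod>a\<in>A. \<phi> a s)"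
  by (induction A rule: infinite_finite_induct) (auto intro: poly_map_const poly_map_mult)

lemmas poly_map_intros =
  poly_map_const poly_map_ident poly_map_add poly_map_diff poly_map_mult poly_map_power
  poly_map_sum poly_map_prod

text \<open>The product of the two polynomials vanishes at every point, hence is zero because the
  field is infinite, and k[t] is a domain.\<close>

lemma poly_map_zero:
  assumes inf: "infinite (UNIV :: 'k::field set)"
    and "poly_map \<phi>" "poly_map \<delta>" "\<delta> t \<noteq> 0" and "\<And>s::'k. \<delta> s \<noteq> 0 \<Longrightarrow> \<phi> s = 0"
  shows "\<phi> s = 0"
proof -
  obtain p d where p: "\<And>s. \<phi> s = poly p s" and d: "\<And>s. \<delta> s = poly d s"
    using assms(2,3) unfolding poly_map_def by blast
  have "p * d = 0"
    by (rule poly_eqI_infinite[OF inf]) (use assms(5) in \<open>auto simp: p d\<close>)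
  moreover have "d \<noteq> 0"
    using assms(4) d by auto
  ultimately show ?thesis
    by (simp add: p)
qed

definition poly_curve :: "nat \<Rightarrow> ('k::field \<Rightarrow> 'k mat) \<Rightarrow> bool" where
  "poly_curve N X \<longleftrightarrow> (\<forall>i < N. \<forall>j < N. poly_map (\<lambda>s. X s $$ (i, j)))"

lemma poly_curve_entry: "poly_curve N X \<Longrightarrow> i < N \<Longrightarrow> j < N \<Longrightarrow> poly_map (\<lambda>s. X s $$ (i, j))"
  by (simp add: poly_curve_def)

lemma poly_curveI:
  "(\<And>i j. i < N \<Longrightarrow> j < N \<Longrightarrow> poly_map (\<lambda>s. X s $$ (i, j))) \<Longrightarrow> poly_curve N X"
  by (simp add: poly_curve_def)

lemma polyfun_poly_map: "P \<in> polyfun N \<Longrightarrow> poly_curve N X \<Longrightarrow> poly_map (\<lambda>s. P (X s))"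
  by (induction rule: polyfun.induct) (auto intro: poly_map_intros poly_curve_entry)

lemma polyfun_curve:
  assumes "P \<in> polyfun N" and "poly_curve N X"
  shows "\<exists>p. \<forall>s. P (X s) = poly p s"
  using polyfun_poly_map[OF assms] unfolding poly_map_def .

text \<open>Stands in for irreducibility: the curve may leave the locus where \<open>D\<close> is
  nonzero, but one good parameter \<open>t\<close> suffices. It is applied with the point of
  interest at parameter 0.\<close>

lemma polyfun_zero_on_curve:
  assumes inf: "infinite (UNIV :: 'k::field set)"
    and P: "P \<in> polyfun N" and D: "D \<in> polyfun N" and X: "poly_curve N (X :: 'k \<Rightarrow> 'k mat)"
    and nz: "D (X t) \<noteq> 0" and zero: "\<And>s. D (X s) \<noteq> 0 \<Longrightarrow> P (X s) = 0"
  shows "P (X s) = 0"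
  using poly_map_zero[OF inf polyfun_poly_map[OF P X] polyfun_poly_map[OF D X] nz] zero by blast

lemma poly_curve_line:
  assumes "A \<in> carrier_mat N N" "C \<in> carrier_mat N N"
  shows "poly_curve N (\<lambda>s. A + s \<cdot>\<^sub>m C)"
proof (rule poly_curveI)
  fix i j assume "i < N" "j < N"
  then have "(\<lambda>s. (A + s \<cdot>\<^sub>m C) $$ (i, j)) = (\<lambda>s. A $$ (i, j) + s * C $$ (i, j))"
    using assms by auto
  then show "poly_map (\<lambda>s. (A + s \<cdot>\<^sub>m C) $$ (i, j))"
    by (simp only:) (intro poly_map_intros)
qed

section \<open>Polynomials vanishing on singular matrices\<close>

text \<open>Besides picking leading minors, this fixes the size: as a function on all matrices
  \<open>det X\<close> depends on the dimension of \<open>X\<close>, while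
  \<open>det (blk N X)\<close> is in \<open>polyfun N\<close> and agrees with it on \<open>N\<close>
  by \<open>N\<close> matrices.\<close>

definition blk :: "nat \<Rightarrow> 'k mat \<Rightarrow> 'k mat" where
  "blk l X = mat l l (\<lambda>(i, j). X $$ (i, j))"

lemma blk_carrier [simp]: "blk l X \<in> carrier_mat l l"
  by (simp add: blk_def)

lemma blk_dim [simp]: "dim_row (blk l X) = l" "dim_col (blk l X) = l"
  by (simp_all add: blk_def)

lemma blk_index [simp]: "i < l \<Longrightarrow> j < l \<Longrightarrow> blk l X $$ (i, j) = X $$ (i, j)"
  by (simp add: blk_def)

lemma blk_self: "X \<in> carrier_mat l l \<Longrightarrow> blk l X = X"
  by (rule eq_matI) auto

lemma polyfun_det_blk: "l \<le> N \<Longrightarrow> (\<lambda>X. det (blk l X)) \<in> polyfun N"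
  by (rule polyfun_det[of _ l]) (auto intro: polyfun.intros)

lemma mult_mat_index:
  assumes "A \<in> carrier_mat n l" "B \<in> carrier_mat l p" "i < n" "j < p"
  shows "(A * B) $$ (i, j) = (\<Sum>k<l. A $$ (i, k) * B $$ (k, j))"
  using assms by (auto simp: scalar_prod_def atLeast0LessThan)

lemma poly_curve_mult:
  assumes "poly_curve N X" "poly_curve N Y"
    and "\<And>s. X s \<in> carrier_mat N N" "\<And>s. Y s \<in> carrier_mat N N"
  shows "poly_curve N (\<lambda>s. X s * Y s)"
proof (rule poly_curveI)
  fix i j assume "i < N" "j < N"
  then have "(X s * Y s) $$ (i, j) = (\<Sum>k<N. X s $$ (i, k) * Y s $$ (k, j))" for s
    using mult_mat_index[OF assms(3,4)] by blast
  then show "poly_map (\<lambda>s. (X s * Y s) $$ (i, j))"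
    using \<open>i < N\<close> \<open>j < N\<close> assms(1,2)
    by (simp only:) (auto intro!: poly_map_sum poly_map_mult poly_curve_entry)
qed

lemma polyfun_mult_right:
  assumes P: "P \<in> polyfun N" and g: "g \<in> carrier_mat N N"
  shows "\<exists>Q \<in> polyfun N. \<forall>X \<in> carrier_mat N N. P (X * g) = Q X"
proof
  let ?M = "\<lambda>X. mat N N (\<lambda>(i, j). \<Sum>k<N. X $$ (i, k) * g $$ (k, j))"
  show "(\<lambda>X. P (?M X)) \<in> polyfun N"
  proof (rule polyfun_comp[OF P])
    fix i j assume "i < N" "j < N"
    then show "(\<lambda>X. ?M X $$ (i, j)) \<in> polyfun N"
      by (simp, intro polyfun_sum, intro polyfun.mult polyfun.entry polyfun.const) auto
  qed
  have "?M X = X * g" if X: "X \<in> carrier_mat N N" for X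
    by (rule eq_matI) (use X g mult_mat_index[OF X g] in auto)
  then show "\<forall>X \<in> carrier_mat N N. P (X * g) = P (?M X)"
    by simp
qed

lemma det_zero_iff_right:
  fixes A :: "'k::field mat"
  assumes A: "A \<in> carrier_mat n n"
  shows "det A = 0 \<longleftrightarrow>
    (\<exists>v. (\<exists>i<n. v i \<noteq> 0) \<and> (\<forall>i<n. (\<Sum>j<n. A $$ (i, j) * v j) = 0))"
proof
  assume "det A = 0"
  then obtain v where v: "v \<in> carrier_vec n" "v \<noteq> 0\<^sub>v n" "A *\<^sub>v v = 0\<^sub>v n"
    using det_0_iff_vec_prod_zero_field[OF A] by auto
  have "(\<Sum>j<n. A $$ (i, j) * v $ j) = 0" if "i < n" for i
  proof -
    have "(A *\<^sub>v v) $ i = (\<Sum>j<n. A $$ (i, j) * v $ j)"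
      using A v(1) that by (auto simp: scalar_prod_def atLeast0LessThan)
    then show ?thesis using v(3) that by simp
  qed
  moreover have "\<exists>i<n. v $ i \<noteq> 0"
    using v(1,2) by (metis carrier_vecD eq_vecI index_zero_vec)
  ultimately show "\<exists>v. (\<exists>i<n. v i \<noteq> 0) \<and> (\<forall>i<n. (\<Sum>j<n. A $$ (i, j) * v j) = 0)"
    by (intro exI[of _ "\<lambda>i. v $ i"]) auto
next
  assume "\<exists>v. (\<exists>i<n. v i \<noteq> 0) \<and> (\<forall>i<n. (\<Sum>j<n. A $$ (i, j) * v j) = 0)"
  then obtain v where v: "\<exists>i<n. v i \<noteq> 0" "\<forall>i<n. (\<Sum>j<n. A $$ (i, j) * v j) = 0" by blast
  have "A *\<^sub>v vec n v = 0\<^sub>v n"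
    using A v(2) by (intro eq_vecI) (auto simp: scalar_prod_def atLeast0LessThan)
  moreover have "vec n v \<noteq> 0\<^sub>v n"
    using v(1) by (metis index_vec index_zero_vec(1))
  ultimately show "det A = 0"
    using det_0_iff_vec_prod_zero_field[OF A] by (metis vec_carrier)
qed

lemma det_zero_iff_left:
  fixes A :: "'k::field mat"
  assumes A: "A \<in> carrier_mat n n"
  shows "det A = 0 \<longleftrightarrow>
    (\<exists>v. (\<exists>i<n. v i \<noteq> 0) \<and> (\<forall>j<n. (\<Sum>i<n. v i * A $$ (i, j)) = 0))"
proof -
  have "(\<Sum>j<n. transpose_mat A $$ (i, j) * v j) = (\<Sum>j<n. v j * A $$ (j, i))" if "i < n" for i v
    using A that by (intro sum.cong) (auto simp: mult.commute)
  then show ?thesis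
    using det_zero_iff_right[of "transpose_mat A" n] A by (simp add: det_transpose[OF A])
qed

lemma poly_sum_le:
  fixes p :: "'a::comm_semiring_1 poly"
  assumes "degree p \<le> d"
  shows "poly p t = (\<Sum>j\<le>d. coeff p j * t ^ j)"
  unfolding poly_altdef
  by (rule sum.mono_neutral_left) (use assms in \<open>auto simp: coeff_eq_0\<close>)

text \<open>The entry in position \<open>(l, l)\<close> is made the variable \<open>t\<close>: the
  leading minor of size \<open>Suc l\<close> is affine in it, with the minor of size
  \<open>l\<close> as slope. The value \<open>t = 0\<close> gives the constant term.\<close>

definition zero_entry :: "nat \<Rightarrow> nat \<Rightarrow> 'k::field mat \<Rightarrow> 'k \<Rightarrow> 'k mat" where
  "zero_entry m l X t = mat m m (\<lambda>(i, j). if i = l \<and> j = l then t else X $$ (i, j))"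

lemma zero_entry_carrier [simp]: "zero_entry m l X t \<in> carrier_mat m m"
  by (simp add: zero_entry_def)

lemma zero_entry_dim [simp]: "dim_row (zero_entry m l X t) = m" "dim_col (zero_entry m l X t) = m"
  by (simp_all add: zero_entry_def)

lemma zero_entry_index [simp]:
  "i < m \<Longrightarrow> j < m \<Longrightarrow> zero_entry m l X t $$ (i, j) = (if i = l \<and> j = l then t else X $$ (i, j))"
  by (simp add: zero_entry_def)

lemma polyfun_zero_entry:
  assumes "P \<in> polyfun m"
  shows "(\<lambda>X. P (zero_entry m l X t)) \<in> polyfun m"
proof (rule polyfun_comp[OF assms])
  fix i j assume "i < m" "j < m"
  then show "(\<lambda>X. zero_entry m l X t $$ (i, j)) \<in> polyfun m"
    by (cases "i = l \<and> j = l") (auto intro: polyfun.intros)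
qed

definition poly_coeffs :: "nat \<Rightarrow> ('k::field mat \<Rightarrow> 'k poly) \<Rightarrow> bool" where
  "poly_coeffs N \<Phi> \<longleftrightarrow> (\<exists>D. \<forall>X. degree (\<Phi> X) \<le> D) \<and> (\<forall>j. (\<lambda>X. coeff (\<Phi> X) j) \<in> polyfun N)"

lemma poly_coeffs_monom:
  assumes "P \<in> polyfun N"
  shows "poly_coeffs N (\<lambda>X. monom (P X) k)"
proof -
  have "(\<lambda>X. coeff (monom (P X) k) j) \<in> polyfun N" for j
    using assms by (cases "j = k") (auto intro: polyfun.intros)
  then show ?thesis
    using degree_monom_le by (auto simp: poly_coeffs_def)
qed

lemma poly_coeffs_add:
  assumes "poly_coeffs N \<Phi>" "poly_coeffs N \<Psi>"
  shows "poly_coeffs N (\<lambda>X. \<Phi> X + \<Psi> X)"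
proof -
  obtain D E where "\<And>X. degree (\<Phi> X) \<le> D" "\<And>X. degree (\<Psi> X) \<le> E"
    using assms by (auto simp: poly_coeffs_def)
  then have "degree (\<Phi> X + \<Psi> X) \<le> max D E" for X
    by (meson degree_add_le max.coboundedI1 max.coboundedI2)
  then show ?thesis
    using assms by (auto simp: poly_coeffs_def intro: polyfun.add)
qed

lemma poly_coeffs_mult:
  assumes "poly_coeffs N \<Phi>" "poly_coeffs N \<Psi>"
  shows "poly_coeffs N (\<lambda>X. \<Phi> X * \<Psi> X)"
proof -
  obtain D E where "\<And>X. degree (\<Phi> X) \<le> D" "\<And>X. degree (\<Psi> X) \<le> E"
    using assms by (auto simp: poly_coeffs_def)
  then have "degree (\<Phi> X * \<Psi> X) \<le> D + E" for X
    by (meson degree_mult_le add_mono le_trans)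
  moreover have "(\<lambda>X. coeff (\<Phi> X * \<Psi> X) j) \<in> polyfun N" for j
    unfolding coeff_mult using assms
    by (intro polyfun_sum polyfun.mult) (auto simp: poly_coeffs_def)
  ultimately show ?thesis
    by (auto simp: poly_coeffs_def)
qed

text \<open>With \<open>\<delta> = 1\<close> the factor \<open>c ^ d\<close> clears negative powers of \<open>c\<close>; with \<open>\<delta> = 0\<close> it is absent.\<close>

lemma polyfun_expand:
  fixes P :: "'k::field mat \<Rightarrow> 'k"
  assumes "P \<in> polyfun N" and p: "\<And>i j. i < N \<Longrightarrow> j < N \<Longrightarrow> p i j \<in> polyfun N'"
    and M: "\<And>X c i j. X \<in> S \<Longrightarrow> c \<in> T \<Longrightarrow> i < N \<Longrightarrow> j < N \<Longrightarrow>
      c ^ \<delta> * M X c $$ (i, j) = p i j X * c ^ e i j"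
  shows "\<exists>\<Phi> d. poly_coeffs N' \<Phi> \<and> (\<forall>X \<in> S. \<forall>c \<in> T. c ^ (\<delta> * d) * P (M X c) = poly (\<Phi> X) c)"
  using assms(1)
proof induction
  case (const a)
  show ?case
    by (rule exI[of _ "\<lambda>X. monom a 0"], rule exI[of _ 0])
      (simp add: poly_coeffs_monom polyfun.const poly_monom)
next
  case (entry i j)
  then show ?case
    by (intro exI[of _ "\<lambda>X. monom (p i j X) (e i j)"] exI[of _ 1])
      (simp add: poly_coeffs_monom p M poly_monom)
next
  case (add P Q)
  then obtain \<Phi> d \<Psi> d' where *: "poly_coeffs N' \<Phi>" "poly_coeffs N' \<Psi>"
    "\<And>X c. X \<in> S \<Longrightarrow> c \<in> T \<Longrightarrow> c ^ (\<delta> * d) * P (M X c) = poly (\<Phi> X) c"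
    "\<And>X c. X \<in> S \<Longrightarrow> c \<in> T \<Longrightarrow> c ^ (\<delta> * d') * Q (M X c) = poly (\<Psi> X) c" by blast
  let ?\<Phi> = "\<lambda>X. monom 1 (\<delta> * d') * \<Phi> X + monom 1 (\<delta> * d) * \<Psi> X"
  have "poly_coeffs N' ?\<Phi>"
    by (intro poly_coeffs_add poly_coeffs_mult poly_coeffs_monom polyfun.const *)
  moreover have "c ^ (\<delta> * (d + d')) * (P (M X c) + Q (M X c)) = poly (?\<Phi> X) c"
    if "X \<in> S" "c \<in> T" for X c
    unfolding poly_add poly_mult poly_monom *(3)[OF that, symmetric] *(4)[OF that, symmetric]
    by (simp add: power_add algebra_simps)
  ultimately show ?case by blast
next
  case (mult P Q)
  then obtain \<Phi> d \<Psi> d' where *: "poly_coeffs N' \<Phi>" "poly_coeffs N' \<Psi>"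
    "\<And>X c. X \<in> S \<Longrightarrow> c \<in> T \<Longrightarrow> c ^ (\<delta> * d) * P (M X c) = poly (\<Phi> X) c"
    "\<And>X c. X \<in> S \<Longrightarrow> c \<in> T \<Longrightarrow> c ^ (\<delta> * d') * Q (M X c) = poly (\<Psi> X) c" by blast
  have "c ^ (\<delta> * (d + d')) * (P (M X c) * Q (M X c)) = poly (\<Phi> X * \<Psi> X) c"
    if "X \<in> S" "c \<in> T" for X c
    unfolding poly_mult *(3)[OF that, symmetric] *(4)[OF that, symmetric]
    by (simp add: power_add algebra_simps)
  then show ?case using poly_coeffs_mult[OF *(1,2)] by blast
qed

lemma det_blk_Suc_expand:
  fixes X :: "'k::field mat"
  assumes "Suc l \<le> m"
  shows "det (blk (Suc l) (zero_entry m l X t)) =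
    det (blk l X) * t + det (blk (Suc l) (zero_entry m l X 0))"
proof -
  let ?A = "\<lambda>t. blk (Suc l) (zero_entry m l X t)"
  have exp: "det (?A t) = (\<Sum>j<Suc l. ?A t $$ (l, j) * cofactor (?A t) l j)" for t
    by (rule laplace_expansion_row) auto
  have del: "mat_delete (?A t) l j = mat_delete (?A 0) l j" if "j < Suc l" for j t
    by (rule eq_matI) (use that assms in \<open>auto simp: mat_delete_def blk_def\<close>)
  have dl: "mat_delete (?A 0) l l = blk l X"
    by (rule eq_matI) (use assms in \<open>auto simp: mat_delete_def blk_def\<close>)
  have cof: "cofactor (?A t) l j = cofactor (?A 0) l j" if "j < Suc l" for j t
    unfolding cofactor_def del[OF that, of t] ..
  have cl: "cofactor (?A 0) l l = det (blk l X)"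
    unfolding cofactor_def dl by simp
  have "det (?A t) = (\<Sum>j<l. X $$ (l, j) * cofactor (?A 0) l j) + t * det (blk l X)" for t
  proof -
    have "det (?A t) = (\<Sum>j<l. ?A t $$ (l, j) * cofactor (?A 0) l j) + ?A t $$ (l, l) * cofactor (?A 0) l l"
    proof -
      have "det (?A t) = (\<Sum>j<Suc l. ?A t $$ (l, j) * cofactor (?A 0) l j)"
        unfolding exp[of t] by (rule sum.cong[OF refl], subst cof[of _ t]) auto
      then show ?thesis by (simp only: sum.lessThan_Suc)
    qed
    also have "(\<Sum>j<l. ?A t $$ (l, j) * cofactor (?A 0) l j) = (\<Sum>j<l. X $$ (l, j) * cofactor (?A 0) l j)"
      using assms by (intro sum.cong) auto
    also have "?A t $$ (l, l) = t"
      using assms by simp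
    finally show ?thesis by (simp only: cl)
  qed
  from this[of t] this[of 0] show ?thesis
    by (simp add: mult.commute)
qed

lemma zero_entry_self: "X \<in> carrier_mat m m \<Longrightarrow> zero_entry m l X (X $$ (l, l)) = X"
  by (rule eq_matI) auto

lemma det_blk_one: "l \<le> m \<Longrightarrow> det (blk l (1\<^sub>m m :: 'k::field mat)) = 1"
proof -
  assume "l \<le> m"
  then have "blk l (1\<^sub>m m :: 'k mat) = 1\<^sub>m l"
    by (intro eq_matI) auto
  then show ?thesis by simp
qed

lemma polyfun_zero_det_blk:
  fixes X :: "'k::field mat"
  assumes inf: "infinite (UNIV :: 'k set)" and P: "P \<in> polyfun m" and l: "l \<le> m"
    and "\<And>X. X \<in> carrier_mat m m \<Longrightarrow> det (blk l X) \<noteq> 0 \<Longrightarrow> P X = 0"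
    and X: "X \<in> carrier_mat m m"
  shows "P X = 0"
proof -
  let ?X = "\<lambda>s. X + s \<cdot>\<^sub>m (1\<^sub>m m - X)"
  have c: "?X s \<in> carrier_mat m m" for s
    using X by auto
  have "?X 1 = 1\<^sub>m m"
    using X by (intro eq_matI) auto
  then have "P (?X 0) = 0"
    by (intro polyfun_zero_on_curve[OF inf P polyfun_det_blk[OF l], where X = ?X and t = 1 and s = 0]
        poly_curve_line)
      (use X assms(4) c in \<open>auto simp: det_blk_one[OF l]\<close>)
  moreover have "?X 0 = X"
    using X by (intro eq_matI) auto
  ultimately show ?thesis by simp
qed

text \<open>Inside the hypersurface \<open>det (blk l X) = 0\<close>, the points with \<open>det (blk (Suc l) X) \<noteq> 0\<close> are
  dense: a line through \<open>X\<close> along which a fixed kernel vector of \<open>blk l X\<close> survives reaches one.\<close>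

lemma polyfun_zero_singular_blk:
  fixes X :: "'k::field mat"
  assumes inf: "infinite (UNIV :: 'k set)" and Q: "Q \<in> polyfun m" and l: "Suc l \<le> m"
    and zero: "\<And>X. X \<in> carrier_mat m m \<Longrightarrow> det (blk l X) = 0 \<Longrightarrow> det (blk (Suc l) X) \<noteq> 0 \<Longrightarrow> Q X = 0"
    and X: "X \<in> carrier_mat m m" and sing: "det (blk l X) = 0"
  shows "Q X = 0"
proof -
  obtain w i0 where i0: "i0 < l" "w i0 \<noteq> 0"
    and w: "\<And>i. i < l \<Longrightarrow> (\<Sum>j<l. X $$ (i, j) * w j) = 0"
    using sing unfolding det_zero_iff_right[OF blk_carrier] by auto
  \<comment> \<open>In the first \<open>l\<close> columns row \<open>i0\<close> is zero and every
    other row \<open>k < l\<close> is \<open>w i0\<close> times the unit vector at \<open>k\<close>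
    minus \<open>w k\<close> times the one at \<open>i0\<close>, so \<open>w\<close> lies in the
    kernel. Rows \<open>i0\<close> and \<open>l\<close> use the columns \<open>l\<close> and
    \<open>i0\<close> to make the larger minor nonsingular.\<close>
  define Y :: "'k mat" where "Y = mat m m (\<lambda>(k, c).
    if k = i0 then (if c = l then 1 else 0)
    else if k < l then (if c = k then w i0 else if c = i0 then - w k else 0)
    else if k = l then (if c = i0 then 1 else 0) else 0)"
  have Y: "Y \<in> carrier_mat m m" by (simp add: Y_def)
  have "det (blk (Suc l) Y) \<noteq> 0"
  proof
    assume "det (blk (Suc l) Y) = 0"
    then obtain v i where i: "i < Suc l" "v i \<noteq> 0"
      and v: "\<And>k. k < Suc l \<Longrightarrow> (\<Sum>j<Suc l. Y $$ (k, j) * v j) = 0"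
      unfolding det_zero_iff_right[OF blk_carrier] by auto
    have "(\<Sum>j<Suc l. Y $$ (i0, j) * v j) = (\<Sum>j<Suc l. if j = l then v j else 0)"
      using l i0 by (intro sum.cong) (auto simp: Y_def)
    with v[of i0] i0 have vl: "v l = 0" by simp
    have "(\<Sum>j<Suc l. Y $$ (l, j) * v j) = (\<Sum>j<Suc l. if j = i0 then v j else 0)"
      using l i0 by (intro sum.cong) (auto simp: Y_def)
    with v[of l] i0 have vi0: "v i0 = 0" by simp
    have "v k = 0" if "k < l" "k \<noteq> i0" for k
    proof -
      have "(\<Sum>j<Suc l. Y $$ (k, j) * v j) = (\<Sum>j<Suc l. if j = k then w i0 * v j else 0)"
        using l i0 that vi0 by (intro sum.cong) (auto simp: Y_def)
      with v[of k] that i0 show ?thesis by simp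
    qed
    with vl vi0 i show False by (metis less_Suc_eq)
  qed
  let ?X = "\<lambda>s. X + s \<cdot>\<^sub>m (Y - X)"
  have c: "?X s \<in> carrier_mat m m" for s
    using X Y by auto
  have X1: "?X 1 = Y" and X0: "?X 0 = X"
    using X Y by (auto intro!: eq_matI)
  have Yw: "(\<Sum>j<l. Y $$ (i, j) * w j) = 0" if "i < l" for i
  proof (cases "i = i0")
    case True
    then show ?thesis using l that by (intro sum.neutral) (auto simp: Y_def)
  next
    case False
    have "(\<Sum>j<l. Y $$ (i, j) * w j) =
      (\<Sum>j<l. (if j = i then w i0 * w i else 0) + (if j = i0 then - w i * w i0 else 0))"
      using l that False i0 by (intro sum.cong) (auto simp: Y_def)
    also have "\<dots> = 0"
      using that i0 by (simp add: sum.distrib)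
    finally show ?thesis .
  qed
  have s0: "det (blk l (?X s)) = 0" for s
    unfolding det_zero_iff_right[OF blk_carrier]
  proof (intro exI conjI allI impI)
    show "i0 < l" "w i0 \<noteq> 0" using i0 by auto
    fix i assume i: "i < l"
    have "(\<Sum>j<l. blk l (?X s) $$ (i, j) * w j) =
      (\<Sum>j<l. X $$ (i, j) * w j) + s * ((\<Sum>j<l. Y $$ (i, j) * w j) - (\<Sum>j<l. X $$ (i, j) * w j))"
      unfolding sum_subtractf[symmetric] sum_distrib_left sum.distrib[symmetric]
      using i l X Y by (intro sum.cong) (auto simp: algebra_simps)
    then show "(\<Sum>j<l. blk l (?X s) $$ (i, j) * w j) = 0"
      using w[OF i] Yw[OF i] by simp
  qed
  have "Q (?X 0) = 0"
    by (intro polyfun_zero_on_curve[OF inf Q polyfun_det_blk[OF l], where X = ?X and t = 1 and s = 0]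
        poly_curve_line)
      (use X Y \<open>det (blk (Suc l) Y) \<noteq> 0\<close> X1 zero[OF c s0] in auto)
  then show ?thesis by (simp only: X0)
qed

text \<open>Pseudo-division in the entry \<open>(l, l)\<close>, in which the minor of size
  \<open>Suc l\<close> is \<open>?D * t + R\<close>. Dividing \<open>P\<close> by it costs powers of
  the smaller minor \<open>?D\<close>; these are cancelled one by one with the induction hypothesis,
  because the larger minor is nonzero on a dense part of the locus \<open>?D = 0\<close>.\<close>

lemma polyfun_det_dvd:
  fixes P :: "'k::field mat \<Rightarrow> 'k"
  assumes inf: "infinite (UNIV :: 'k set)" and "l \<le> m" and "P \<in> polyfun m"
    and "\<And>X. X \<in> carrier_mat m m \<Longrightarrow> det (blk l X) = 0 \<Longrightarrow> P X = 0"
  shows "\<exists>Q \<in> polyfun m. \<forall>X \<in> carrier_mat m m. P X = det (blk l X) * Q X"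
  using assms(2-)
proof (induction l arbitrary: P)
  case 0
  have "det (blk 0 X) = 1" for X :: "'k mat"
    by (rule det_dim_zero) simp
  then show ?case using "0.prems"(2) by auto
next
  case (Suc l)
  note IH = Suc.IH
  let ?D = "\<lambda>X. det (blk l X)" and ?E = "\<lambda>X. det (blk (Suc l) X)"
  define R where "R X = ?E (zero_entry m l X 0)" for X :: "'k mat"
  have l: "l < m" "l \<le> m" using Suc.prems by auto
  have D: "?D \<in> polyfun m" and E: "?E \<in> polyfun m"
    using Suc.prems(1) by (auto intro: polyfun_det_blk)
  have R: "R \<in> polyfun m"
    using polyfun_zero_entry[OF E] unfolding R_def .
  have ER: "?E (zero_entry m l X t) = ?D X * t + R X" for X t
    using det_blk_Suc_expand[OF Suc.prems(1)] unfolding R_def .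
  have "\<exists>\<Phi> d. poly_coeffs m \<Phi> \<and> (\<forall>X \<in> UNIV. \<forall>t \<in> UNIV.
      t ^ (0 * d) * P (zero_entry m l X t) = poly (\<Phi> X) t)"
    by (rule polyfun_expand[OF Suc.prems(2), where e = "\<lambda>i j. if i = l \<and> j = l then 1 else 0"
          and p = "\<lambda>i j. if i = l \<and> j = l then (\<lambda>X. 1) else (\<lambda>X. X $$ (i, j))"])
      (auto intro: polyfun.intros)
  then obtain \<Phi> where \<Phi>: "poly_coeffs m \<Phi>" "\<And>X t. P (zero_entry m l X t) = poly (\<Phi> X) t"
    by auto
  then obtain d where d: "\<And>X. degree (\<Phi> X) \<le> d"
    by (auto simp: poly_coeffs_def)
  define c where "c j X = coeff (\<Phi> X) j" for j X
  have c: "c j \<in> polyfun m" for j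
    using \<Phi>(1) unfolding c_def poly_coeffs_def by blast
  have Pc: "P (zero_entry m l X t) = (\<Sum>j\<le>d. c j X * t ^ j)" for X t
    unfolding \<Phi>(2) c_def by (rule poly_sum_le[OF d])
  \<comment> \<open>Up to the factor \<open>?D ^ d\<close>, this is the value of \<open>P\<close> at
    the root \<open>t = - R / ?D\<close> of the minor, where \<open>P\<close> vanishes; density of
    the locus where \<open>?D\<close> is nonzero extends this to all matrices.\<close>
  define r where "r X = (\<Sum>j\<le>d. c j X * ?D X ^ (d - j) * (- R X) ^ j)" for X
  have r: "r \<in> polyfun m"
    unfolding r_def by (intro polyfun_sum polyfun.mult polyfun_power polyfun_uminus c D R)
  have r0: "r X = 0" if "X \<in> carrier_mat m m" for X
  proof (rule polyfun_zero_det_blk[OF inf r l(2) _ that])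
    fix X :: "'k mat" assume "?D X \<noteq> 0"
    then have "P (zero_entry m l X (- R X / ?D X)) = 0"
      by (intro Suc.prems(3)) (auto simp: ER)
    then have "0 = ?D X ^ d * (\<Sum>j\<le>d. c j X * (- R X / ?D X) ^ j)"
      by (simp only: Pc) simp
    also have "\<dots> = r X"
      unfolding r_def sum_distrib_left
    proof (rule sum.cong)
      fix j assume "j \<in> {..d}"
      then have 1: "?D X ^ d = ?D X ^ (d - j) * ?D X ^ j"
        by (simp add: power_add[symmetric])
      have 2: "(- R X) ^ j = ?D X ^ j * (- R X / ?D X) ^ j"
        using \<open>?D X \<noteq> 0\<close> by (simp add: power_mult_distrib[symmetric])
      show "?D X ^ d * (c j X * (- R X / ?D X) ^ j) = c j X * ?D X ^ (d - j) * (- R X) ^ j"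
        unfolding 1 2 by (simp only: ac_simps)
    qed simp
    finally show "r X = 0" by simp
  qed
  \<comment> \<open>\<open>?D ^ d * P\<close> and \<open>r\<close> are the same expression in
    \<open>?D * t = ?E - R\<close> and in \<open>- R\<close>; equal powers of these differ by a
    multiple of \<open>?E\<close>, and this is the quotient.\<close>
  define Q0 where "Q0 X = (\<Sum>j\<le>d. c j X * ?D X ^ (d - j) *
    (\<Sum>i<j. (- R X) ^ (j - Suc i) * (?E X - R X) ^ i))" for X
  have Q0: "Q0 \<in> polyfun m"
    unfolding Q0_def
    by (intro polyfun_sum polyfun.mult polyfun_power polyfun_diff polyfun_uminus c D R E)
  have DP: "?D X ^ d * P X = ?E X * Q0 X" if X: "X \<in> carrier_mat m m" for X
  proof -
    let ?t = "X $$ (l, l)"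
    have Dt: "?D X * ?t = ?E X - R X"
      using ER[of X ?t] by (simp add: zero_entry_self[OF X])
    have "?D X ^ d * P X = (\<Sum>j\<le>d. c j X * ?D X ^ (d - j) * (?D X * ?t) ^ j)"
      unfolding Pc[of X ?t, unfolded zero_entry_self[OF X]] sum_distrib_left
    proof (rule sum.cong)
      fix j assume "j \<in> {..d}"
      then have "?D X ^ d = ?D X ^ (d - j) * ?D X ^ j"
        by (simp add: power_add[symmetric])
      then show "?D X ^ d * (c j X * ?t ^ j) = c j X * ?D X ^ (d - j) * (?D X * ?t) ^ j"
        by (simp add: power_mult_distrib)
    qed simp
    also have "\<dots> - r X = (\<Sum>j\<le>d. c j X * ?D X ^ (d - j) * ((?E X - R X) ^ j - (- R X) ^ j))"
      by (simp only: r_def Dt sum_subtractf[symmetric] right_diff_distrib)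
    also have "\<dots> = ?E X * Q0 X"
      unfolding Q0_def sum_distrib_left[of "?E X"]
    proof (rule sum.cong)
      fix j
      have "(?E X - R X) ^ j - (- R X) ^ j =
          ?E X * (\<Sum>i<j. (- R X) ^ (j - Suc i) * (?E X - R X) ^ i)"
        by (subst power_diff_sumr2) simp
      then show "c j X * ?D X ^ (d - j) * ((?E X - R X) ^ j - (- R X) ^ j) = ?E X * (c j X *
          ?D X ^ (d - j) * (\<Sum>i<j. (- R X) ^ (j - Suc i) * (?E X - R X) ^ i))"
        by (simp only: mult.left_commute)
    qed simp
    finally show ?thesis using r0[OF X] by simp
  qed
  have "\<exists>Q \<in> polyfun m. \<forall>X \<in> carrier_mat m m. P X = ?E X * Q X"
    if "Q \<in> polyfun m" "\<forall>X \<in> carrier_mat m m. ?D X ^ e * P X = ?E X * Q X" for e Q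
    using that
  proof (induction e arbitrary: Q)
    case 0
    then show ?case by auto
  next
    case (Suc e)
    \<comment> \<open>On \<open>?D = 0\<close> the product \<open>?E * Q\<close> vanishes and
      \<open>?E\<close> is nonzero on a dense part, so \<open>Q\<close> vanishes there too and is
      divisible by \<open>?D\<close>.\<close>
    have van: "Q X = 0" if "X \<in> carrier_mat m m" "?D X = 0" for X
    proof (rule polyfun_zero_singular_blk[OF inf Suc.prems(1) \<open>Suc l \<le> m\<close> _ that])
      fix X :: "'k mat" assume "X \<in> carrier_mat m m" "?D X = 0" "?E X \<noteq> 0"
      then show "Q X = 0" using Suc.prems(2) by auto
    qed
    have "\<exists>Q' \<in> polyfun m. \<forall>X \<in> carrier_mat m m. Q X = ?D X * Q' X"
      by (rule IH[OF l(2) Suc.prems(1)]) (rule van)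
    then obtain Q' where Q': "Q' \<in> polyfun m" "\<forall>X \<in> carrier_mat m m. Q X = ?D X * Q' X"
      by blast
    have "?D X ^ e * P X - ?E X * Q' X = 0" if "X \<in> carrier_mat m m" for X
    proof (rule polyfun_zero_det_blk[OF inf _ l(2) _ that])
      show "(\<lambda>X. ?D X ^ e * P X - ?E X * Q' X) \<in> polyfun m"
        by (intro polyfun_diff polyfun.mult polyfun_power D E Q' \<open>P \<in> polyfun m\<close>)
      fix X :: "'k mat" assume "X \<in> carrier_mat m m" "?D X \<noteq> 0"
      moreover from this have "?D X * (?D X ^ e * P X) = ?D X * (?E X * Q' X)"
        using Suc.prems(2) Q'(2) by (auto simp: algebra_simps)
      ultimately show "?D X ^ e * P X - ?E X * Q' X = 0" by simp
    qed
    then show ?case using Suc.IH[OF Q'(1)] by auto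
  qed
  from this[OF Q0, of d] DP show ?case by blast
qed

section \<open>Coordinate rings\<close>

lemma nonsingular_inverse:
  fixes X :: "'k::field mat"
  assumes "X \<in> carrier_mat N N" "det X \<noteq> 0"
  obtains Y where "Y \<in> carrier_mat N N" "X * Y = 1\<^sub>m N" "Y * X = 1\<^sub>m N"
  using det_non_zero_imp_unit[OF assms, of "()"] that by (auto simp: Units_def ring_mat_def)

lemma GL_iff: "X \<in> GL N \<longleftrightarrow> X \<in> carrier_mat N N \<and> det (X :: 'k::field mat) \<noteq> 0"
proof
  assume "X \<in> GL N"
  then obtain Y where X: "X \<in> carrier_mat N N" and XY: "X * Y = 1\<^sub>m N" "Y * X = 1\<^sub>m (dim_row Y)"
    by (auto simp: GL_def invertible_mat_def inverts_mat_def)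
  have "Y \<in> carrier_mat N N"
    using X arg_cong[OF XY(1), of dim_col] arg_cong[OF XY(2), of dim_col] by auto
  then have "det X * det Y = 1"
    using det_mult[OF X] XY(1) by (metis det_one)
  then show "X \<in> carrier_mat N N \<and> det X \<noteq> 0"
    using X by auto
next
  assume X: "X \<in> carrier_mat N N \<and> det X \<noteq> 0"
  then obtain Y where "Y \<in> carrier_mat N N" "X * Y = 1\<^sub>m N" "Y * X = 1\<^sub>m N"
    using nonsingular_inverse by blast
  then show "X \<in> GL N"
    using X by (auto simp: GL_def invertible_mat_def inverts_mat_def)
qed

lemma coord_ring_outside: "f \<in> coord_ring N G \<Longrightarrow> X \<notin> G \<Longrightarrow> f X = 0"
  by (induction rule: coord_ring.induct) (auto simp: restr_def)

lemma restr_add: "restr G (\<lambda>X. f X + h X) = (\<lambda>X. restr G f X + restr G h X)"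
  and restr_mult: "restr G (\<lambda>X. f X * h X) = (\<lambda>X. restr G f X * restr G h X)"
  by (auto simp: restr_def)

lemma polyfun_restr:
  assumes "P \<in> polyfun N"
  shows "restr G P \<in> coord_ring N G"
  using assms
proof induction
  case (add P Q)
  show ?case unfolding restr_add by (rule coord_ring.add[OF add.IH])
next
  case (mult P Q)
  show ?case unfolding restr_mult by (rule coord_ring.mult[OF mult.IH])
qed (auto intro: coord_ring.intros)

lemma coord_ring_numerator:
  fixes f :: "'k::field mat \<Rightarrow> 'k"
  assumes "G \<subseteq> GL N" and "f \<in> coord_ring N G"
  shows "\<exists>P \<in> polyfun N. \<exists>k. \<forall>X \<in> G. f X * det X ^ k = P X"
  using assms(2)
proof induction
  case (const c)
  show ?case
    by (intro bexI[of _ "\<lambda>X. c"] exI[of _ 0]) (auto simp: restr_def intro: polyfun.intros)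
next
  case (entry i j)
  then show ?case
    by (intro bexI[of _ "\<lambda>X. X $$ (i, j)"] exI[of _ 0]) (auto simp: restr_def intro: polyfun.intros)
next
  case inv_det
  show ?case
    using assms(1)
    by (intro bexI[of _ "\<lambda>X. 1"] exI[of _ 1]) (auto simp: restr_def GL_iff intro: polyfun.intros)
next
  case (add f h)
  then obtain P k Q l where *: "P \<in> polyfun N" "\<forall>X\<in>G. f X * det X ^ k = P X"
    "Q \<in> polyfun N" "\<forall>X\<in>G. h X * det X ^ l = Q X" by blast
  have "(\<lambda>X. P X * det (blk N X) ^ l + Q X * det (blk N X) ^ k) \<in> polyfun N"
    by (intro polyfun.intros polyfun_power polyfun_det_blk *) auto
  moreover have "(f X + h X) * det X ^ (k + l) = P X * det (blk N X) ^ l + Q X * det (blk N X) ^ k"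
    if "X \<in> G" for X
  proof -
    have "blk N X = X"
      using that assms(1) by (intro blk_self) (auto simp: GL_iff)
    then show ?thesis
      using *(2,4) that by (auto simp: power_add algebra_simps)
  qed
  ultimately show ?case
    by (intro bexI[of _ "\<lambda>X. P X * det (blk N X) ^ l + Q X * det (blk N X) ^ k"] exI[of _ "k + l"]) auto
next
  case (mult f h)
  then obtain P k Q l where *: "P \<in> polyfun N" "\<forall>X\<in>G. f X * det X ^ k = P X"
    "Q \<in> polyfun N" "\<forall>X\<in>G. h X * det X ^ l = Q X" by blast
  have "f X * h X * det X ^ (k + l) = P X * Q X" if "X \<in> G" for X
    using *(2,4) that by (auto simp: power_add algebra_simps)
  then show ?case
    by (intro bexI[of _ "\<lambda>X. P X * Q X"] exI[of _ "k + l"]) (auto intro: polyfun.intros *)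
qed

section \<open>Semi-invariants under lower triangular matrices\<close>

definition lower_tri :: "nat \<Rightarrow> 'k::field mat \<Rightarrow> bool" where
  "lower_tri N b \<longleftrightarrow> b \<in> carrier_mat N N \<and> (\<forall>i < N. \<forall>j < N. i < j \<longrightarrow> b $$ (i, j) = 0)"

lemma borel_GL_iff: "b \<in> borel_subgroup N (GL N) \<longleftrightarrow> lower_tri N b \<and> det b \<noteq> 0"
  by (auto simp: borel_subgroup_def lower_tri_def GL_iff)

lemma det_lower_tri:
  assumes "lower_tri N b"
  shows "det b = (\<Prod>i<N. b $$ (i, i))"
proof -
  have "det b = prod_list (diag_mat b)"
    by (rule det_lower_triangular[of N]) (use assms in \<open>auto simp: lower_tri_def\<close>)
  moreover have "dim_row b = N"
    using assms by (auto simp: lower_tri_def)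
  ultimately show ?thesis
    by (simp add: prod_list_diag_prod atLeast0LessThan)
qed

text \<open>Lines from \<open>b\<close> and from \<open>X\<close> to the identity are followed
  simultaneously. The exponents are natural numbers, so both sides stay polynomial where
  \<open>b\<close> degenerates; reaching singular \<open>b\<close> and \<open>X\<close> is the point
  of the extension.\<close>

lemma semi_invariant_extend:
  fixes P :: "'k::field mat \<Rightarrow> 'k"
  assumes inf: "infinite (UNIV :: 'k set)" and P: "P \<in> polyfun N"
    and semi: "\<And>b X. lower_tri N b \<Longrightarrow> det b \<noteq> 0 \<Longrightarrow> X \<in> GL N \<Longrightarrow>
      P (b * X) = (\<Prod>i<N. b $$ (i, i) ^ e i) * P X"
    and b: "lower_tri N b" and X: "X \<in> carrier_mat N N"
  shows "P (b * X) = (\<Prod>i<N. b $$ (i, i) ^ e i) * P X"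
proof -
  let ?b = "\<lambda>s. b + s \<cdot>\<^sub>m (1\<^sub>m N - b)" and ?X = "\<lambda>s. X + s \<cdot>\<^sub>m (1\<^sub>m N - X)"
  have bc: "b \<in> carrier_mat N N"
    using b by (simp add: lower_tri_def)
  have c: "?b s \<in> carrier_mat N N" "?X s \<in> carrier_mat N N" for s
    using bc X by auto
  have cb: "poly_curve N ?b"
    using bc by (intro poly_curve_line) auto
  have cX: "poly_curve N ?X"
    using X by (intro poly_curve_line) auto
  have lb: "lower_tri N (?b s)" for s
    using b bc by (auto simp: lower_tri_def)
  have b1: "?b 1 = 1\<^sub>m N" and X1: "?X 1 = 1\<^sub>m N" and b0: "?b 0 = b" and X0: "?X 0 = X"
    using bc X by (auto intro!: eq_matI)
  let ?w = "\<lambda>s. (\<Prod>i<N. ?b s $$ (i, i) ^ e i)"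
  have "P (?b 0 * ?X 0) - ?w 0 * P (?X 0) = 0"
  proof (rule poly_map_zero[OF inf, where \<phi> = "\<lambda>s. P (?b s * ?X s) - ?w s * P (?X s)"
        and \<delta> = "\<lambda>s. det (blk N (?b s)) * det (blk N (?X s))" and t = 1 and s = 0])
    show "poly_map (\<lambda>s. P (?b s * ?X s) - ?w s * P (?X s))"
      by (intro poly_map_intros polyfun_poly_map[OF P] poly_curve_mult poly_curve_entry[OF cb] c)
        (use cb cX in auto)
    show "poly_map (\<lambda>s. det (blk N (?b s)) * det (blk N (?X s)))"
      using polyfun_poly_map[OF polyfun_det_blk[OF le_refl] cb]
        polyfun_poly_map[OF polyfun_det_blk[OF le_refl] cX] by (rule poly_map_mult)
    show "det (blk N (?b 1)) * det (blk N (?X 1)) \<noteq> 0"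
      unfolding b1 X1 by (simp add: blk_self)
    fix s assume "det (blk N (?b s)) * det (blk N (?X s)) \<noteq> 0"
    then have "det (?b s) \<noteq> 0" "?X s \<in> GL N"
      using c[of s] by (auto simp: blk_self GL_iff)
    then show "P (?b s * ?X s) - ?w s * P (?X s) = 0"
      using semi[OF lb] by auto
  qed
  then show ?thesis unfolding b0 X0 by simp
qed

text \<open>A singular matrix is fixed by a lower triangular one with a zero on its diagonal, so the
  numerator of a semi-invariant of nonnegative weight vanishes wherever its denominator does.\<close>

lemma semi_invariant_polyfun:
  fixes f :: "'k::field mat \<Rightarrow> 'k"
  assumes inf: "infinite (UNIV :: 'k set)" and f: "f \<in> coord_ring N (GL N)"
    and semi: "\<And>b X. lower_tri N b \<Longrightarrow> det b \<noteq> 0 \<Longrightarrow> X \<in> GL N \<Longrightarrow>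
      f (b * X) = (\<Prod>i<N. b $$ (i, i) ^ e i) * f X"
  shows "\<exists>P \<in> polyfun N. \<forall>X \<in> GL N. f X = P X"
proof -
  have "\<exists>P \<in> polyfun N. \<forall>X \<in> GL N. f X = P X"
    if "P \<in> polyfun N" "\<forall>X \<in> GL N. f X * det X ^ k = P X" for P k
    using that
  proof (induction k arbitrary: P)
    case 0
    then show ?case by auto
  next
    case (Suc k)
    \<comment> \<open>Clearing the denominator adds the weight of \<open>det ^ Suc k\<close>; all
      exponents become positive, which matters for diagonal entries that are 0.\<close>
    have Pb: "P (b * X) = (\<Prod>i<N. b $$ (i, i) ^ (e i + Suc k)) * P X"
      if "lower_tri N b" "X \<in> carrier_mat N N" for b X
    proof (rule semi_invariant_extend[OF inf Suc.prems(1) _ that])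
      fix b X :: "'k mat" assume *: "lower_tri N b" "det b \<noteq> 0" "X \<in> GL N"
      then have c: "b \<in> carrier_mat N N" "X \<in> carrier_mat N N"
        by (auto simp: lower_tri_def GL_iff)
      then have d: "det (b * X) = det b * det X"
        by (rule det_mult)
      then have "b * X \<in> GL N"
        using * c by (auto simp: GL_iff)
      then have "P (b * X) = f (b * X) * det (b * X) ^ Suc k"
        using Suc.prems(2) by simp
      also have "\<dots> = (\<Prod>i<N. b $$ (i, i) ^ e i) * f X * (det b * det X) ^ Suc k"
        by (simp only: semi[OF *] d)
      also have "\<dots> = (\<Prod>i<N. b $$ (i, i) ^ e i) * det b ^ Suc k * (f X * det X ^ Suc k)"
        by (simp only: power_mult_distrib ac_simps)
      also have "f X * det X ^ Suc k = P X"
        using Suc.prems(2) * by blast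
      also have "(\<Prod>i<N. b $$ (i, i) ^ e i) * det b ^ Suc k = (\<Prod>i<N. b $$ (i, i) ^ (e i + Suc k))"
        unfolding det_lower_tri[OF *(1)] prod_power_distrib
        by (simp only: prod.distrib[symmetric] power_add)
      finally show "P (b * X) = (\<Prod>i<N. b $$ (i, i) ^ (e i + Suc k)) * P X" .
    qed
    have "P X = 0" if X: "X \<in> carrier_mat N N" and "det X = 0" for X
    proof -
      obtain v where v: "\<exists>i<N. v i \<noteq> 0" "\<And>j. j < N \<Longrightarrow> (\<Sum>i<N. v i * X $$ (i, j)) = 0"
        using \<open>det X = 0\<close> unfolding det_zero_iff_left[OF X] by blast
      \<comment> \<open>The last nonzero entry, so that \<open>b\<close> below, which changes row
        \<open>i\<close> only, is lower triangular.\<close>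
      define i where "i = Max {i. i < N \<and> v i \<noteq> 0}"
      have fin: "finite {i. i < N \<and> v i \<noteq> 0}" by auto
      have i: "i < N" "v i \<noteq> 0"
        using Max_in[OF fin] v(1) unfolding i_def by auto
      have above: "v c = 0" if "i < c" "c < N" for c
      proof (rule ccontr)
        assume "v c \<noteq> 0"
        with that(2) have "c \<le> i"
          unfolding i_def by (intro Max_ge[OF fin]) simp
        with that(1) show False by simp
      qed
      \<comment> \<open>From row \<open>i\<close> it subtracts the combination of all rows with
        coefficients \<open>v c / v i\<close>, which is zero by the choice of \<open>v\<close>; its
        own diagonal entry at \<open>i\<close> is 1 - 1.\<close>
      define b where "b = mat N N (\<lambda>(a, c). (if a = c then 1 else 0) - (if a = i then v c / v i else 0))"
      have b: "b \<in> carrier_mat N N" by (simp add: b_def)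
      have lb: "lower_tri N b"
        using above by (auto simp: lower_tri_def b_def)
      have "b * X = X"
      proof (rule eq_matI)
        fix a j assume aj: "a < dim_row X" "j < dim_col X"
        then have "(b * X) $$ (a, j) = (\<Sum>c<N. b $$ (a, c) * X $$ (c, j))"
          using X b by (intro mult_mat_index) auto
        also have "\<dots> = (\<Sum>c<N. (if a = c then X $$ (c, j) else 0) -
            (if a = i then (v c * X $$ (c, j)) / v i else 0))"
          using aj X by (intro sum.cong) (auto simp: b_def algebra_simps)
        also have "\<dots> = X $$ (a, j) - (if a = i then (\<Sum>c<N. v c * X $$ (c, j)) / v i else 0)"
          using aj X by (auto simp: sum_subtractf sum_divide_distrib)
        also have "\<dots> = X $$ (a, j)"
          using v(2)[of j] aj X by simp
        finally show "(b * X) $$ (a, j) = X $$ (a, j)" .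
      qed (use X b in auto)
      moreover have "(\<Prod>j<N. b $$ (j, j) ^ (e j + Suc k)) = 0"
        using i by (intro prod_zero) (auto simp: b_def intro!: bexI[of _ i])
      ultimately show ?thesis
        using Pb[OF lb X] by (simp only: mult_zero_left)
    qed
    then have "\<exists>Q \<in> polyfun N. \<forall>X \<in> carrier_mat N N. P X = det (blk N X) * Q X"
      by (intro polyfun_det_dvd[OF inf le_refl Suc.prems(1)]) (auto simp: blk_self)
    then obtain Q where Q: "Q \<in> polyfun N" "\<forall>X \<in> carrier_mat N N. P X = det (blk N X) * Q X"
      by blast
    have "f X * det X ^ k = Q X" if "X \<in> GL N" for X
    proof -
      have X: "X \<in> carrier_mat N N" "det X \<noteq> 0"
        using that by (auto simp: GL_iff)
      have "f X * det X ^ Suc k = det X * Q X"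
        using Suc.prems(2) that Q(2) X by (auto simp: blk_self)
      then have "det X * (f X * det X ^ k) = det X * Q X"
        by (simp only: power_Suc ac_simps)
      then show ?thesis using X by simp
    qed
    then show ?case using Suc.IH[OF Q(1)] by blast
  qed
  then show ?thesis
    using coord_ring_numerator[OF _ f] by blast
qed

section \<open>Components for a one-parameter subgroup\<close>

lemma nabla_add:
  assumes "f \<in> nabla N G lam" "h \<in> nabla N G lam"
  shows "(\<lambda>X. f X + h X) \<in> nabla N G lam"
  using assms by (auto simp: nabla_def intro: coord_ring.add simp: algebra_simps)

lemma nabla_smult:
  assumes "f \<in> nabla N G lam"
  shows "(\<lambda>X. c * f X) \<in> nabla N G lam"
proof -
  have "(\<lambda>X. restr G (\<lambda>X. c) X * f X) \<in> coord_ring N G"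
    using assms by (intro coord_ring.intros) (auto simp: nabla_def)
  moreover have "(\<lambda>X. restr G (\<lambda>X. c) X * f X) = (\<lambda>X. c * f X)"
    using assms coord_ring_outside by (fastforce simp: restr_def nabla_def)
  ultimately show ?thesis
    using assms by (auto simp: nabla_def algebra_simps)
qed

lemma nabla_zero: "(\<lambda>X. 0) \<in> nabla N G lam"
proof -
  have "restr G (\<lambda>X. 0) = (\<lambda>X. 0)"
    by (auto simp: restr_def)
  then have "(\<lambda>X. 0) \<in> coord_ring N G"
    using coord_ring.const[of G 0 N] by simp
  then show ?thesis
    by (simp add: nabla_def)
qed

lemma nabla_sum_list:
  "(\<And>a. a \<in> set M \<Longrightarrow> f a \<in> nabla N G lam) \<Longrightarrow> (\<lambda>X. \<Sum>a\<leftarrow>M. c a * f a X) \<in> nabla N G lam"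
proof (induction M)
  case Nil
  show ?case using nabla_zero[of N G lam] by simp
next
  case (Cons a M)
  then have "(\<lambda>X. c a * f a X + (\<Sum>a\<leftarrow>M. c a * f a X)) \<in> nabla N G lam"
    by (intro nabla_add nabla_smult) auto
  then show ?case by simp
qed

lemma additive_sum_list:
  fixes \<Lambda> :: "('k::field mat \<Rightarrow> 'k) \<Rightarrow> 'k"
  assumes add: "\<And>f h. f \<in> nabla N G lam \<Longrightarrow> h \<in> nabla N G lam \<Longrightarrow> \<Lambda> (\<lambda>X. f X + h X) = \<Lambda> f + \<Lambda> h"
    and smult: "\<And>c f. f \<in> nabla N G lam \<Longrightarrow> \<Lambda> (\<lambda>X. c * f X) = c * \<Lambda> f"
  shows "(\<And>a. a \<in> set M \<Longrightarrow> f a \<in> nabla N G lam) \<Longrightarrow>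
    \<Lambda> (\<lambda>X. \<Sum>a\<leftarrow>M. c a * f a X) = (\<Sum>a\<leftarrow>M. c a * \<Lambda> (f a))"
proof (induction M)
  case Nil
  show ?case
    using smult[OF nabla_zero, of 0] by simp
next
  case (Cons a M)
  then have "\<Lambda> (\<lambda>X. c a * f a X + (\<Sum>a\<leftarrow>M. c a * f a X)) =
      \<Lambda> (\<lambda>X. c a * f a X) + \<Lambda> (\<lambda>X. \<Sum>a\<leftarrow>M. c a * f a X)"
    by (intro add nabla_smult nabla_sum_list) auto
  with Cons show ?case
    by (simp add: smult)
qed

lemma sum_atMost_conv_sum_list: "(\<Sum>j\<le>M. F j) = (\<Sum>j\<leftarrow>[0..<Suc M]. F j)"
  by (simp add: interv_sum_list_conv_sum_set_nat atLeastLessThanSuc_atLeastAtMost atMost_atLeast0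
      del: upt_Suc)

lemma Hom_modD:
  assumes "\<chi> \<in> Hom_mod G V W"
  shows "f \<in> V \<Longrightarrow> \<chi> f \<in> W"
    and "f \<in> V \<Longrightarrow> h \<in> V \<Longrightarrow> \<chi> (\<lambda>X. f X + h X) = (\<lambda>X. \<chi> f X + \<chi> h X)"
    and "f \<in> V \<Longrightarrow> \<chi> (\<lambda>X. c * f X) = (\<lambda>X. c * \<chi> f X)"
    and "g \<in> G \<Longrightarrow> f \<in> V \<Longrightarrow> \<chi> (right_trans G g f) = right_trans G g (\<chi> f)"
  using assms unfolding Hom_mod_def by (auto simp: Pi_def)

text \<open>The weight of column \<open>j\<close> is \<open>e j - 1\<close>. Shifting by one keeps
  the exponents natural, and one factor \<open>c\<close> per matrix entry clears the
  denominator.\<close>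

definition torus_elt :: "nat \<Rightarrow> (nat \<Rightarrow> nat) \<Rightarrow> 'k::field \<Rightarrow> 'k mat" where
  "torus_elt N e c = mat N N (\<lambda>(i, j). if i = j then c ^ e j / c else 0)"

lemma torus_elt_carrier [simp]: "torus_elt N e c \<in> carrier_mat N N"
  by (simp add: torus_elt_def)

lemma mult_torus_elt_index:
  assumes "X \<in> carrier_mat N N" "i < N" "j < N"
  shows "(X * torus_elt N e c) $$ (i, j) = X $$ (i, j) * (c ^ e j / c)"
proof -
  have "(X * torus_elt N e c) $$ (i, j) = (\<Sum>k<N. X $$ (i, k) * torus_elt N e c $$ (k, j))"
    using assms by (intro mult_mat_index) auto
  also have "\<dots> = (\<Sum>k<N. if k = j then X $$ (i, j) * (c ^ e j / c) else 0)"
    using assms by (intro sum.cong) (auto simp: torus_elt_def)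
  finally show ?thesis using assms by simp
qed

lemma polyfun_torus_expand:
  fixes P :: "'k::field mat \<Rightarrow> 'k"
  assumes "P \<in> polyfun N"
  obtains \<Phi> d where "poly_coeffs N \<Phi>"
    "\<And>X c. X \<in> carrier_mat N N \<Longrightarrow> c \<noteq> 0 \<Longrightarrow> c ^ d * P (X * torus_elt N e c) = poly (\<Phi> X) c"
proof -
  have "\<exists>\<Phi> d. poly_coeffs N \<Phi> \<and> (\<forall>X \<in> carrier_mat N N. \<forall>c \<in> - {0}.
      c ^ (1 * d) * P (X * torus_elt N e c) = poly (\<Phi> X) c)"
    by (rule polyfun_expand[OF assms, where e = "\<lambda>i j. e j" and p = "\<lambda>i j X. X $$ (i, j)"])
      (auto simp: mult_torus_elt_index simp del: index_mult_mat intro: polyfun.intros)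
  then show ?thesis using that by auto
qed

text \<open>Algebraic limit for \<open>c\<close> to infinity: \<open>c ^ k\<close> is the highest
  power that can occur in \<open>q\<close>, and its coefficient is the limit of
  \<open>poly p (1 / c)\<close>. After multiplication by \<open>c ^ degree p\<close> the right side
  becomes \<open>c ^ k\<close> times the reflected polynomial.\<close>

lemma coeff_of_reversed:
  fixes p q :: "'k::field poly"
  assumes inf: "infinite (UNIV :: 'k set)" and "\<And>c. c \<noteq> 0 \<Longrightarrow> poly q c = c ^ k * poly p (1 / c)"
  shows "coeff q k = poly p 0"
proof -
  let ?D = "degree p"
  have "monom 1 ?D * q = monom 1 k * reflect_poly p"
  proof (rule poly_eqI_infinite)
    show "infinite (- {0::'k})"
      using inf by (simp add: Compl_eq_Diff_UNIV)
    fix c :: 'k assume "c \<in> - {0}"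
    then have "c \<noteq> 0" by simp
    then show "poly (monom 1 ?D * q) c = poly (monom 1 k * reflect_poly p) c"
      using assms(2)[OF \<open>c \<noteq> 0\<close>]
      by (simp add: poly_monom poly_reflect_poly_nz inverse_eq_divide)
  qed
  from arg_cong[OF this, of "\<lambda>p. coeff p (k + ?D)"] show ?thesis
    by (simp add: coeff_monom_mult coeff_reflect_poly poly_0_coeff_0)
qed

text \<open>A homomorphism \<open>\<chi>\<close> is determined by \<open>f \<mapsto> \<chi> f 1\<close>, a functional that only sees the
  \<open>c ^ r\<close>-eigencomponent of \<open>f\<close>; here it is the coefficient of \<open>c ^ (d + r)\<close>.\<close>

lemma Hom_mod_component:
  fixes h :: "'k::field mat \<Rightarrow> 'k"
  assumes inf: "infinite (UNIV :: 'k set)" and G: "G \<subseteq> carrier_mat N N" "1\<^sub>m N \<in> G"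
    and mult: "\<And>X Y. X \<in> G \<Longrightarrow> Y \<in> G \<Longrightarrow> X * Y \<in> G"
    and \<chi>: "\<chi> \<in> Hom_mod G (nabla N G lam) (nabla N G mu)" and h: "h \<in> nabla N G lam"
    and z: "\<And>c. c \<noteq> 0 \<Longrightarrow> z c \<in> borel_subgroup N G" "\<And>c. c \<noteq> 0 \<Longrightarrow> weight_char mu (z c) = c ^ r"
    and \<Phi>: "poly_coeffs N \<Phi>"
    and exp: "\<And>X c. X \<in> G \<Longrightarrow> c \<noteq> 0 \<Longrightarrow> c ^ d * h (X * z c) = poly (\<Phi> X) c"
  shows "restr G (\<lambda>X. coeff (\<Phi> X) (d + r)) \<in> nabla N G lam"
    and "\<chi> h (1\<^sub>m N) = \<chi> (restr G (\<lambda>X. coeff (\<Phi> X) (d + r))) (1\<^sub>m N)"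
proof -
  let ?h = "\<lambda>j. restr G (\<lambda>X. coeff (\<Phi> X) j)"
  obtain D where D: "\<And>X. degree (\<Phi> X) \<le> D"
    using \<Phi> by (auto simp: poly_coeffs_def)
  have poly: "(\<lambda>X. coeff (\<Phi> X) j) \<in> polyfun N" for j
    using \<Phi> by (simp add: poly_coeffs_def)
  have zG: "z c \<in> G" if "c \<noteq> 0" for c
    using z(1)[OF that] by (simp add: borel_subgroup_def)
  have inf': "infinite (- {0::'k})"
    using inf by (simp add: Compl_eq_Diff_UNIV)
  \<comment> \<open>Left multiplication by \<open>b\<close> commutes with right translation by
    \<open>z c\<close>, so every coefficient inherits the semi-invariance of
    \<open>h\<close>.\<close>
  have hn: "?h j \<in> nabla N G lam" for j
    unfolding nabla_def
  proof (intro CollectI conjI ballI)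
    show "?h j \<in> coord_ring N G"
      by (rule polyfun_restr) (rule poly)
    fix g b assume g: "g \<in> G" and b: "b \<in> borel_subgroup N G"
    then have bG: "b \<in> G" "b * g \<in> G"
      using mult by (auto simp: borel_subgroup_def)
    have "\<Phi> (b * g) = smult (weight_char lam b) (\<Phi> g)"
    proof (rule poly_eqI_infinite[OF inf'])
      fix c :: 'k assume "c \<in> - {0}"
      then have c: "c \<noteq> 0" by simp
      have "b * g * z c = b * (g * z c)"
        using bG g zG[OF c] G(1) by (intro assoc_mult_mat[of _ N N _ N _ N]) auto
      moreover have "h (b * (g * z c)) = weight_char lam b * h (g * z c)"
        using h b mult[OF g zG[OF c]] by (auto simp: nabla_def)
      ultimately show "poly (\<Phi> (b * g)) c = poly (smult (weight_char lam b) (\<Phi> g)) c"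
        using exp[OF bG(2) c] exp[OF g c] by (simp add: algebra_simps)
    qed
    then show "?h j (b * g) = weight_char lam b * ?h j g"
      using g bG by (simp add: restr_def)
  qed
  then show "?h (d + r) \<in> nabla N G lam" .
  \<comment> \<open>The maximum guarantees that the index \<open>d + r\<close> occurs in the sums
    even if it exceeds the degree.\<close>
  let ?M = "max D (d + r)"
  have sum: "poly (\<Phi> X) c = (\<Sum>j\<le>?M. c ^ j * coeff (\<Phi> X) j)" for X c
    using D[of X] by (subst poly_sum_le[of _ ?M]) (auto simp: mult.commute)
  \<comment> \<open>At \<open>c\<close>, both sides are \<open>c ^ d\<close> times the value at 1 of
    \<open>\<chi>\<close> on the translate of \<open>h\<close> by \<open>z c\<close>: on the left by
    equivariance and the weight of \<open>\<chi> h\<close>, on the right by linearity.\<close>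
  have "monom (\<chi> h (1\<^sub>m N)) (d + r) = (\<Sum>j\<le>?M. monom (\<chi> (?h j) (1\<^sub>m N)) j)"
  proof (rule poly_eqI_infinite[OF inf'])
    fix c :: 'k assume "c \<in> - {0}"
    then have c: "c \<noteq> 0" by simp
    have rt: "(\<lambda>X. c ^ d * right_trans G (z c) h X) = (\<lambda>X. \<Sum>j\<le>?M. c ^ j * ?h j X)"
      using exp[OF _ c] sum by (auto simp: right_trans_def restr_def fun_eq_iff)
    have rtn: "right_trans G (z c) h \<in> nabla N G lam"
    proof -
      have "(\<lambda>X. inverse (c ^ d) * (\<Sum>j\<le>?M. c ^ j * ?h j X)) \<in> nabla N G lam"
        unfolding sum_atMost_conv_sum_list by (intro nabla_smult nabla_sum_list hn)
      moreover have "(\<lambda>X. inverse (c ^ d) * (\<Sum>j\<le>?M. c ^ j * ?h j X)) = right_trans G (z c) h"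
        unfolding fun_cong[OF rt, symmetric] using c by (simp add: mult.assoc[symmetric])
      ultimately show ?thesis by simp
    qed
    have \<chi>h: "\<chi> h \<in> nabla N G mu"
      by (rule Hom_modD(1)[OF \<chi> h])
    have "\<chi> (\<lambda>X. c ^ d * right_trans G (z c) h X) = (\<lambda>X. c ^ d * \<chi> (right_trans G (z c) h) X)"
      by (rule Hom_modD(3)[OF \<chi> rtn])
    moreover have "\<chi> (right_trans G (z c) h) = right_trans G (z c) (\<chi> h)"
      by (rule Hom_modD(4)[OF \<chi> zG[OF c] h])
    moreover have "right_trans G (z c) (\<chi> h) (1\<^sub>m N) = c ^ r * \<chi> h (1\<^sub>m N)"
    proof -
      have "1\<^sub>m N * z c = z c * 1\<^sub>m N"
        using zG[OF c] G(1) by auto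
      then have "right_trans G (z c) (\<chi> h) (1\<^sub>m N) = \<chi> h (z c * 1\<^sub>m N)"
        using G(2) by (simp add: right_trans_def restr_def)
      also have "\<dots> = weight_char mu (z c) * \<chi> h (1\<^sub>m N)"
        using \<chi>h z(1)[OF c] G(2) by (auto simp: nabla_def)
      finally show ?thesis using z(2)[OF c] by simp
    qed
    moreover have "\<chi> (\<lambda>X. \<Sum>j\<le>?M. c ^ j * ?h j X) (1\<^sub>m N) = (\<Sum>j\<le>?M. c ^ j * \<chi> (?h j) (1\<^sub>m N))"
      unfolding sum_atMost_conv_sum_list
      by (rule additive_sum_list[of N G lam "\<lambda>f. \<chi> f (1\<^sub>m N)"])
        (auto simp: Hom_modD(2,3)[OF \<chi>] hn)
    ultimately have "c ^ d * (c ^ r * \<chi> h (1\<^sub>m N)) = (\<Sum>j\<le>?M. c ^ j * \<chi> (?h j) (1\<^sub>m N))"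
      unfolding rt by (simp add: fun_eq_iff)
    then show "poly (monom (\<chi> h (1\<^sub>m N)) (d + r)) c = poly (\<Sum>j\<le>?M. monom (\<chi> (?h j) (1\<^sub>m N)) j) c"
      by (simp add: poly_sum poly_monom power_add algebra_simps)
  qed
  from arg_cong[OF this, of "\<lambda>p. coeff p (d + r)"]
  show "\<chi> h (1\<^sub>m N) = \<chi> (?h (d + r)) (1\<^sub>m N)"
    by (simp add: coeff_sum)
qed

lemma coord_ring_SL_polyfun:
  assumes "G \<subseteq> SL N" "f \<in> coord_ring N G"
  shows "\<exists>P \<in> polyfun N. \<forall>X \<in> G. f X = P X"
proof -
  have "G \<subseteq> GL N"
    using assms(1) SL_subset_GL by blast
  then obtain P k where "P \<in> polyfun N" "\<forall>X \<in> G. f X * det X ^ k = P X"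
    using coord_ring_numerator[OF _ assms(2)] by blast
  moreover have "det X = 1" if "X \<in> G" for X
    using that assms(1) by (auto simp: SL_def)
  ultimately show ?thesis by auto
qed

lemma right_trans_nabla:
  assumes G: "G \<subseteq> carrier_mat N N" and mult: "\<And>X Y. X \<in> G \<Longrightarrow> Y \<in> G \<Longrightarrow> X * Y \<in> G"
    and P: "P \<in> polyfun N" "\<And>X. X \<in> G \<Longrightarrow> f X = P X"
    and f: "f \<in> nabla N G lam" and g: "g \<in> G"
  shows "right_trans G g f \<in> nabla N G lam"
  unfolding nabla_def
proof (intro CollectI conjI ballI)
  have gc: "g \<in> carrier_mat N N"
    using g G by auto
  obtain Q where Q: "Q \<in> polyfun N" "\<And>X. X \<in> carrier_mat N N \<Longrightarrow> P (X * g) = Q X"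
    using polyfun_mult_right[OF P(1) gc] by blast
  have "right_trans G g f = restr G Q"
    using P(2) mult[OF _ g] Q(2) G by (auto simp: right_trans_def restr_def fun_eq_iff)
  then show "right_trans G g f \<in> coord_ring N G"
    using polyfun_restr[OF Q(1)] by (simp only:)
  fix h b assume h: "h \<in> G" and b: "b \<in> borel_subgroup N G"
  then have bG: "b \<in> G" by (simp add: borel_subgroup_def)
  have "b * h * g = b * (h * g)"
    using bG h gc G by (intro assoc_mult_mat[of _ N N _ N _ N]) auto
  then show "right_trans G g f (b * h) = weight_char lam b * right_trans G g f h"
    using f b bG h g mult by (auto simp: right_trans_def restr_def nabla_def)
qed

lemma right_trans_right_trans:
  assumes G: "G \<subseteq> carrier_mat N N" and mult: "\<And>X Y. X \<in> G \<Longrightarrow> Y \<in> G \<Longrightarrow> X * Y \<in> G"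
    and "g \<in> G" "g' \<in> G"
  shows "right_trans G g (right_trans G g' f) = right_trans G (g * g') f"
proof -
  have "X * g * g' = X * (g * g')" if "X \<in> G" for X
    using that assms by (intro assoc_mult_mat[of _ N N _ N _ N]) auto
  then show ?thesis
    using assms by (auto simp: right_trans_def restr_def fun_eq_iff)
qed

section \<open>Weights supported on the first rows\<close>

definition wexp :: "nat list \<Rightarrow> nat \<Rightarrow> nat" where
  "wexp lam i = (if i < length lam then lam ! i else 0)"

text \<open>\<open>m\<close> may be smaller than the length, namely for even orthogonal groups. The
  same \<open>r\<close> is used for source and target weight, so that the top component is the
  eigencomponent.\<close>

definition weight_upto :: "nat \<Rightarrow> nat \<Rightarrow> nat list \<Rightarrow> nat \<Rightarrow> bool" where
  "weight_upto N m lam r \<longleftrightarrow>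
    length lam \<le> N \<and> (\<forall>i \<ge> m. wexp lam i = 0) \<and> (\<Sum>i<m. wexp lam i) = r"

lemma weight_char_wexp:
  assumes "length lam \<le> N"
  shows "weight_char lam b = (\<Prod>i<N. b $$ (i, i) ^ wexp lam i)"
proof -
  have "(\<Prod>i<N. b $$ (i, i) ^ wexp lam i) = (\<Prod>i<length lam. b $$ (i, i) ^ wexp lam i)"
    by (rule prod.mono_neutral_right) (use assms in \<open>auto simp: wexp_def\<close>)
  then show ?thesis
    by (simp add: weight_char_def wexp_def)
qed

lemma weight_char_upto:
  assumes "weight_upto N m lam r" "m \<le> N"
  shows "weight_char lam b = (\<Prod>i<m. b $$ (i, i) ^ wexp lam i)"
proof -
  have "(\<Prod>i<N. b $$ (i, i) ^ wexp lam i) = (\<Prod>i<m. b $$ (i, i) ^ wexp lam i)"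
    by (rule prod.mono_neutral_right) (use assms in \<open>auto simp: weight_upto_def\<close>)
  then show ?thesis
    using assms weight_char_wexp[of lam N b] by (simp add: weight_upto_def)
qed

lemma weight_char_const:
  assumes "weight_upto N m lam r" "m \<le> N" "\<And>i. i < m \<Longrightarrow> b $$ (i, i) = c"
  shows "weight_char lam b = c ^ r"
  using assms(3) assms(1)
  by (simp add: weight_char_upto[OF assms(1,2)] weight_upto_def power_sum[symmetric])

lemma polyfun_eq_on_GL:
  fixes P Q :: "'k::field mat \<Rightarrow> 'k"
  assumes inf: "infinite (UNIV :: 'k set)" and "P \<in> polyfun m" "Q \<in> polyfun m"
    and "\<And>a. a \<in> GL m \<Longrightarrow> P a = Q a" and "A \<in> carrier_mat m m"
  shows "P A = Q A"
proof -
  have "P A - Q A = 0"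
    by (rule polyfun_zero_det_blk[OF inf polyfun_diff[OF assms(2,3)] le_refl _ assms(5)])
      (use assms(4) in \<open>auto simp: blk_self GL_iff\<close>)
  then show ?thesis by simp
qed

lemma blk_mult_lower_left:
  assumes "lower_tri N b" "X \<in> carrier_mat N N" "m \<le> N"
  shows "blk m (b * X) = blk m b * blk m X"
proof (rule eq_matI)
  fix i j assume "i < dim_row (blk m b * blk m X)" "j < dim_col (blk m b * blk m X)"
  then have ij: "i < m" "j < m" by auto
  have bc: "b \<in> carrier_mat N N"
    using assms by (simp add: lower_tri_def)
  have "(b * X) $$ (i, j) = (\<Sum>k<N. b $$ (i, k) * X $$ (k, j))"
    by (rule mult_mat_index[OF bc assms(2)]) (use assms(3) ij in auto)
  also have "\<dots> = (\<Sum>k<m. b $$ (i, k) * X $$ (k, j))"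
    by (rule sum.mono_neutral_right) (use assms ij in \<open>auto simp: lower_tri_def\<close>)
  also have "\<dots> = (blk m b * blk m X) $$ (i, j)"
    using ij by (subst mult_mat_index[of _ m m _ m]) auto
  finally show "blk m (b * X) $$ (i, j) = (blk m b * blk m X) $$ (i, j)"
    using ij by simp
qed auto

lemma lower_tri_blk: "lower_tri N b \<Longrightarrow> m \<le> N \<Longrightarrow> lower_tri m (blk m b)"
  by (auto simp: lower_tri_def)

lemma nabla_GL_polyfun:
  fixes F :: "'k::field mat \<Rightarrow> 'k"
  assumes inf: "infinite (UNIV :: 'k set)" and F: "F \<in> nabla N (GL N) lam" and len: "length lam \<le> N"
  obtains P where "P \<in> polyfun N" "\<And>X. X \<in> GL N \<Longrightarrow> F X = P X"
    "\<And>b X. lower_tri N b \<Longrightarrow> X \<in> carrier_mat N N \<Longrightarrow> P (b * X) = weight_char lam b * P X"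
proof -
  have semi: "F (b * X) = (\<Prod>i<N. b $$ (i, i) ^ wexp lam i) * F X"
    if "lower_tri N b" "det b \<noteq> 0" "X \<in> GL N" for b X
    using F that by (auto simp: nabla_def borel_GL_iff weight_char_wexp[OF len])
  have "F \<in> coord_ring N (GL N)"
    using F by (simp add: nabla_def)
  then obtain P where P: "P \<in> polyfun N" "\<forall>X \<in> GL N. F X = P X"
    using semi_invariant_polyfun[OF inf _ semi] by blast
  have "P (b * X) = (\<Prod>i<N. b $$ (i, i) ^ wexp lam i) * P X"
    if "lower_tri N b" "X \<in> carrier_mat N N" for b X
  proof (rule semi_invariant_extend[OF inf P(1) _ that])
    fix b X :: "'k mat" assume *: "lower_tri N b" "det b \<noteq> 0" "X \<in> GL N"
    then have "b \<in> carrier_mat N N" "X \<in> carrier_mat N N"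
      by (auto simp: lower_tri_def GL_iff)
    then have "b * X \<in> GL N"
      using * by (auto simp: GL_iff det_mult)
    then show "P (b * X) = (\<Prod>i<N. b $$ (i, i) ^ wexp lam i) * P X"
      using semi[OF *] P(2) * by auto
  qed
  then show ?thesis
    using that[OF P(1)] P(2) by (auto simp: weight_char_wexp[OF len])
qed

definition ext_mat :: "nat \<Rightarrow> nat \<Rightarrow> 'k::field mat \<Rightarrow> 'k mat" where
  "ext_mat N m A = mat N N (\<lambda>(i, j). if i < m \<and> j < m then A $$ (i, j) else 0)"

lemma polyfun_ext_mat:
  assumes "P \<in> polyfun N"
  shows "(\<lambda>A. P (ext_mat N m A)) \<in> polyfun m"
proof (rule polyfun_comp[OF assms])
  fix i j assume "i < N" "j < N"
  then show "(\<lambda>A. ext_mat N m A $$ (i, j)) \<in> polyfun m"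
    by (cases "i < m \<and> j < m") (auto simp: ext_mat_def intro: polyfun.intros)
qed

text \<open>The semi-invariance is applied to the singular matrix \<open>diag (1, \<dots>, 1, 0, \<dots>, 0)\<close>.\<close>

lemma semi_invariant_rows:
  fixes P :: "'k::field mat \<Rightarrow> 'k"
  assumes P: "P \<in> polyfun N"
    "\<And>b X. lower_tri N b \<Longrightarrow> X \<in> carrier_mat N N \<Longrightarrow> P (b * X) = weight_char lam b * P X"
    and lam: "weight_upto N m lam r" "m \<le> N"
    and X: "X \<in> carrier_mat N N" and Y: "Y \<in> carrier_mat N N"
    and XY: "\<And>i j. i < m \<Longrightarrow> j < N \<Longrightarrow> X $$ (i, j) = c * Y $$ (i, j)"
  shows "P X = c ^ r * P Y"
proof -
  let ?d = "\<lambda>c. mat N N (\<lambda>(i, j). if i = j \<and> i < m then c else 0 :: 'k)"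
  have l: "lower_tri N (?d c)" for c
    by (auto simp: lower_tri_def)
  have w: "weight_char lam (?d c) = c ^ r" for c
    by (rule weight_char_const[OF lam]) (use lam(2) in auto)
  have dX: "(?d c * X) $$ (i, j) = (if i < m then c * X $$ (i, j) else 0)"
    if "X \<in> carrier_mat N N" "i < N" "j < N" for X c i j
  proof -
    have "(?d c * X) $$ (i, j) = (\<Sum>k<N. ?d c $$ (i, k) * X $$ (k, j))"
      using that by (intro mult_mat_index) auto
    also have "\<dots> = (\<Sum>k<N. if k = i then (if i < m then c * X $$ (i, j) else 0) else 0)"
      using that by (intro sum.cong) auto
    finally show ?thesis using that by simp
  qed
  have "P X = P (?d 1 * X)"
    using P(2)[OF l X, of 1] w[of 1] by simp
  also have "?d 1 * X = ?d c * Y"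
  proof (rule eq_matI)
    fix i j assume "i < dim_row (?d c * Y)" "j < dim_col (?d c * Y)"
    then have "i < N" "j < N" using Y by auto
    then show "(?d 1 * X) $$ (i, j) = (?d c * Y) $$ (i, j)"
      using dX[OF X, of i j 1] dX[OF Y, of i j c] XY by simp
  qed (use X Y in auto)
  also have "P (?d c * Y) = c ^ r * P Y"
    using P(2)[OF l Y, of c] w[of c] by simp
  finally show ?thesis .
qed

section \<open>Groups with a general linear Levi factor\<close>

text \<open>The exponents \<open>e\<close> describe the one-parameter group \<open>torus_elt N e c = diag (c ^ e j / c)\<close>. In
  \<open>cell\<close>, the first \<open>m\<close> rows of \<open>Y (1 / c)\<close> are those of \<open>X * torus_elt N e c\<close> divided by \<open>c\<close>, so
  semi-invariants compare \<open>X * torus_elt N e c\<close> for large \<open>c\<close> with \<open>Y 0 = iota (blk m X)\<close>.\<close>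

locale levi_group =
  fixes N m :: nat and G :: "'k::field mat set" and iota :: "'k mat \<Rightarrow> 'k mat" and e :: "nat \<Rightarrow> nat"
  assumes inf: "infinite (UNIV :: 'k set)" and m_le: "m \<le> N"
    and G_SL: "G \<subseteq> SL N" and one_G: "1\<^sub>m N \<in> G"
    and mult_G: "X \<in> G \<Longrightarrow> Y \<in> G \<Longrightarrow> X * Y \<in> G"
    and inv_G: "X \<in> G \<Longrightarrow> \<exists>Y \<in> G. X * Y = 1\<^sub>m N \<and> Y * X = 1\<^sub>m N"
    and iota_G: "a \<in> GL m \<Longrightarrow> iota a \<in> G"
    and iota_row: "a \<in> GL m \<Longrightarrow> i < m \<Longrightarrow> j < N \<Longrightarrow>
      iota a $$ (i, j) = (if j < m then a $$ (i, j) else 0)"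
    and iota_lower: "lower_tri m b \<Longrightarrow> det b \<noteq> 0 \<Longrightarrow> lower_tri N (iota b)"
    and iota_regular: "P \<in> polyfun N \<Longrightarrow> restr (GL m) (\<lambda>a. P (iota a)) \<in> coord_ring m (GL m)"
    and rigid: "X \<in> G \<Longrightarrow> (\<And>i j. i < m \<Longrightarrow> j < N \<Longrightarrow> X $$ (i, j) = (if i = j then 1 else 0)) \<Longrightarrow>
      lower_tri N X"
    and torus_G: "c \<noteq> 0 \<Longrightarrow> torus_elt N e c \<in> G" and e_m: "j < m \<Longrightarrow> e j = 2"
    and cell: "X \<in> G \<Longrightarrow> det (blk m X) \<noteq> 0 \<Longrightarrow>
      \<exists>Y. poly_curve N Y \<and> (\<forall>s. Y s \<in> G) \<and> Y 0 = iota (blk m X) \<and>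
        (\<forall>s. \<forall>i < m. \<forall>j < N. Y s $$ (i, j) = X $$ (i, j) * s ^ (2 - e j))"
    and e_le: "e j \<le> 2"
    and dense: "P \<in> polyfun N \<Longrightarrow> (\<And>X. X \<in> G \<Longrightarrow> det (blk m X) \<noteq> 0 \<Longrightarrow> P X = 0) \<Longrightarrow> X \<in> G \<Longrightarrow> P X = 0"
begin

lemma G_carrier: "G \<subseteq> carrier_mat N N"
  using G_SL by (auto simp: SL_def)

lemma G_GL: "G \<subseteq> GL N"
  using G_SL SL_subset_GL by blast

text \<open>Two elements of \<open>G\<close> with the same first \<open>m\<close> rows differ by a
  left factor whose first \<open>m\<close> rows are those of the identity; \<open>rigid\<close> puts
  it in the Borel subgroup, and its weight is 1. So \<open>X\<close> may be replaced by
  \<open>iota L * Y\<close>, and \<open>iota L\<close> is in the Borel subgroup as well.\<close>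

lemma nabla_rows:
  assumes h: "h \<in> nabla N G lam" and lam: "weight_upto N m lam r"
    and X: "X \<in> G" and Y: "Y \<in> G" and L: "lower_tri m L" "det L \<noteq> 0"
    and rows: "\<And>i j. i < m \<Longrightarrow> j < N \<Longrightarrow> X $$ (i, j) = (\<Sum>k<m. L $$ (i, k) * Y $$ (k, j))"
  shows "h X = (\<Prod>i<m. L $$ (i, i) ^ wexp lam i) * h Y"
proof -
  have eq: "h X = h Y" if X: "X \<in> G" and Y: "Y \<in> G"
    and XY: "\<And>i j. i < m \<Longrightarrow> j < N \<Longrightarrow> X $$ (i, j) = Y $$ (i, j)" for X Y
  proof -
    obtain Z where Z: "Z \<in> G" "Y * Z = 1\<^sub>m N" "Z * Y = 1\<^sub>m N"
      using inv_G[OF Y] by blast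
    have c: "X \<in> carrier_mat N N" "Y \<in> carrier_mat N N" "Z \<in> carrier_mat N N"
      using X Y Z G_carrier by auto
    have \<beta>: "(X * Z) $$ (i, j) = (if i = j then 1 else 0)" if "i < m" "j < N" for i j
    proof -
      have i: "i < N" using that m_le by simp
      have "(X * Z) $$ (i, j) = (\<Sum>k<N. X $$ (i, k) * Z $$ (k, j))"
        by (rule mult_mat_index[OF c(1,3) i that(2)])
      also have "\<dots> = (\<Sum>k<N. Y $$ (i, k) * Z $$ (k, j))"
        using XY that by simp
      also have "\<dots> = (Y * Z) $$ (i, j)"
        by (rule mult_mat_index[OF c(2,3) i that(2), symmetric])
      finally show ?thesis using Z(2) i that by simp
    qed
    have \<beta>G: "X * Z \<in> G"
      using mult_G X Z by auto
    have "lower_tri N (X * Z)"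
      by (rule rigid[OF \<beta>G \<beta>])
    then have "X * Z \<in> borel_subgroup N G"
      using \<beta>G by (auto simp: borel_subgroup_def lower_tri_def)
    then have "h (X * Z * Y) = weight_char lam (X * Z) * h Y"
      using h Y by (auto simp: nabla_def)
    moreover have "X * Z * Y = X"
      using c Z(3) by (simp add: assoc_mult_mat[of _ N N _ N _ N])
    moreover have "weight_char lam (X * Z) = 1 ^ r"
      by (rule weight_char_const[OF lam m_le]) (use \<beta> m_le in auto)
    ultimately show ?thesis by simp
  qed
  have LGL: "L \<in> GL m"
    using L by (auto simp: GL_iff lower_tri_def)
  have b: "iota L \<in> borel_subgroup N G"
    using iota_lower[OF L] iota_G[OF LGL] by (auto simp: borel_subgroup_def lower_tri_def)
  have bG: "iota L \<in> G" by (rule iota_G[OF LGL])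
  have "h X = h (iota L * Y)"
  proof (rule eq[OF X mult_G[OF bG Y]])
    fix i j assume ij: "i < m" "j < N"
    have "(iota L * Y) $$ (i, j) = (\<Sum>k<N. iota L $$ (i, k) * Y $$ (k, j))"
      by (rule mult_mat_index[of _ N N _ N]) (use bG Y G_carrier ij m_le in auto)
    also have "\<dots> = (\<Sum>k<m. iota L $$ (i, k) * Y $$ (k, j))"
      by (rule sum.mono_neutral_right) (use m_le ij iota_row[OF LGL] in auto)
    also have "\<dots> = X $$ (i, j)"
      unfolding rows[OF ij] using iota_row[OF LGL] ij m_le by (intro sum.cong) auto
    finally show "X $$ (i, j) = (iota L * Y) $$ (i, j)" ..
  qed
  also have "\<dots> = weight_char lam (iota L) * h Y"
    using h b Y by (auto simp: nabla_def)
  also have "weight_char lam (iota L) = (\<Prod>i<m. L $$ (i, i) ^ wexp lam i)"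
    unfolding weight_char_upto[OF lam m_le] using iota_row[OF LGL] m_le by (intro prod.cong) auto
  finally show ?thesis .
qed

lemma nabla_same_rows:
  assumes "h \<in> nabla N G lam" "weight_upto N m lam r" "X \<in> G" "Y \<in> G"
    and "\<And>i j. i < m \<Longrightarrow> j < N \<Longrightarrow> X $$ (i, j) = Y $$ (i, j)"
  shows "h X = h Y"
proof -
  have "h X = (\<Prod>i<m. 1\<^sub>m m $$ (i, i) ^ wexp lam i) * h Y"
  proof (rule nabla_rows[OF assms(1-4)])
    fix i j assume ij: "i < m" "j < N"
    have "(\<Sum>k<m. 1\<^sub>m m $$ (i, k) * Y $$ (k, j)) = (\<Sum>k<m. if k = i then Y $$ (i, j) else 0)"
      using ij by (intro sum.cong) auto
    then show "X $$ (i, j) = (\<Sum>k<m. 1\<^sub>m m $$ (i, k) * Y $$ (k, j))"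
      using assms(5)[OF ij] ij by simp
  qed (auto simp: lower_tri_def)
  then show ?thesis by simp
qed

lemma nabla_polyfun:
  assumes "h \<in> nabla N G lam"
  obtains P where "P \<in> polyfun N" "\<And>X. X \<in> G \<Longrightarrow> h X = P X"
  using coord_ring_SL_polyfun[OF G_SL, of h] assms unfolding nabla_def by blast

lemma nabla_iota_lower:
  assumes h: "h \<in> nabla N G lam" and lam: "weight_upto N m lam r"
    and b: "lower_tri m b" "det b \<noteq> 0" and a: "a \<in> GL m"
  shows "h (iota (b * a)) = (\<Prod>i<m. b $$ (i, i) ^ wexp lam i) * h (iota a)"
proof -
  have c: "b \<in> carrier_mat m m" "a \<in> carrier_mat m m"
    using a b by (auto simp: lower_tri_def GL_iff)
  then have ba: "b * a \<in> GL m"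
    using a b by (auto simp: GL_iff det_mult)
  show ?thesis
  proof (rule nabla_rows[OF h lam iota_G[OF ba] iota_G[OF a] b])
    fix i j assume ij: "i < m" "j < N"
    show "iota (b * a) $$ (i, j) = (\<Sum>k<m. b $$ (i, k) * iota a $$ (k, j))"
      using iota_row[OF ba ij] iota_row[OF a _ ij(2)] mult_mat_index[OF c ij(1), of j] by auto
  qed
qed

section \<open>Restriction to the Levi factor and lift to the general linear group\<close>

lemma levi_restriction:
  assumes h: "h \<in> nabla N G lam" and lam: "weight_upto N m lam r"
  shows "\<exists>P. P \<in> polyfun m \<and> (\<forall>a \<in> GL m. h (iota a) = P a)"
proof -
  obtain Q where Q: "Q \<in> polyfun N" "\<And>X. X \<in> G \<Longrightarrow> h X = Q X"
    using nabla_polyfun[OF h] by blast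
  let ?f = "restr (GL m) (\<lambda>a. Q (iota a))"
  have f: "?f a = h (iota a)" if "a \<in> GL m" for a
    using that Q(2)[OF iota_G[OF that]] by (simp add: restr_def)
  have "\<exists>P \<in> polyfun m. \<forall>a \<in> GL m. ?f a = P a"
  proof (rule semi_invariant_polyfun[OF inf iota_regular[OF Q(1)]])
    fix b a :: "'k mat" assume *: "lower_tri m b" "det b \<noteq> 0" "a \<in> GL m"
    then have "b * a \<in> GL m"
      by (auto simp: lower_tri_def GL_iff det_mult)
    then show "?f (b * a) = (\<Prod>i<m. b $$ (i, i) ^ wexp lam i) * ?f a"
      using f nabla_iota_lower[OF h lam *] * by simp
  qed
  then show ?thesis using f by auto
qed

definition lev :: "('k mat \<Rightarrow> 'k) \<Rightarrow> 'k mat \<Rightarrow> 'k" where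
  "lev h = (SOME P. P \<in> polyfun m \<and> (\<forall>a \<in> GL m. h (iota a) = P a))"

lemma lev:
  assumes "h \<in> nabla N G lam" "weight_upto N m lam r"
  shows "lev h \<in> polyfun m" and "a \<in> GL m \<Longrightarrow> lev h a = h (iota a)"
  using someI_ex[OF levi_restriction[OF assms]] unfolding lev_def by auto

text \<open>Makes the choice in \<open>lev\<close> canonical on \<open>m\<close> by \<open>m\<close>
  matrices, where the invertible ones are dense. Identities for \<open>lev\<close> are thus checked
  on \<open>GL m\<close>, where it is given by \<open>iota\<close>.\<close>

lemma lev_eq:
  assumes "h \<in> nabla N G lam" "weight_upto N m lam r" "P \<in> polyfun m"
    and "\<And>a. a \<in> GL m \<Longrightarrow> h (iota a) = P a" and "A \<in> carrier_mat m m"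
  shows "lev h A = P A"
  by (rule polyfun_eq_on_GL[OF inf lev(1)[OF assms(1,2)] assms(3) _ assms(5)])
    (use assms(4) lev(2)[OF assms(1,2)] in auto)

definition lift :: "('k mat \<Rightarrow> 'k) \<Rightarrow> 'k mat \<Rightarrow> 'k" where
  "lift h = restr (GL N) (\<lambda>X. lev h (blk m X))"

lemma polyfun_blk:
  assumes "P \<in> polyfun m"
  shows "(\<lambda>X. P (blk m X)) \<in> polyfun N"
  by (rule polyfun_comp[OF assms]) (use m_le in \<open>auto intro: polyfun.intros\<close>)

text \<open>The upper left block of an invertible matrix may be singular, so the semi-invariance of
  \<open>lev h\<close> has to be extended from \<open>GL m\<close> to all \<open>m\<close> by
  \<open>m\<close> matrices. A lower triangular \<open>b\<close> acts on blocks through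
  \<open>blk m b\<close>.\<close>

lemma lift_nabla:
  assumes h: "h \<in> nabla N G lam" and lam: "weight_upto N m lam r"
  shows "lift h \<in> nabla N (GL N) lam"
  unfolding nabla_def
proof (intro CollectI conjI ballI)
  show "lift h \<in> coord_ring N (GL N)"
    unfolding lift_def by (intro polyfun_restr polyfun_blk lev(1)[OF h lam])
  fix X b :: "'k mat" assume X: "X \<in> GL N" and b: "b \<in> borel_subgroup N (GL N)"
  then have b': "lower_tri N b" "det b \<noteq> 0"
    by (auto simp: borel_GL_iff)
  have c: "X \<in> carrier_mat N N" "b \<in> carrier_mat N N"
    using X b' by (auto simp: GL_iff lower_tri_def)
  then have bX: "b * X \<in> GL N"
    using X b' by (auto simp: GL_iff det_mult)
  have "lev h (blk m b * blk m X) = (\<Prod>i<m. blk m b $$ (i, i) ^ wexp lam i) * lev h (blk m X)"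
  proof (rule semi_invariant_extend[OF inf lev(1)[OF h lam]])
    fix b a :: "'k mat" assume *: "lower_tri m b" "det b \<noteq> 0" "a \<in> GL m"
    then have "b * a \<in> GL m"
      by (auto simp: lower_tri_def GL_iff det_mult)
    then show "lev h (b * a) = (\<Prod>i<m. b $$ (i, i) ^ wexp lam i) * lev h a"
      using nabla_iota_lower[OF h lam *] lev(2)[OF h lam] * by simp
  qed (use lower_tri_blk[OF b'(1) m_le] in auto)
  moreover have "(\<Prod>i<m. blk m b $$ (i, i) ^ wexp lam i) = weight_char lam b"
    unfolding weight_char_upto[OF lam m_le] by (intro prod.cong) auto
  ultimately show "lift h (b * X) = weight_char lam b * lift h X"
    using X bX blk_mult_lower_left[OF b'(1) c(1) m_le] by (simp add: lift_def restr_def)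
qed

lemma lift_add:
  assumes f: "f \<in> nabla N G lam" and h: "h \<in> nabla N G lam" and lam: "weight_upto N m lam r"
  shows "lift (\<lambda>X. f X + h X) = (\<lambda>X. lift f X + lift h X)"
proof
  fix X
  have "lev (\<lambda>X. f X + h X) (blk m X) = lev f (blk m X) + lev h (blk m X)"
    by (rule lev_eq[OF nabla_add[OF f h] lam polyfun.add[OF lev(1)[OF f lam] lev(1)[OF h lam]]])
      (use lev(2)[OF f lam] lev(2)[OF h lam] in auto)
  then show "lift (\<lambda>X. f X + h X) X = lift f X + lift h X"
    by (simp add: lift_def restr_def)
qed

lemma lift_smult:
  assumes h: "h \<in> nabla N G lam" and lam: "weight_upto N m lam r"
  shows "lift (\<lambda>X. c * h X) = (\<lambda>X. c * lift h X)"
proof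
  fix X
  have "lev (\<lambda>X. c * h X) (blk m X) = c * lev h (blk m X)"
    by (rule lev_eq[OF nabla_smult[OF h] lam polyfun.mult[OF polyfun.const lev(1)[OF h lam]]])
      (use lev(2)[OF h lam] in auto)
  then show "lift (\<lambda>X. c * h X) X = c * lift h X"
    by (simp add: lift_def restr_def)
qed

section \<open>Comparison of functionals at the identity\<close>

lemma torus_borel: "c \<noteq> 0 \<Longrightarrow> torus_elt N e c \<in> borel_subgroup N G"
  using torus_G by (auto simp: borel_subgroup_def torus_elt_def)

lemma weight_torus:
  assumes "weight_upto N m mu r" "c \<noteq> 0"
  shows "weight_char mu (torus_elt N e c) = c ^ r"
  by (rule weight_char_const[OF assms(1) m_le])
    (use m_le e_m assms(2) in \<open>auto simp: torus_elt_def power2_eq_square\<close>)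

lemma Hom_eval_lift:
  assumes h: "h \<in> nabla N G lam" and lam: "weight_upto N m lam r" and mu: "weight_upto N m mu r"
    and \<chi>: "\<chi> \<in> Hom_mod G (nabla N G lam) (nabla N G mu)"
  shows "\<chi> h (1\<^sub>m N) = \<chi> (restr G (lift h)) (1\<^sub>m N)"
proof -
  obtain P where P: "P \<in> polyfun N" "\<And>X. X \<in> G \<Longrightarrow> h X = P X"
    using nabla_polyfun[OF h] by blast
  obtain \<Phi> d where \<Phi>: "poly_coeffs N \<Phi>"
    "\<And>X c. X \<in> carrier_mat N N \<Longrightarrow> c \<noteq> 0 \<Longrightarrow> c ^ d * P (X * torus_elt N e c) = poly (\<Phi> X) c"
    using polyfun_torus_expand[OF P(1), of e] by metis
  have exp: "c ^ d * h (X * torus_elt N e c) = poly (\<Phi> X) c" if "X \<in> G" "c \<noteq> 0" for X c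
    using \<Phi>(2)[of X c] P(2)[OF mult_G[OF that(1) torus_G[OF that(2)]]] that G_carrier by auto
  \<comment> \<open>On the cell, the first \<open>m\<close> rows of
    \<open>X * torus_elt N e c\<close> are those of \<open>Y (1 / c)\<close> scaled by
    \<open>c\<close>, which contributes \<open>c ^ r\<close>; letting \<open>c\<close> go to
    infinity leaves the value of \<open>h\<close> at \<open>Y 0\<close>.\<close>
  have top: "coeff (\<Phi> X) (d + r) = lev h (blk m X)" if X: "X \<in> G" and dX: "det (blk m X) \<noteq> 0" for X
  proof -
    obtain Y where Y: "poly_curve N Y" "\<And>s. Y s \<in> G" "Y 0 = iota (blk m X)"
      "\<And>s i j. i < m \<Longrightarrow> j < N \<Longrightarrow> Y s $$ (i, j) = X $$ (i, j) * s ^ (2 - e j)"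
      using cell[OF X dX] by blast
    obtain p where p: "\<And>s. P (Y s) = poly p s"
      using polyfun_curve[OF P(1) Y(1)] by blast
    have "poly (\<Phi> X) c = c ^ (d + r) * poly p (1 / c)" if c: "c \<noteq> 0" for c
    proof -
      let ?L = "c \<cdot>\<^sub>m 1\<^sub>m m"
      have "h (X * torus_elt N e c) = (\<Prod>i<m. ?L $$ (i, i) ^ wexp lam i) * h (Y (1 / c))"
      proof (rule nabla_rows[OF h lam mult_G[OF X torus_G[OF c]] Y(2)])
        fix i j assume ij: "i < m" "j < N"
        have "(\<Sum>k<m. ?L $$ (i, k) * Y (1 / c) $$ (k, j)) =
            (\<Sum>k<m. if k = i then c * Y (1 / c) $$ (i, j) else 0)"
          using ij by (intro sum.cong) auto
        also have "\<dots> = c * (X $$ (i, j) * (1 / c) ^ (2 - e j))"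
          using ij Y(4)[OF ij] by simp
        also have "\<dots> = X $$ (i, j) * (c ^ e j / c)"
        proof -
          have "e j = 0 \<or> e j = 1 \<or> e j = 2"
            using e_le[of j] by linarith
          then show ?thesis
            using c by (auto simp: power2_eq_square)
        qed
        finally show "(X * torus_elt N e c) $$ (i, j) = (\<Sum>k<m. ?L $$ (i, k) * Y (1 / c) $$ (k, j))"
          using mult_torus_elt_index[of X N i j e c] X G_carrier ij m_le by auto
      qed (use c in \<open>auto simp: lower_tri_def\<close>)
      also have "(\<Prod>i<m. ?L $$ (i, i) ^ wexp lam i) = c ^ r"
        using lam by (simp add: weight_upto_def power_sum[symmetric])
      finally show ?thesis
        using exp[OF X c] P(2)[OF Y(2)] p by (simp add: power_add mult.assoc[symmetric])
    qed
    then have "coeff (\<Phi> X) (d + r) = poly p 0"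
      by (rule coeff_of_reversed[OF inf])
    also have "\<dots> = h (iota (blk m X))"
      using p[of 0] P(2)[OF Y(2)] Y(3) by metis
    also have "\<dots> = lev h (blk m X)"
      using lev(2)[OF h lam] dX by (simp add: GL_iff)
    finally show ?thesis .
  qed
  have "coeff (\<Phi> X) (d + r) - lev h (blk m X) = 0" if "X \<in> G" for X
  proof (rule dense[OF polyfun_diff _ that])
    show "(\<lambda>X. coeff (\<Phi> X) (d + r)) \<in> polyfun N"
      using \<Phi>(1) by (simp add: poly_coeffs_def)
  qed (simp_all add: top polyfun_blk[OF lev(1)[OF h lam]])
  then have "restr G (\<lambda>X. coeff (\<Phi> X) (d + r)) = restr G (lift h)"
    using G_GL by (auto simp: restr_def lift_def fun_eq_iff)
  moreover have "\<chi> h (1\<^sub>m N) = \<chi> (restr G (\<lambda>X. coeff (\<Phi> X) (d + r))) (1\<^sub>m N)"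
    by (rule Hom_mod_component(2)[OF inf G_carrier one_G mult_G \<chi> h torus_borel
          weight_torus[OF mu] \<Phi>(1) exp])
  ultimately show ?thesis by simp
qed

lemma restr_nabla_levi:
  assumes "F \<in> nabla N (GL N) lam"
  shows "restr G F \<in> nabla N G lam"
  unfolding nabla_def
proof (intro CollectI conjI ballI)
  show "restr G F \<in> coord_ring N G"
    using assms restr_coord_ring[OF G_GL] by (auto simp: nabla_def)
  fix g b assume "g \<in> G" "b \<in> borel_subgroup N G"
  moreover from this have "b * g \<in> G" "b \<in> borel_subgroup N (GL N)" "g \<in> GL N"
    using mult_G G_GL by (auto simp: borel_subgroup_def)
  ultimately show "restr G F (b * g) = weight_char lam b * restr G F g"
    using assms by (auto simp: nabla_def restr_def)
qed

lemma GL_mult: "X \<in> GL N \<Longrightarrow> Y \<in> GL N \<Longrightarrow> X * Y \<in> GL N"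
  by (auto simp: GL_iff det_mult)

lemma GL_carrier: "GL N \<subseteq> carrier_mat N N"
  by (auto simp: GL_iff)

text \<open>The contracting family \<open>T\<close> below leaves \<open>GL N\<close>, which is
  harmless because \<open>F\<close> extends to a polynomial that is semi-invariant on all matrices;
  the limit \<open>T 0\<close> is the block padded by zeros.\<close>

lemma Hom_eval_lift_GL:
  assumes F: "F \<in> nabla N (GL N) lam" and lam: "weight_upto N m lam r" and mu: "weight_upto N m mu r"
    and \<phi>: "\<phi> \<in> Hom_mod (GL N) (nabla N (GL N) lam) (nabla N (GL N) mu)"
  shows "\<phi> F (1\<^sub>m N) = \<phi> (lift (restr G F)) (1\<^sub>m N)"
proof -
  let ?e = "\<lambda>j. if j < m then 2 else 1 :: nat"
  have len: "length lam \<le> N"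
    using lam by (simp add: weight_upto_def)
  obtain P where P: "P \<in> polyfun N" "\<And>X. X \<in> GL N \<Longrightarrow> F X = P X"
    "\<And>b X. lower_tri N b \<Longrightarrow> X \<in> carrier_mat N N \<Longrightarrow> P (b * X) = weight_char lam b * P X"
    using nabla_GL_polyfun[OF inf F len] by blast
  obtain \<Phi> d where \<Phi>: "poly_coeffs N \<Phi>"
    "\<And>X c. X \<in> carrier_mat N N \<Longrightarrow> c \<noteq> 0 \<Longrightarrow> c ^ d * P (X * torus_elt N ?e c) = poly (\<Phi> X) c"
    using polyfun_torus_expand[OF P(1), of ?e] by metis
  have tl: "lower_tri N (torus_elt N ?e c)" for c :: 'k
    by (auto simp: lower_tri_def torus_elt_def)
  have tGL: "torus_elt N ?e c \<in> GL N" if "c \<noteq> 0" for c :: 'k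
    using that unfolding GL_iff det_lower_tri[OF tl] by (auto simp: torus_elt_def)
  have exp: "c ^ d * F (X * torus_elt N ?e c) = poly (\<Phi> X) c" if "X \<in> GL N" "c \<noteq> 0" for X c
    using \<Phi>(2)[of X c] P(2)[OF GL_mult[OF that(1) tGL[OF that(2)]]] that by (auto simp: GL_iff)
  have FG: "restr G F \<in> nabla N G lam"
    by (rule restr_nabla_levi[OF F])
  have top: "coeff (\<Phi> X) (d + r) = P (ext_mat N m (blk m X))" if X: "X \<in> carrier_mat N N" for X
  proof -
    define T where "T s = mat N N (\<lambda>(i, j). if i < m then if j < m then X $$ (i, j) else s * X $$ (i, j) else 0)"
      for s
    have "poly_curve N T"
    proof (rule poly_curveI)
      fix i j assume "i < N" "j < N"
      then show "poly_map (\<lambda>s. T s $$ (i, j))"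
        by (cases "i < m"; cases "j < m") (simp_all add: T_def poly_map_const poly_map_mult poly_map_ident)
    qed
    then obtain p where p: "\<And>s. P (T s) = poly p s"
      using polyfun_curve[OF P(1)] by blast
    have "poly (\<Phi> X) c = c ^ (d + r) * poly p (1 / c)" if c: "c \<noteq> 0" for c
    proof -
      have "P (X * torus_elt N ?e c) = c ^ r * P (T (1 / c))"
      proof (rule semi_invariant_rows[OF P(1,3) lam m_le])
        fix i j assume "i < m" "j < N"
        then show "(X * torus_elt N ?e c) $$ (i, j) = c * T (1 / c) $$ (i, j)"
          using mult_torus_elt_index[OF X, of i j ?e c] m_le c
          by (auto simp: T_def power2_eq_square)
      qed (use X in \<open>auto simp: T_def torus_elt_def\<close>)
      then show ?thesis
        using \<Phi>(2)[OF X c] p by (simp add: power_add mult.assoc[symmetric])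
    qed
    then have "coeff (\<Phi> X) (d + r) = P (T 0)"
      using coeff_of_reversed[OF inf] p by metis
    also have "T 0 = ext_mat N m (blk m X)"
      by (rule eq_matI) (auto simp: T_def ext_mat_def)
    finally show ?thesis .
  qed
  \<comment> \<open>The first \<open>m\<close> rows of \<open>iota a\<close> and of the padded block
    agree, and the extension of \<open>F\<close> sees only those rows.\<close>
  have lev: "lev (restr G F) A = P (ext_mat N m A)" if "A \<in> carrier_mat m m" for A
  proof (rule lev_eq[OF FG lam polyfun_ext_mat[OF P(1)] _ that])
    fix a :: "'k mat" assume a: "a \<in> GL m"
    have "restr G F (iota a) = P (iota a)"
      using iota_G[OF a] G_GL P(2) by (auto simp: restr_def)
    also have "\<dots> = 1 ^ r * P (ext_mat N m a)"
      by (rule semi_invariant_rows[OF P(1,3) lam m_le])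
        (use iota_G[OF a] G_carrier m_le iota_row[OF a] in \<open>auto simp: ext_mat_def\<close>)
    finally show "restr G F (iota a) = P (ext_mat N m a)" by simp
  qed
  have "restr (GL N) (\<lambda>X. coeff (\<Phi> X) (d + r)) = lift (restr G F)"
    using top lev by (auto simp: restr_def lift_def fun_eq_iff GL_iff)
  moreover have "\<phi> F (1\<^sub>m N) = \<phi> (restr (GL N) (\<lambda>X. coeff (\<Phi> X) (d + r))) (1\<^sub>m N)"
  proof (rule Hom_mod_component(2)[OF inf GL_carrier _ GL_mult \<phi> F _ _ \<Phi>(1) exp])
    show "1\<^sub>m N \<in> GL N" by (simp add: GL_iff)
    fix c :: 'k assume c: "c \<noteq> 0"
    show "torus_elt N ?e c \<in> borel_subgroup N (GL N)"
      using tl tGL[OF c] by (auto simp: borel_GL_iff GL_iff)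
    show "weight_char mu (torus_elt N ?e c) = c ^ r"
      by (rule weight_char_const[OF mu m_le]) (use m_le c in \<open>auto simp: torus_elt_def power2_eq_square\<close>)
  qed
  ultimately show ?thesis by simp
qed

end

section \<open>Regularity of translated functionals\<close>

lemma polyfun_sum_list:
  "(\<And>a. a \<in> set L \<Longrightarrow> F a \<in> polyfun N) \<Longrightarrow> (\<lambda>X. \<Sum>a\<leftarrow>L. F a X) \<in> polyfun N"
  by (induction L) (auto intro: polyfun.intros)

text \<open>A list of pairs is an element of a tensor product of function spaces, such as the image
  of a polynomial function under comultiplication, evaluated at \<open>X\<close> and
  \<open>g\<close>.\<close>

definition split_form :: "(('k mat \<Rightarrow> 'k) \<times> ('k mat \<Rightarrow> 'k)) list \<Rightarrow> 'k mat \<Rightarrow> 'k mat \<Rightarrow> 'k::field" where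
  "split_form L X g = (\<Sum>(p, q)\<leftarrow>L. p X * q g)"

lemma split_form_simps [simp]:
  "split_form [] X g = 0"
  "split_form (a # L) X g = fst a X * snd a g + split_form L X g"
  "split_form (L @ M) X g = split_form L X g + split_form M X g"
  by (simp_all add: split_form_def case_prod_beta)

definition snd_poly :: "nat \<Rightarrow> ('a \<times> ('k::field mat \<Rightarrow> 'k)) list \<Rightarrow> bool" where
  "snd_poly N L \<longleftrightarrow> (\<forall>a \<in> set L. snd a \<in> polyfun N)"

lemma snd_poly_simps [simp]:
  "snd_poly N []"
  "snd_poly N (a # L) \<longleftrightarrow> snd a \<in> polyfun N \<and> snd_poly N L"
  "snd_poly N (L @ M) \<longleftrightarrow> snd_poly N L \<and> snd_poly N M"
  by (auto simp: snd_poly_def)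

lemma split_form_mult:
  assumes "snd_poly N L" "snd_poly N M"
  shows "\<exists>K. snd_poly N K \<and> (\<forall>X g. split_form K X g = split_form L X g * split_form M X g)"
  using assms(1)
proof (induction L)
  case Nil
  show ?case by (intro exI[of _ "[]"]) simp
next
  case (Cons a L)
  then obtain K where K: "snd_poly N K"
    "\<And>X g. split_form K X g = split_form L X g * split_form M X g" by auto
  let ?K = "map (\<lambda>b. (\<lambda>X. fst a X * fst b X, \<lambda>g. snd a g * snd b g)) M"
  have form: "split_form ?K X g = fst a X * snd a g * split_form M X g" for X g
    by (induction M) (simp_all add: algebra_simps)
  have "snd_poly N ?K"
    using assms(2) Cons.prems by (simp add: snd_poly_def polyfun.mult)
  then show ?case
    using K form by (intro exI[of _ "?K @ K"]) (simp add: algebra_simps)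
qed

lemma polyfun_split_form:
  fixes P :: "'k::field mat \<Rightarrow> 'k"
  assumes "P \<in> polyfun N"
  shows "\<exists>L. snd_poly N L \<and>
    (\<forall>X \<in> carrier_mat N N. \<forall>g \<in> carrier_mat N N. P (X * g) = split_form L X g)"
  using assms
proof induction
  case (const c)
  show ?case
    by (intro exI[of _ "[(\<lambda>X. c, \<lambda>g. 1)]"]) (simp add: polyfun.const)
next
  case (entry i j)
  let ?L = "map (\<lambda>k. (\<lambda>X. X $$ (i, k), \<lambda>g. g $$ (k, j))) [0..<N]"
  have "(X * g) $$ (i, j) = split_form ?L X g"
    if "X \<in> carrier_mat N N" "g \<in> carrier_mat N N" for X g :: "'k mat"
    unfolding mult_mat_index[OF that entry]
    by (simp add: split_form_def comp_def interv_sum_list_conv_sum_set_nat atLeast0LessThan)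
  moreover have "snd_poly N ?L"
    using entry by (simp add: snd_poly_def polyfun.entry)
  ultimately show ?case by blast
next
  case (add P Q)
  then obtain L M where *: "snd_poly N L" "snd_poly N M"
    "\<forall>X \<in> carrier_mat N N. \<forall>g \<in> carrier_mat N N. P (X * g) = split_form L X g"
    "\<forall>X \<in> carrier_mat N N. \<forall>g \<in> carrier_mat N N. Q (X * g) = split_form M X g" by blast
  then show ?case
    by (intro exI[of _ "L @ M"]) simp
next
  case (mult P Q)
  then obtain L M where *: "snd_poly N L" "snd_poly N M"
    "\<forall>X \<in> carrier_mat N N. \<forall>g \<in> carrier_mat N N. P (X * g) = split_form L X g"
    "\<forall>X \<in> carrier_mat N N. \<forall>g \<in> carrier_mat N N. Q (X * g) = split_form M X g" by blast
  obtain K where "snd_poly N K" "\<forall>X g. split_form K X g = split_form L X g * split_form M X g"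
    using split_form_mult[OF *(1,2)] by blast
  then show ?case using *(3,4) by (intro exI[of _ K]) simp
qed

text \<open>The translates of a polynomial function span a finite-dimensional space, with coordinates
  that are polynomial in the translating element (Gaussian elimination on the length of \<open>L\<close>).\<close>

lemma split_form_translates:
  assumes "snd_poly N L"
  shows "\<exists>M. fst ` set M \<subseteq> S \<and> snd_poly N M \<and>
    (\<forall>X. \<forall>g \<in> S. split_form L X g = (\<Sum>(g', c)\<leftarrow>M. c g * split_form L X g'))"
  using assms
proof (induction "length L" arbitrary: L)
  case 0
  then show ?case by (intro exI[of _ "[]"]) simp
next
  case (Suc n)
  from Suc.hyps(2) obtain p q L0 where L: "L = (p, q) # L0"
    by (cases L) auto
  have len: "n = length L0" and L0: "snd_poly N L0" and q: "q \<in> polyfun N"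
    using Suc L by auto
  show ?case
  proof (cases "\<forall>g \<in> S. q g = 0")
    case True
    obtain M where M: "fst ` set M \<subseteq> S" "snd_poly N M"
      "\<forall>X. \<forall>g \<in> S. split_form L0 X g = (\<Sum>(g', c)\<leftarrow>M. c g * split_form L0 X g')"
      using Suc.hyps(1)[OF len L0] by blast
    have eq: "split_form L X g = split_form L0 X g" if "g \<in> S" for X g
      using True that by (simp add: L)
    have "(\<Sum>(g', c)\<leftarrow>M. c g * split_form L X g') = (\<Sum>(g', c)\<leftarrow>M. c g * split_form L0 X g')" for X g
      by (intro arg_cong[of _ _ sum_list] map_cong) (use M(1) eq in auto)
    then have "\<forall>X. \<forall>g \<in> S. split_form L X g = (\<Sum>(g', c)\<leftarrow>M. c g * split_form L X g')"
      by (metis M(3) eq)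
    then show ?thesis
      using M(1,2) by blast
  next
    case False
    then obtain g0 where g0: "g0 \<in> S" "q g0 \<noteq> 0" by blast
    \<comment> \<open>Pivot step: subtracting \<open>t g\<close> times the translate by
      \<open>g0\<close> removes the first summand for every \<open>g\<close>, which shortens the
      list.\<close>
    define t where "t g = q g * inverse (q g0)" for g
    have t: "t \<in> polyfun N"
      unfolding t_def by (intro polyfun.mult polyfun.const q)
    define L1 where "L1 = map (\<lambda>(p', q'). (p', \<lambda>g. q' g - t g * q' g0)) L0"
    have L1: "snd_poly N L1" "n = length L1"
      using L0 len by (auto simp: L1_def snd_poly_def case_prod_beta intro!: polyfun_diff polyfun.mult[OF t] polyfun.const)
    have L1L: "split_form L1 X g = split_form L X g - t g * split_form L X g0" for X g
    proof -
      have "split_form L1 X g = split_form L0 X g - t g * split_form L0 X g0"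
        unfolding L1_def by (induction L0) (simp_all add: case_prod_beta algebra_simps)
      moreover have "t g * q g0 = q g"
        using g0 by (simp add: t_def)
      ultimately show ?thesis
        by (simp add: L algebra_simps)
    qed
    obtain M where M: "fst ` set M \<subseteq> S" "snd_poly N M"
      "\<forall>X. \<forall>g \<in> S. split_form L1 X g = (\<Sum>(g', c)\<leftarrow>M. c g * split_form L1 X g')"
      using Suc.hyps(1)[OF L1(2,1)] by blast
    \<comment> \<open>Each translate of \<open>L1\<close> is itself a translate of \<open>L\<close>
      corrected by a multiple of the pivot translate; \<open>c0\<close> collects the total
      coefficient of the latter.\<close>
    define c0 where "c0 g = t g - (\<Sum>(g', c)\<leftarrow>M. c g * t g')" for g
    have "(\<lambda>g. \<Sum>a\<leftarrow>M. snd a g * t (fst a)) \<in> polyfun N"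
      by (rule polyfun_sum_list, rule polyfun.mult[OF _ polyfun.const]) (use M(2) in \<open>auto simp: snd_poly_def\<close>)
    then have c0: "c0 \<in> polyfun N"
      unfolding c0_def case_prod_beta by (rule polyfun_diff[OF t])
    have sum: "(\<Sum>(g', c)\<leftarrow>M. c g * (u g' - t g' * w)) =
      (\<Sum>(g', c)\<leftarrow>M. c g * u g') - (\<Sum>(g', c)\<leftarrow>M. c g * t g') * w" for g u w
      by (induction M) (auto simp: algebra_simps)
    have "split_form L X g = (\<Sum>(g', c)\<leftarrow>(g0, c0) # M. c g * split_form L X g')" if "g \<in> S" for X g
    proof -
      have "split_form L X g = t g * split_form L X g0 + (\<Sum>(g', c)\<leftarrow>M. c g * split_form L1 X g')"
        unfolding M(3)[rule_format, OF that, of X, symmetric] unfolding L1L by simp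
      then show ?thesis
        unfolding L1L sum by (simp add: c0_def algebra_simps)
    qed
    then have "\<forall>X. \<forall>g \<in> S. split_form L X g = (\<Sum>(g', c)\<leftarrow>(g0, c0) # M. c g * split_form L X g')"
      by blast
    moreover have "fst ` set ((g0, c0) # M) \<subseteq> S" "snd_poly N ((g0, c0) # M)"
      using M(1,2) g0 c0 by auto
    ultimately show ?thesis by blast
  qed
qed

section \<open>The induced homomorphism\<close>

context levi_group
begin

lemma right_trans_nabla_levi: "h \<in> nabla N G lam \<Longrightarrow> g \<in> G \<Longrightarrow> right_trans G g h \<in> nabla N G lam"
  by (metis nabla_polyfun right_trans_nabla[OF G_carrier mult_G])

lemma right_trans_nabla_GL:
  fixes F :: "'k mat \<Rightarrow> 'k"
  assumes "F \<in> nabla N (GL N) lam" "length lam \<le> N" "g \<in> GL N"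
  shows "right_trans (GL N) g F \<in> nabla N (GL N) lam"
proof -
  obtain P where P: "P \<in> polyfun N" "\<And>X. X \<in> GL N \<Longrightarrow> F X = P X"
    using nabla_GL_polyfun[OF inf assms(1,2)] by metis
  show ?thesis
    by (rule right_trans_nabla[OF GL_carrier GL_mult P assms(1,3)])
qed

definition hom_fun :: "(('k mat \<Rightarrow> 'k) \<Rightarrow> 'k mat \<Rightarrow> 'k) \<Rightarrow> ('k mat \<Rightarrow> 'k) \<Rightarrow> 'k" where
  "hom_fun \<phi> h = \<phi> (lift h) (1\<^sub>m N)"

context
  fixes lam mu :: "nat list" and r :: nat and \<phi> :: "('k mat \<Rightarrow> 'k) \<Rightarrow> 'k mat \<Rightarrow> 'k"
  assumes lam: "weight_upto N m lam r" and mu: "weight_upto N m mu r"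
    and \<phi>: "\<phi> \<in> Hom_mod (GL N) (nabla N (GL N) lam) (nabla N (GL N) mu)"
begin

lemma len_lam: "length lam \<le> N"
  using lam by (simp add: weight_upto_def)

lemma hom_fun_add:
  assumes "f \<in> nabla N G lam" "h \<in> nabla N G lam"
  shows "hom_fun \<phi> (\<lambda>X. f X + h X) = hom_fun \<phi> f + hom_fun \<phi> h"
  unfolding hom_fun_def lift_add[OF assms lam]
  using Hom_modD(2)[OF \<phi> lift_nabla[OF assms(1) lam] lift_nabla[OF assms(2) lam]] by simp

lemma hom_fun_smult:
  assumes "h \<in> nabla N G lam"
  shows "hom_fun \<phi> (\<lambda>X. c * h X) = c * hom_fun \<phi> h"
  unfolding hom_fun_def lift_smult[OF assms lam]
  using Hom_modD(3)[OF \<phi> lift_nabla[OF assms lam]] by simp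

text \<open>Every translate of \<open>h\<close> is a combination of finitely many fixed translates
  with coefficients polynomial in \<open>g\<close>. By linearity of \<open>hom_fun \<phi>\<close>,
  its finitely many values on these become constants of a polynomial function.\<close>

lemma hom_fun_regular:
  assumes h: "h \<in> nabla N G lam"
  shows "restr G (\<lambda>g. hom_fun \<phi> (right_trans G g h)) \<in> coord_ring N G"
proof -
  obtain P where P: "P \<in> polyfun N" "\<And>X. X \<in> G \<Longrightarrow> h X = P X"
    using nabla_polyfun[OF h] by blast
  obtain L where L: "snd_poly N L"
    "\<forall>X \<in> carrier_mat N N. \<forall>g \<in> carrier_mat N N. P (X * g) = split_form L X g"
    using polyfun_split_form[OF P(1)] by blast
  obtain M where M: "fst ` set M \<subseteq> G" "snd_poly N M"
    "\<forall>X. \<forall>g \<in> G. split_form L X g = (\<Sum>(g', c)\<leftarrow>M. c g * split_form L X g')"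
    using split_form_translates[OF L(1), of G] by blast
  have hL: "h (X * g) = split_form L X g" if "X \<in> G" "g \<in> G" for X g
    using P(2)[OF mult_G[OF that]] L(2) that G_carrier by auto
  have rt: "right_trans G g h = (\<lambda>X. \<Sum>a\<leftarrow>M. snd a g * right_trans G (fst a) h X)" if g: "g \<in> G" for g
  proof
    fix X
    show "right_trans G g h X = (\<Sum>a\<leftarrow>M. snd a g * right_trans G (fst a) h X)"
    proof (cases "X \<in> G")
      case True
      have "right_trans G g h X = (\<Sum>a\<leftarrow>M. snd a g * split_form L X (fst a))"
        using hL[OF True g] M(3)[rule_format, OF g, of X] True
        unfolding case_prod_unfold by (simp add: right_trans_def restr_def)
      also have "\<dots> = (\<Sum>a\<leftarrow>M. snd a g * right_trans G (fst a) h X)"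
        by (intro arg_cong[of _ _ sum_list] map_cong)
          (use True M(1) hL in \<open>auto simp: right_trans_def restr_def\<close>)
      finally show ?thesis .
    qed (simp add: right_trans_def restr_def)
  qed
  have "hom_fun \<phi> (right_trans G g h) = (\<Sum>a\<leftarrow>M. snd a g * hom_fun \<phi> (right_trans G (fst a) h))"
    if "g \<in> G" for g
    unfolding rt[OF that] by (rule additive_sum_list[where \<Lambda> = "hom_fun \<phi>", OF hom_fun_add hom_fun_smult])
        (use right_trans_nabla_levi[OF h] M(1) in auto)
  then have "restr G (\<lambda>g. hom_fun \<phi> (right_trans G g h)) =
      restr G (\<lambda>g. \<Sum>a\<leftarrow>M. snd a g * hom_fun \<phi> (right_trans G (fst a) h))"
    by (auto simp: restr_def)
  also have "\<dots> \<in> coord_ring N G"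
    by (rule polyfun_restr, rule polyfun_sum_list, rule polyfun.mult[OF _ polyfun.const])
      (use M(2) in \<open>auto simp: snd_poly_def\<close>)
  finally show ?thesis .
qed

text \<open>The lift turns translation by \<open>b\<close> in \<open>G\<close> into translation by a
  lower triangular element of \<open>GL N\<close>, where the semi-invariance of
  \<open>\<phi> (lift h)\<close> at 1 applies. The weight \<open>mu\<close> reads only the first
  \<open>m\<close> diagonal entries, which the two elements share.\<close>

lemma hom_fun_borel:
  assumes h: "h \<in> nabla N G lam" and b: "b \<in> borel_subgroup N G"
  shows "hom_fun \<phi> (right_trans G b h) = weight_char mu b * hom_fun \<phi> h"
proof -
  have bG: "b \<in> G" and bl: "lower_tri N b"
    using b G_carrier by (auto simp: borel_subgroup_def lower_tri_def)
  have bc: "b \<in> carrier_mat N N" using bG G_carrier by auto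
  have bm: "lower_tri m (blk m b)"
    by (rule lower_tri_blk[OF bl m_le])
  have diag: "b $$ (i, i) \<noteq> 0" if "i < N" for i
  proof -
    have "(\<Prod>i<N. b $$ (i, i)) = 1"
      using det_lower_tri[OF bl] bG G_SL by (auto simp: SL_def)
    then show ?thesis
      using that by (metis finite_lessThan lessThan_iff prod_zero zero_neq_one)
  qed
  have bm0: "blk m b \<in> GL m"
    unfolding GL_iff det_lower_tri[OF bm] using diag m_le by auto
  \<comment> \<open>Translating by \<open>b\<close> itself would mix columns beyond \<open>m\<close>
    into the block of \<open>X * b\<close>; the block diagonal \<open>b'\<close> satisfies
    \<open>blk m (X * b') = blk m X * blk m b\<close> for every \<open>X\<close>.\<close>
  define b' where "b' = mat N N (\<lambda>(i, j). if i < m \<and> j < m then b $$ (i, j) else if i = j then 1 else 0)"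
  have b'c: "b' \<in> carrier_mat N N" by (simp add: b'_def)
  have b'l: "lower_tri N b'"
    using bl m_le by (auto simp: b'_def lower_tri_def)
  have b'GL: "b' \<in> GL N"
    unfolding GL_iff det_lower_tri[OF b'l] using diag b'c by (auto simp: b'_def)
  have b'B: "b' \<in> borel_subgroup N (GL N)"
    using b'l b'GL by (auto simp: borel_GL_iff GL_iff)
  have rt: "right_trans G b h \<in> nabla N G lam"
    by (rule right_trans_nabla_levi[OF h bG])
  have lev_b: "lev (right_trans G b h) A = lev h (A * blk m b)" if "A \<in> carrier_mat m m" for A
  proof -
    obtain Q where Q: "Q \<in> polyfun m" "\<And>A. A \<in> carrier_mat m m \<Longrightarrow> lev h (A * blk m b) = Q A"
      using polyfun_mult_right[OF lev(1)[OF h lam] blk_carrier] by blast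
    have "lev (right_trans G b h) A = Q A"
    proof (rule lev_eq[OF rt lam Q(1) _ that])
      fix a :: "'k mat" assume a: "a \<in> GL m"
      then have ac: "a \<in> carrier_mat m m" by (simp add: GL_iff)
      have ab: "a * blk m b \<in> GL m"
        using a bm0 by (auto simp: GL_iff det_mult)
      have "right_trans G b h (iota a) = h (iota a * b)"
        using iota_G[OF a] by (simp add: right_trans_def restr_def)
      \<comment> \<open>The first \<open>m\<close> rows of \<open>iota a\<close> vanish beyond
        column \<open>m\<close>, so only the first \<open>m\<close> rows of \<open>b\<close> count,
        and these vanish beyond column \<open>m\<close> by triangularity.\<close>
      also have "\<dots> = h (iota (a * blk m b))"
      proof (rule nabla_same_rows[OF h lam mult_G[OF iota_G[OF a] bG] iota_G[OF ab]])
        fix i j assume ij: "i < m" "j < N"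
        have "(iota a * b) $$ (i, j) = (\<Sum>k<N. iota a $$ (i, k) * b $$ (k, j))"
          by (rule mult_mat_index[of _ N N _ N]) (use iota_G[OF a] G_carrier bc ij m_le in auto)
        also have "\<dots> = (\<Sum>k<m. iota a $$ (i, k) * b $$ (k, j))"
          by (rule sum.mono_neutral_right) (use m_le ij iota_row[OF a] in auto)
        also have "\<dots> = iota (a * blk m b) $$ (i, j)"
        proof (cases "j < m")
          case True
          then show ?thesis
            using iota_row[OF ab ij] iota_row[OF a ij(1)] m_le
              mult_mat_index[OF ac blk_carrier ij(1) True, of b] by auto
        next
          case False
          then show ?thesis
            using iota_row[OF ab ij] bl ij m_le by (auto simp: lower_tri_def intro!: sum.neutral)
        qed
        finally show "(iota a * b) $$ (i, j) = iota (a * blk m b) $$ (i, j)" .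
      qed
      also have "\<dots> = Q a"
        using lev(2)[OF h lam ab] Q(2)[OF ac] by simp
      finally show "right_trans G b h (iota a) = Q a" .
    qed
    then show ?thesis using Q(2)[OF that] by simp
  qed
  have blk: "blk m (X * b') = blk m X * blk m b" if X: "X \<in> carrier_mat N N" for X
  proof (rule eq_matI)
    fix i j assume "i < dim_row (blk m X * blk m b)" "j < dim_col (blk m X * blk m b)"
    then have ij: "i < m" "j < m" by auto
    have "(X * b') $$ (i, j) = (\<Sum>k<N. X $$ (i, k) * b' $$ (k, j))"
      by (rule mult_mat_index[OF X b'c]) (use ij m_le in auto)
    also have "\<dots> = (\<Sum>k<m. X $$ (i, k) * b' $$ (k, j))"
      by (rule sum.mono_neutral_right) (use m_le ij in \<open>auto simp: b'_def\<close>)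
    also have "\<dots> = (\<Sum>k<m. blk m X $$ (i, k) * blk m b $$ (k, j))"
      using ij m_le by (intro sum.cong) (auto simp: b'_def)
    also have "\<dots> = (blk m X * blk m b) $$ (i, j)"
      using ij by (intro mult_mat_index[symmetric]) auto
    finally show "blk m (X * b') $$ (i, j) = (blk m X * blk m b) $$ (i, j)"
      using ij by simp
  qed auto
  have "lift (right_trans G b h) = right_trans (GL N) b' (lift h)"
  proof
    fix X
    show "lift (right_trans G b h) X = right_trans (GL N) b' (lift h) X"
    proof (cases "X \<in> GL N")
      case True
      then show ?thesis
        using GL_mult[OF True b'GL] lev_b[OF blk_carrier, of X] blk[of X]
        by (auto simp: lift_def right_trans_def restr_def GL_iff)
    qed (simp add: lift_def right_trans_def restr_def)
  qed
  then have "hom_fun \<phi> (right_trans G b h) = right_trans (GL N) b' (\<phi> (lift h)) (1\<^sub>m N)"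
    unfolding hom_fun_def using Hom_modD(4)[OF \<phi> b'GL lift_nabla[OF h lam]] by simp
  also have "\<dots> = \<phi> (lift h) (b' * 1\<^sub>m N)"
    using b'c by (simp add: right_trans_def restr_def GL_iff)
  also have "\<dots> = weight_char mu b' * \<phi> (lift h) (1\<^sub>m N)"
    using Hom_modD(1)[OF \<phi> lift_nabla[OF h lam]] b'B by (auto simp: nabla_def GL_iff)
  also have "weight_char mu b' = weight_char mu b"
    unfolding weight_char_upto[OF mu m_le] using m_le by (intro prod.cong) (auto simp: b'_def)
  finally show ?thesis by (simp add: hom_fun_def)
qed

definition induced where
  "induced = (\<lambda>h \<in> nabla N G lam. restr G (\<lambda>g. hom_fun \<phi> (right_trans G g h)))"

lemma induced_Hom: "induced \<in> Hom_mod G (nabla N G lam) (nabla N G mu)"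
  unfolding Hom_mod_def
proof (intro CollectI conjI ballI allI)
  show "induced \<in> nabla N G lam \<rightarrow>\<^sub>E nabla N G mu"
  proof (rule PiE_I)
    fix h assume h: "h \<in> nabla N G lam"
    have "restr G (\<lambda>g. hom_fun \<phi> (right_trans G g h)) (b * g) =
        weight_char mu b * restr G (\<lambda>g. hom_fun \<phi> (right_trans G g h)) g"
      if g: "g \<in> G" and b: "b \<in> borel_subgroup N G" for b g
    proof -
      have bG: "b \<in> G" using b by (simp add: borel_subgroup_def)
      show ?thesis
        using hom_fun_borel[OF right_trans_nabla_levi[OF h g] b] g bG mult_G[OF bG g]
        by (simp add: restr_def right_trans_right_trans[OF G_carrier mult_G])
    qed
    then show "induced h \<in> nabla N G mu"
      using h hom_fun_regular[OF h] by (simp add: induced_def nabla_def)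
  qed (simp add: induced_def)
  fix f h assume f: "f \<in> nabla N G lam" and h: "h \<in> nabla N G lam"
  have "right_trans G g (\<lambda>X. f X + h X) = (\<lambda>X. right_trans G g f X + right_trans G g h X)" for g
    by (auto simp: right_trans_def restr_def)
  then have "hom_fun \<phi> (right_trans G g (\<lambda>X. f X + h X)) =
      hom_fun \<phi> (right_trans G g f) + hom_fun \<phi> (right_trans G g h)" if "g \<in> G" for g
    using hom_fun_add[OF right_trans_nabla_levi[OF f that] right_trans_nabla_levi[OF h that]] by simp
  then show "induced (\<lambda>X. f X + h X) = (\<lambda>X. induced f X + induced h X)"
    using f h nabla_add[OF f h] by (auto simp: induced_def restr_def)
next
  fix c h assume h: "h \<in> nabla N G lam"
  have "right_trans G g (\<lambda>X. c * h X) = (\<lambda>X. c * right_trans G g h X)" for g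
    by (auto simp: right_trans_def restr_def)
  then have "hom_fun \<phi> (right_trans G g (\<lambda>X. c * h X)) = c * hom_fun \<phi> (right_trans G g h)"
    if "g \<in> G" for g
    using hom_fun_smult[OF right_trans_nabla_levi[OF h that]] by simp
  then show "induced (\<lambda>X. c * h X) = (\<lambda>X. c * induced h X)"
    using h nabla_smult[OF h] by (auto simp: induced_def restr_def)
next
  fix g h assume g: "g \<in> G" and h: "h \<in> nabla N G lam"
  show "induced (right_trans G g h) = right_trans G g (induced h)"
  proof
    fix X
    show "induced (right_trans G g h) X = right_trans G g (induced h) X"
    proof (cases "X \<in> G")
      case True
      have "right_trans G g (induced h) X = induced h (X * g)"
        using True by (simp add: right_trans_def restr_def)
      then show ?thesis
        using True h right_trans_nabla_levi[OF h g] mult_G[OF True g]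
          right_trans_right_trans[OF G_carrier mult_G True g]
        by (simp add: induced_def restr_def)
    next
      case False
      then have "right_trans G g (induced h) X = 0"
        by (simp add: right_trans_def restr_def)
      then show ?thesis
        using False right_trans_nabla_levi[OF h g] by (simp add: induced_def restr_def)
    qed
  qed
qed

text \<open>At \<open>g\<close> this is the comparison \<open>Hom_eval_lift_GL\<close> for the
  translate of \<open>F\<close> by \<open>g\<close>, together with the equivariance of
  \<open>\<phi>\<close>; restriction commutes with translation by elements of
  \<open>G\<close>.\<close>

lemma induced_restr:
  assumes F: "F \<in> nabla N (GL N) lam"
  shows "induced (restr G F) = restr G (\<phi> F)"
proof
  fix g
  show "induced (restr G F) g = restr G (\<phi> F) g"
  proof (cases "g \<in> G")
    case True
    then have gGL: "g \<in> GL N" using G_GL by auto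
    have "right_trans G g (restr G F) = restr G (right_trans (GL N) g F)"
      using True mult_G G_GL by (auto simp: right_trans_def restr_def fun_eq_iff)
    then have "induced (restr G F) g = \<phi> (lift (restr G (right_trans (GL N) g F))) (1\<^sub>m N)"
      using restr_nabla_levi[OF F] True by (simp add: induced_def restr_def hom_fun_def)
    also have "\<dots> = \<phi> (right_trans (GL N) g F) (1\<^sub>m N)"
      by (rule Hom_eval_lift_GL[OF right_trans_nabla_GL[OF F len_lam gGL] lam mu \<phi>, symmetric])
    also have "\<dots> = right_trans (GL N) g (\<phi> F) (1\<^sub>m N)"
      using Hom_modD(4)[OF \<phi> gGL F] by simp
    also have "\<dots> = \<phi> F g"
      using gGL left_mult_one_mat[of g N N] by (auto simp: right_trans_def restr_def GL_iff)
    finally show ?thesis using True by (simp add: restr_def)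
  next
    case False
    then show ?thesis
      using restr_nabla_levi[OF F] by (simp add: induced_def restr_def)
  qed
qed

lemma induced_is_induced: "is_induced_hom N G lam mu \<phi> induced"
  using induced_Hom induced_restr by (simp add: is_induced_hom_def)

text \<open>By equivariance \<open>\<psi> h g\<close> is the value at 1 of \<open>\<psi>\<close> on
  a translate of \<open>h\<close>, which \<open>Hom_eval_lift\<close> replaces by a restriction from
  \<open>GL N\<close>, where \<open>\<psi>\<close> is prescribed. Outside the module both maps agree
  by extensionality.\<close>

lemma induced_unique:
  assumes "is_induced_hom N G lam mu \<phi> \<psi>"
  shows "\<psi> = induced"
proof -
  have \<psi>: "\<psi> \<in> Hom_mod G (nabla N G lam) (nabla N G mu)"
    and \<psi>F: "\<And>F. F \<in> nabla N (GL N) lam \<Longrightarrow> \<psi> (restr G F) = restr G (\<phi> F)"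
    using assms by (auto simp: is_induced_hom_def)
  have "\<psi> h = induced h" if h: "h \<in> nabla N G lam" for h
  proof
    fix g
    show "\<psi> h g = induced h g"
    proof (cases "g \<in> G")
      case True
      have h': "right_trans G g h \<in> nabla N G lam"
        by (rule right_trans_nabla_levi[OF h True])
      have "\<psi> h g = right_trans G g (\<psi> h) (1\<^sub>m N)"
        using one_G True G_carrier by (auto simp: right_trans_def restr_def)
      also have "\<dots> = \<psi> (right_trans G g h) (1\<^sub>m N)"
        using Hom_modD(4)[OF \<psi> True h] by simp
      also have "\<dots> = \<psi> (restr G (lift (right_trans G g h))) (1\<^sub>m N)"
        by (rule Hom_eval_lift[OF h' lam mu \<psi>])
      also have "\<dots> = hom_fun \<phi> (right_trans G g h)"
        using \<psi>F[OF lift_nabla[OF h' lam]] one_G by (simp add: restr_def hom_fun_def)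
      finally show ?thesis
        using True h by (simp add: induced_def restr_def)
    next
      case False
      have "\<psi> h \<in> coord_ring N G"
        using Hom_modD(1)[OF \<psi> h] by (simp add: nabla_def)
      then show ?thesis
        using False h coord_ring_outside by (auto simp: induced_def restr_def)
    qed
  qed
  moreover have "\<psi> h = induced h" if "h \<notin> nabla N G lam" for h
    using that \<psi> induced_Hom by (auto simp: Hom_mod_def PiE_def extensional_def)
  ultimately show ?thesis by blast
qed

end

theorem induced_hom_bij:
  assumes lam: "weight_upto N m lam r" and mu: "weight_upto N m mu r"
  shows "(\<forall>\<phi> \<in> Hom_mod (GL N) (nabla N (GL N) lam) (nabla N (GL N) mu).
      \<exists>!\<psi>. is_induced_hom N G lam mu \<phi> \<psi>) \<and>
    inj_on (induced_hom N G lam mu) (Hom_mod (GL N) (nabla N (GL N) lam) (nabla N (GL N) mu))"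
proof -
  let ?H = "Hom_mod (GL N) (nabla N (GL N) lam) (nabla N (GL N) mu)"
  have ex1: "\<exists>!\<psi>. is_induced_hom N G lam mu \<phi> \<psi>" if "\<phi> \<in> ?H" for \<phi>
    using induced_is_induced[OF lam mu that] induced_unique[OF lam mu that] by blast
  have ind: "is_induced_hom N G lam mu \<phi> (induced_hom N G lam mu \<phi>)" if "\<phi> \<in> ?H" for \<phi>
    unfolding induced_hom_def by (rule theI'[OF ex1[OF that]])
  have "inj_on (induced_hom N G lam mu) ?H"
  proof (rule inj_onI)
    fix \<phi> \<phi>' assume \<phi>: "\<phi> \<in> ?H" and \<phi>': "\<phi>' \<in> ?H"
      and eq: "induced_hom N G lam mu \<phi> = induced_hom N G lam mu \<phi>'"
    have len: "length lam \<le> N"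
      using lam by (simp add: weight_upto_def)
    have one: "\<phi> F (1\<^sub>m N) = \<phi>' F (1\<^sub>m N)" if "F \<in> nabla N (GL N) lam" for F
    proof -
      have "restr G (\<phi> F) = restr G (\<phi>' F)"
        using ind[OF \<phi>] ind[OF \<phi>'] eq that unfolding is_induced_hom_def by metis
      from fun_cong[OF this, of "1\<^sub>m N"] show ?thesis
        using one_G by (simp add: restr_def)
    qed
    have "\<phi> F = \<phi>' F" if F: "F \<in> nabla N (GL N) lam" for F
    proof
      fix g
      show "\<phi> F g = \<phi>' F g"
      proof (cases "g \<in> GL N")
        case True
        have ev: "\<chi> F g = \<chi> (right_trans (GL N) g F) (1\<^sub>m N)" if "\<chi> \<in> ?H" for \<chi>
          using Hom_modD(4)[OF that True F] True left_mult_one_mat[of g N N]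
          by (auto simp: right_trans_def restr_def GL_iff)
        then show ?thesis
          using ev[OF \<phi>] ev[OF \<phi>'] one[OF right_trans_nabla_GL[OF F len True]] by simp
      next
        case False
        have "\<chi> F \<in> coord_ring N (GL N)" if "\<chi> \<in> ?H" for \<chi>
          using Hom_modD(1)[OF that F] by (simp add: nabla_def)
        then show ?thesis
          using \<phi> \<phi>' False coord_ring_outside by metis
      qed
    qed
    moreover have "\<phi> F = \<phi>' F" if "F \<notin> nabla N (GL N) lam" for F
      using that \<phi> \<phi>' by (auto simp: Hom_mod_def PiE_def extensional_def)
    ultimately show "\<phi> = \<phi>'" by blast
  qed
  with ex1 show ?thesis by blast
qed

end

section \<open>Groups preserving a form\<close>

text \<open>Cramer's rule rather than an abstract inverse, so that the entries are visibly a
  polynomial divided by the determinant, hence regular on \<open>GL m\<close>.\<close>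

definition inv_mat :: "nat \<Rightarrow> 'k::field mat \<Rightarrow> 'k mat" where
  "inv_mat m a = mat m m (\<lambda>(i, j). inverse (det a) * cofactor a j i)"

lemma inv_mat_index:
  "i < m \<Longrightarrow> j < m \<Longrightarrow> inv_mat m a $$ (i, j) = inverse (det a) * cofactor a j i"
  by (simp add: inv_mat_def)

lemma inv_mat_carrier [simp]: "inv_mat m a \<in> carrier_mat m m"
  by (simp add: inv_mat_def)

lemma inv_mat_dim [simp]: "dim_row (inv_mat m a) = m" "dim_col (inv_mat m a) = m"
  by (simp_all add: inv_mat_def)

lemma mult_inv_mat:
  assumes "a \<in> GL m"
  shows "a * inv_mat m a = 1\<^sub>m m" "inv_mat m a * a = 1\<^sub>m m"
proof -
  have a: "a \<in> carrier_mat m m" "det a \<noteq> 0"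
    using assms by (auto simp: GL_iff)
  have "inv_mat m a = inverse (det a) \<cdot>\<^sub>m adj_mat a"
    using a by (intro eq_matI) (auto simp: inv_mat_def adj_mat_def)
  then have "a * inv_mat m a = inverse (det a) \<cdot>\<^sub>m (a * adj_mat a)"
    using a adj_mat(1)[OF a(1)] by (simp add: mult_smult_distrib)
  then show 1: "a * inv_mat m a = 1\<^sub>m m"
    using a adj_mat(2)[OF a(1)] by (auto intro!: eq_matI)
  then show "inv_mat m a * a = 1\<^sub>m m"
    by (rule mat_mult_left_right_inverse[OF a(1) inv_mat_carrier])
qed

lemma mult_inv_mat_index:
  assumes "a \<in> GL m" "i < m" "j < m"
  shows "(\<Sum>k<m. a $$ (i, k) * inv_mat m a $$ (k, j)) = (if i = j then 1 else 0)"
    and "(\<Sum>k<m. inv_mat m a $$ (i, k) * a $$ (k, j)) = (if i = j then 1 else 0)"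
proof -
  have "a \<in> carrier_mat m m" using assms by (simp add: GL_iff)
  then show "(\<Sum>k<m. a $$ (i, k) * inv_mat m a $$ (k, j)) = (if i = j then 1 else 0)"
    and "(\<Sum>k<m. inv_mat m a $$ (i, k) * a $$ (k, j)) = (if i = j then 1 else 0)"
    using mult_mat_index[of a m m "inv_mat m a" m i j] mult_mat_index[of "inv_mat m a" m m a m i j]
      mult_inv_mat[OF assms(1)] assms(2,3) by auto
qed

lemma inv_mat_lower_tri:
  assumes b: "lower_tri m b" "det b \<noteq> 0" and "i < j" "j < m"
  shows "inv_mat m b $$ (i, j) = 0"
  using assms(3)
proof (induction i rule: less_induct)
  case (less i)
  have bGL: "b \<in> GL m"
    using b by (auto simp: GL_iff lower_tri_def)
  have diag: "b $$ (i, i) \<noteq> 0"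
    using b(2) less.prems assms(4) unfolding det_lower_tri[OF b(1)] by simp
  have "(\<Sum>k<m. b $$ (i, k) * inv_mat m b $$ (k, j)) = (\<Sum>k<m. if k = i then b $$ (i, i) * inv_mat m b $$ (i, j) else 0)"
  proof (rule sum.cong)
    fix k assume "k \<in> {..<m}"
    then show "b $$ (i, k) * inv_mat m b $$ (k, j) = (if k = i then b $$ (i, i) * inv_mat m b $$ (i, j) else 0)"
      using less b(1) assms(4) by (cases k i rule: linorder_cases) (auto simp: lower_tri_def)
  qed simp
  then show ?case
    using mult_inv_mat_index(1)[OF bGL, of i j] less.prems assms(4) diag by simp
qed

lemma inv_mat_regular:
  assumes "i < m" "j < m"
  shows "restr (GL m) (\<lambda>a. inv_mat m a $$ (i, j)) \<in> coord_ring m (GL m :: 'k::field mat set)"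
proof -
  have "(\<lambda>a::'k mat. (-1) ^ (j + i) * det (mat_delete (blk m a) j i)) \<in> polyfun m"
  proof (intro polyfun.mult polyfun.const polyfun_det[of _ "m - 1"])
    fix k l assume kl: "k < m - 1" "l < m - 1"
    have "mat_delete (blk m a) j i $$ (k, l) =
        a $$ (if k < j then k else Suc k, if l < i then l else Suc l)" for a :: "'k mat"
      using kl by (auto simp: mat_delete_def)
    then show "(\<lambda>a::'k mat. mat_delete (blk m a) j i $$ (k, l)) \<in> polyfun m"
      using kl by (simp only:) (intro polyfun.entry, auto)
  qed (auto simp: mat_delete_def)
  then have *: "(\<lambda>X. restr (GL m) (\<lambda>X. inverse (det X)) X *
      restr (GL m) (\<lambda>a::'k mat. (-1) ^ (j + i) * det (mat_delete (blk m a) j i)) X) \<in> coord_ring m (GL m)"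
    by (intro coord_ring.mult coord_ring.inv_det polyfun_restr)
  have "restr (GL m) (\<lambda>a. inv_mat m a $$ (i, j)) = (\<lambda>X. restr (GL m) (\<lambda>X. inverse (det X)) X *
      restr (GL m) (\<lambda>a::'k mat. (-1) ^ (j + i) * det (mat_delete (blk m a) j i)) X)"
    using assms by (auto simp: restr_def GL_iff inv_mat_index cofactor_def blk_self)
  then show ?thesis using * by simp
qed

definition form_mat :: "nat \<Rightarrow> (nat \<Rightarrow> 'k::field) \<Rightarrow> 'k mat" where
  "form_mat N eps = mat N N (\<lambda>(i, j). if i + j + 1 = N then eps i else 0)"

text \<open>The middle block has size \<open>q = N - 2 * m\<close>. For \<open>SO (2 * n)\<close> one takes \<open>m = n - 1\<close> and
  \<open>q = 2\<close>: the last part of the weights vanishes, and the middle block then always contains an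
  anisotropic vector, as needed for the density of the big cell.\<close>

locale form_group =
  fixes N m q :: nat and eps :: "nat \<Rightarrow> 'k::field" and sg :: 'k and G :: "'k mat set"
  assumes inf: "infinite (UNIV :: 'k set)" and N: "N = 2 * m + q"
    and eps_m: "i < m \<Longrightarrow> eps i = 1"
    and eps_dual: "i < N \<Longrightarrow> eps i * eps (N - 1 - i) = sg"
    and eps_sq: "i < N \<Longrightarrow> eps i * eps i = 1" and sg_sq: "sg * sg = 1"
    and type: "q = 0 \<and> sg = -1 \<or> (q = 1 \<or> q = 2) \<and> sg = 1 \<and> (\<forall>i. eps i = 1) \<and> (2 :: 'k) \<noteq> 0"
    and G: "G = {X \<in> SL N. transpose_mat X * form_mat N eps * X = form_mat N eps}"
begin

abbreviation "J \<equiv> form_mat N eps"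

lemma J_carrier [simp]: "J \<in> carrier_mat N N"
  by (simp add: form_mat_def)

lemma J_index: "i < N \<Longrightarrow> j < N \<Longrightarrow> J $$ (i, j) = (if i + j + 1 = N then eps i else 0)"
  by (simp add: form_mat_def)

lemma J_one [simp]: "1\<^sub>m N * J = J" "J * 1\<^sub>m N = J"
  using left_mult_one_mat[OF J_carrier] right_mult_one_mat[OF J_carrier] by auto

lemma J_sq: "J * J = sg \<cdot>\<^sub>m 1\<^sub>m N"
proof (rule eq_matI)
  fix i j assume "i < dim_row (sg \<cdot>\<^sub>m 1\<^sub>m N)" "j < dim_col (sg \<cdot>\<^sub>m 1\<^sub>m N :: 'k mat)"
  then have ij: "i < N" "j < N" by auto
  have "(J * J) $$ (i, j) = (\<Sum>k<N. J $$ (i, k) * J $$ (k, j))"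
    by (rule mult_mat_index) (use ij in auto)
  also have "\<dots> = (\<Sum>k<N. if k = N - 1 - i then (if i = j then sg else 0) else 0)"
    using ij eps_dual[OF ij(1)] by (intro sum.cong) (auto simp: J_index)
  finally show "(J * J) $$ (i, j) = (sg \<cdot>\<^sub>m 1\<^sub>m N) $$ (i, j)"
    using ij by auto
qed (auto simp: form_mat_def)

lemma sg_smult_sg: "sg \<cdot>\<^sub>m (sg \<cdot>\<^sub>m A) = A"
proof (rule eq_matI)
  fix i j assume "i < dim_row A" "j < dim_col A"
  then have "(sg \<cdot>\<^sub>m (sg \<cdot>\<^sub>m A)) $$ (i, j) = (sg * sg) * A $$ (i, j)"
    by simp
  then show "(sg \<cdot>\<^sub>m (sg \<cdot>\<^sub>m A)) $$ (i, j) = A $$ (i, j)"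
    by (simp only: sg_sq mult_1_left)
qed auto

text \<open>Since \<open>J * J\<close> is the scalar \<open>sg\<close>, the inverse of
  \<open>X\<close> is \<open>sg\<close> times \<open>J * transpose_mat X * J\<close>, and it is a
  right inverse as well as a left one. This replaces column conditions by row conditions, which suit
  functions that depend on rows.\<close>

lemma form_transpose:
  assumes X: "X \<in> carrier_mat N N" and f: "transpose_mat X * J * X = J"
  shows "X * J * transpose_mat X = J"
proof -
  define T where "T = transpose_mat X"
  have T: "T \<in> carrier_mat N N" using X by (simp add: T_def)
  define B where "B = J * T * J"
  have JT: "J * T \<in> carrier_mat N N" and TJ: "T * J \<in> carrier_mat N N"
    and XJ: "X * J \<in> carrier_mat N N" and B: "B \<in> carrier_mat N N"
    using X T by (auto simp: B_def intro!: mult_carrier_mat[of _ N N _ N])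
  have "B * X = J * (T * J * X)"
    unfolding B_def using assoc_mult_mat[OF J_carrier T J_carrier]
      assoc_mult_mat[OF J_carrier TJ X] by simp
  also have "\<dots> = sg \<cdot>\<^sub>m 1\<^sub>m N"
    using f J_sq by (simp add: T_def)
  finally have "(sg \<cdot>\<^sub>m B) * X = sg \<cdot>\<^sub>m (sg \<cdot>\<^sub>m 1\<^sub>m N)"
    using mult_smult_assoc_mat[OF B X] by simp
  then have "(sg \<cdot>\<^sub>m B) * X = 1\<^sub>m N"
    unfolding sg_smult_sg .
  then have "X * (sg \<cdot>\<^sub>m B) = 1\<^sub>m N"
    using mat_mult_left_right_inverse[of "sg \<cdot>\<^sub>m B" N X] X B by auto
  then have "sg \<cdot>\<^sub>m (sg \<cdot>\<^sub>m (X * B)) = sg \<cdot>\<^sub>m 1\<^sub>m N"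
    using mult_smult_distrib[OF X B] by simp
  then have XB: "X * B = sg \<cdot>\<^sub>m 1\<^sub>m N"
    unfolding sg_smult_sg .
  have "X * B = (X * J * T) * J"
    unfolding B_def using assoc_mult_mat[OF X JT J_carrier] assoc_mult_mat[OF X J_carrier T] by simp
  then have "(X * J * T) * (J * J) = (sg \<cdot>\<^sub>m 1\<^sub>m N) * J"
    using XB assoc_mult_mat[of "X * J * T" N N J N J N] XJ T by simp
  then have "sg \<cdot>\<^sub>m (X * J * T) = sg \<cdot>\<^sub>m J"
    unfolding J_sq using mult_smult_distrib[of "X * J * T" N N "1\<^sub>m N" N sg] XJ T
      mult_smult_assoc_mat[of "1\<^sub>m N" N N J N sg] by simp
  then have "sg \<cdot>\<^sub>m (sg \<cdot>\<^sub>m (X * J * T)) = sg \<cdot>\<^sub>m (sg \<cdot>\<^sub>m J)"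
    by simp
  then show ?thesis
    unfolding sg_smult_sg T_def .
qed

definition bil :: "(nat \<Rightarrow> 'k) \<Rightarrow> (nat \<Rightarrow> 'k) \<Rightarrow> 'k" where
  "bil x y = (\<Sum>c<N. eps c * x c * y (N - 1 - c))"

abbreviation row_fun :: "'k mat \<Rightarrow> nat \<Rightarrow> nat \<Rightarrow> 'k" where
  "row_fun X i \<equiv> (\<lambda>c. X $$ (i, c))"

lemma rows_form:
  assumes X: "X \<in> carrier_mat N N" and "i < N" "k < N"
  shows "(X * J * transpose_mat X) $$ (i, k) = bil (row_fun X i) (row_fun X k)"
proof -
  have "(X * J * transpose_mat X) $$ (i, k) = (\<Sum>d<N. (X * J) $$ (i, d) * X $$ (k, d))"
    using mult_mat_index[of "X * J" N N "transpose_mat X" N i k] X assms by auto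
  also have "\<dots> = (\<Sum>d<N. eps (N - 1 - d) * X $$ (i, N - 1 - d) * X $$ (k, d))"
  proof (rule sum.cong)
    fix d assume "d \<in> {..<N}"
    then have d: "d < N" by simp
    have "(X * J) $$ (i, d) = (\<Sum>c<N. X $$ (i, c) * J $$ (c, d))"
      by (rule mult_mat_index[OF X]) (use assms d in auto)
    also have "\<dots> = (\<Sum>c<N. if c = N - 1 - d then X $$ (i, c) * eps c else 0)"
      using d by (intro sum.cong) (auto simp: J_index)
    finally show "(X * J) $$ (i, d) * X $$ (k, d) = eps (N - 1 - d) * X $$ (i, N - 1 - d) * X $$ (k, d)"
      using d by simp
  qed simp
  also have "\<dots> = bil (row_fun X i) (row_fun X k)"
    unfolding bil_def by (rule sum.reindex_bij_witness[of _ "\<lambda>c. N - 1 - c" "\<lambda>c. N - 1 - c"]) auto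
  finally show ?thesis .
qed

lemma G_iff:
  "X \<in> G \<longleftrightarrow> X \<in> carrier_mat N N \<and> det X = 1 \<and>
    (\<forall>i<N. \<forall>k<N. bil (row_fun X i) (row_fun X k) = J $$ (i, k))"
proof (cases "X \<in> carrier_mat N N")
  case True
  have "transpose_mat X * J * X = J \<longleftrightarrow> X * J * transpose_mat X = J"
    using form_transpose[OF True] form_transpose[of "transpose_mat X"] True by auto
  also have "\<dots> \<longleftrightarrow> (\<forall>i<N. \<forall>k<N. (X * J * transpose_mat X) $$ (i, k) = J $$ (i, k))"
  proof
    assume "X * J * transpose_mat X = J"
    then show "\<forall>i<N. \<forall>k<N. (X * J * transpose_mat X) $$ (i, k) = J $$ (i, k)"
      by (simp only: simp_thms)
  next
    assume eq: "\<forall>i<N. \<forall>k<N. (X * J * transpose_mat X) $$ (i, k) = J $$ (i, k)"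
    show "X * J * transpose_mat X = J"
    proof (rule eq_matI)
      fix i k assume "i < dim_row J" "k < dim_col J"
      then show "(X * J * transpose_mat X) $$ (i, k) = J $$ (i, k)"
        using eq carrier_matD[OF J_carrier] by (simp only: simp_thms)
    qed (use True in \<open>auto simp: form_mat_def\<close>)
  qed
  finally show ?thesis
    using True rows_form[OF True] by (auto simp: G SL_def)
qed (auto simp: G SL_def)

lemma G_bil: "X \<in> G \<Longrightarrow> i < N \<Longrightarrow> k < N \<Longrightarrow>
  bil (row_fun X i) (row_fun X k) = (if i + k + 1 = N then eps i else 0)"
  by (simp add: G_iff J_index)

lemma G_carrier: "X \<in> G \<Longrightarrow> X \<in> carrier_mat N N"
  by (simp add: G_iff)

lemma one_G: "1\<^sub>m N \<in> G"
  by (simp add: G SL_def)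

lemma mult_G: "X \<in> G \<Longrightarrow> Y \<in> G \<Longrightarrow> X * Y \<in> G"
  using form_preserved_mult[OF J_carrier, of X Y] by (auto simp: G SL_def det_mult)

lemma inv_G:
  assumes "X \<in> G"
  shows "\<exists>Y \<in> G. X * Y = 1\<^sub>m N \<and> Y * X = 1\<^sub>m N"
proof -
  have X: "X \<in> carrier_mat N N" "det X = 1" "transpose_mat X * J * X = J"
    using assms by (auto simp: G SL_def)
  obtain Y where Yc: "Y \<in> carrier_mat N N" and Y: "X * Y = 1\<^sub>m N" "Y * X = 1\<^sub>m N"
    using nonsingular_inverse[OF X(1)] X(2) by auto
  have tX: "transpose_mat X \<in> carrier_mat N N" and tY: "transpose_mat Y \<in> carrier_mat N N"
    using X Yc by auto
  note assoc = assoc_mult_mat[of _ N N _ N _ N] mult_carrier_mat[of _ N N _ N]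
    mult_smult_assoc_mat[of _ N N _ N] mult_smult_distrib[of _ N N _ N]
  have "det Y = 1"
    using det_mult[OF X(1) Yc] X(2) Y(1) by simp
  moreover have "transpose_mat Y * J * Y = J"
  proof -
    have "transpose_mat Y * (transpose_mat X * J * X) * Y = transpose_mat (X * Y) * J * (X * Y)"
      using X(1) Yc tX tY by (simp add: transpose_mult[OF X(1) Yc] assoc)
    then show ?thesis by (simp add: X(3) Y(1))
  qed
  ultimately show ?thesis
    using Y Yc by (auto simp: G SL_def)
qed

section \<open>Calculus of the bilinear form on rows\<close>

lemma bil_add_left: "bil (\<lambda>c. x c + y c) z = bil x z + bil y z"
  by (simp add: bil_def algebra_simps sum.distrib)

lemma bil_add_right: "bil z (\<lambda>c. x c + y c) = bil z x + bil z y"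
  by (simp add: bil_def algebra_simps sum.distrib)

lemma bil_smult_left: "bil (\<lambda>c. a * x c) z = a * bil x z"
  by (simp add: bil_def algebra_simps sum_distrib_left)

lemma bil_smult_right: "bil z (\<lambda>c. a * x c) = a * bil z x"
  by (simp add: bil_def algebra_simps sum_distrib_left)

lemma bil_sum_left: "finite A \<Longrightarrow> bil (\<lambda>c. \<Sum>k\<in>A. a k * x k c) z = (\<Sum>k\<in>A. a k * bil (x k) z)"
proof (induction A rule: finite_induct)
  case (insert k A)
  then show ?case by (simp add: bil_add_left bil_smult_left)
qed (simp add: bil_def)

lemma eps_swap: "i < N \<Longrightarrow> k < N \<Longrightarrow> i + k + 1 = N \<Longrightarrow> eps k = sg * eps i"
proof -
  assume *: "i < N" "k < N" "i + k + 1 = N"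
  then have k: "k = N - 1 - i" by auto
  have "eps i * (eps i * eps k) = eps i * sg"
    using eps_dual[OF *(1)] k by simp
  then show ?thesis
    using eps_sq[OF *(1)] by (simp add: mult.assoc[symmetric] mult.commute)
qed

lemma bil_sym: "bil y x = sg * bil x y"
proof -
  have "bil y x = (\<Sum>c<N. eps (N - 1 - c) * y (N - 1 - c) * x c)"
    unfolding bil_def by (rule sum.reindex_bij_witness[of _ "\<lambda>c. N - 1 - c" "\<lambda>c. N - 1 - c"]) auto
  also have "\<dots> = (\<Sum>c<N. sg * (eps c * x c * y (N - 1 - c)))"
    using eps_swap by (intro sum.cong) auto
  finally show ?thesis by (simp add: bil_def sum_distrib_left)
qed

definition unit_fun :: "nat \<Rightarrow> nat \<Rightarrow> 'k" where
  "unit_fun k c = (if c = k then 1 else 0)"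

lemma bil_unit_right: "k < N \<Longrightarrow> bil x (unit_fun k) = eps (N - 1 - k) * x (N - 1 - k)"
proof -
  assume k: "k < N"
  have "bil x (unit_fun k) = (\<Sum>c<N. if c = N - 1 - k then eps (N - 1 - k) * x (N - 1 - k) else 0)"
    unfolding bil_def unit_fun_def using k by (intro sum.cong) auto
  then show ?thesis using k by simp
qed

lemma bil_unit_left: "k < N \<Longrightarrow> bil (unit_fun k) x = eps k * x (N - 1 - k)"
proof -
  assume k: "k < N"
  have "bil (unit_fun k) x = (\<Sum>c<N. if c = k then eps k * x (N - 1 - k) else 0)"
    unfolding bil_def unit_fun_def using k by (intro sum.cong) auto
  then show ?thesis using k by simp
qed

lemma bil_cong: "(\<And>c. c < N \<Longrightarrow> x c = x' c) \<Longrightarrow> (\<And>c. c < N \<Longrightarrow> y c = y' c) \<Longrightarrow> bil x y = bil x' y'"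
  unfolding bil_def by (intro sum.cong) auto

lemma G_det_sq:
  assumes X: "X \<in> carrier_mat N N"
    and "\<And>i k. i < N \<Longrightarrow> k < N \<Longrightarrow> bil (row_fun X i) (row_fun X k) = J $$ (i, k)"
  shows "det X * det X = 1"
proof -
  have "X * J * transpose_mat X = J"
    using assms rows_form[OF X] X by (intro eq_matI) (auto simp: form_mat_def)
  then have "det J = det (X * J * transpose_mat X)"
    by simp
  also have "\<dots> = det X * det J * det X"
    using X by (simp add: det_mult[of _ N] det_transpose)
  finally have "det J = det X * det J * det X" .
  moreover have "det J * det J = sg ^ N"
    using det_mult[OF J_carrier J_carrier] unfolding J_sq by simp
  then have "det J \<noteq> 0"
    using sg_sq by (metis mult_zero_left power_eq_0_iff zero_neq_one)
  ultimately show ?thesis by simp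
qed

text \<open>On a polynomial curve of isometries the determinant is a polynomial with values \<open>\<plusminus>1\<close>.\<close>

lemma isometry_curve_G:
  assumes \<gamma>: "poly_curve N \<gamma>" "\<And>s. \<gamma> s \<in> carrier_mat N N" and t: "\<gamma> t = 1\<^sub>m N"
    and iso: "\<And>s i k. i < N \<Longrightarrow> k < N \<Longrightarrow> bil (row_fun (\<gamma> s) i) (row_fun (\<gamma> s) k) = J $$ (i, k)"
  shows "\<gamma> s \<in> G"
proof -
  obtain p where p: "\<And>s. det (blk N (\<gamma> s)) = poly p s"
    using polyfun_curve[OF polyfun_det_blk[OF le_refl] \<gamma>(1)] by blast
  then have p: "det (\<gamma> s) = poly p s" for s
    using blk_self[OF \<gamma>(2)] by metis
  have "p * p = 1"
    by (rule poly_eqI_infinite[OF inf]) (use G_det_sq[OF \<gamma>(2) iso] p in auto)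
  then have "(p - 1) * (p + 1) = 0"
    by (simp add: algebra_simps)
  then have "p = 1 \<or> p = -1"
    by (simp add: eq_neg_iff_add_eq_0)
  moreover have "poly p t = 1"
    using p[of t] t by simp
  ultimately have "poly p s = 1"
    by auto
  then show ?thesis
    using p iso \<gamma>(2) by (simp add: G_iff)
qed

section \<open>The Levi factor and its central torus\<close>

definition wt :: "nat \<Rightarrow> nat" where
  "wt j = (if j < m then 2 else if j < N - m then 1 else 0)"

text \<open>Blocks \<open>a\<close>, the identity of size \<open>q\<close>, and the inverse of
  \<open>a\<close> reflected in the antidiagonal. The last block is forced: the form pairs
  coordinate \<open>c\<close> with \<open>N - 1 - c\<close>, so the last \<open>m\<close>
  coordinates are dual to the first.\<close>

definition iota :: "'k mat \<Rightarrow> 'k mat" where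
  "iota a = mat N N (\<lambda>(i, j). if i < m \<and> j < m then a $$ (i, j)
    else if N - m \<le> i \<and> N - m \<le> j then inv_mat m a $$ (N - 1 - j, N - 1 - i)
    else if i = j then 1 else 0)"

lemma iota_carrier [simp]: "iota a \<in> carrier_mat N N"
  by (simp add: iota_def)

lemma iota_index: "i < N \<Longrightarrow> j < N \<Longrightarrow> iota a $$ (i, j) = (if i < m \<and> j < m then a $$ (i, j)
    else if N - m \<le> i \<and> N - m \<le> j then inv_mat m a $$ (N - 1 - j, N - 1 - i)
    else if i = j then 1 else 0)"
  by (simp add: iota_def)

lemma m_le: "m \<le> N" "m \<le> N - m"
  using N by auto

lemma bil_sym_J:
  assumes "i < N" "k < N" "bil y x = J $$ (k, i)"
  shows "bil x y = J $$ (i, k)"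
proof -
  have "bil x y = sg * J $$ (k, i)"
    using bil_sym[of x y] assms(3) by simp
  also have "\<dots> = J $$ (i, k)"
    using assms(1,2) eps_swap[of k i] by (auto simp: J_index)
  finally show ?thesis .
qed

lemma bil_left_supp:
  assumes "S \<subseteq> {..<N}" and "\<And>c. c < N \<Longrightarrow> c \<notin> S \<Longrightarrow> x c = 0"
  shows "bil x y = (\<Sum>c\<in>S. eps c * x c * y (N - 1 - c))"
  unfolding bil_def by (rule sum.mono_neutral_right) (use assms in auto)

lemma iota_isometry:
  assumes a: "a \<in> GL m" and i: "i < N" and k: "k < N"
  shows "bil (row_fun (iota a) i) (row_fun (iota a) k) = J $$ (i, k)"
proof -
  have 1: "bil (row_fun (iota a) i) (row_fun (iota a) k) = J $$ (i, k)" if im: "i < m" and k: "k < N" for i k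
  proof -
    have i: "i < N" using im m_le by simp
    have "bil (row_fun (iota a) i) (row_fun (iota a) k) =
        (\<Sum>c<m. eps c * iota a $$ (i, c) * iota a $$ (k, N - 1 - c))"
      by (rule bil_left_supp) (use m_le im i in \<open>auto simp: iota_index\<close>)
    also have "\<dots> = (\<Sum>c<m. a $$ (i, c) * (if N - m \<le> k then inv_mat m a $$ (c, N - 1 - k) else 0))"
    proof (rule sum.cong)
      fix c assume "c \<in> {..<m}"
      then have c: "c < m" "c < N" "N - 1 - c < N" "N - m \<le> N - 1 - c" "\<not> N - 1 - c < m"
        using m_le by auto
      then show "eps c * iota a $$ (i, c) * iota a $$ (k, N - 1 - c) =
          a $$ (i, c) * (if N - m \<le> k then inv_mat m a $$ (c, N - 1 - k) else 0)"
        using im i k eps_m[OF c(1)] by (auto simp: iota_index)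
    qed simp
    also have "\<dots> = J $$ (i, k)"
    proof (cases "N - m \<le> k")
      case True
      then show ?thesis
        using mult_inv_mat_index(1)[OF a im, of "N - 1 - k"] i k m_le eps_m[OF im] im
        by (auto simp: J_index)
    next
      case False
      then show ?thesis using i k im by (auto simp: J_index)
    qed
    finally show ?thesis .
  qed
  consider "i < m" | "k < m" | "m \<le> i" "i < N - m" "m \<le> k" | "N - m \<le> i" "m \<le> k"
    by linarith
  then show ?thesis
  proof cases
    case 1
    then show ?thesis using \<open>\<And>i k. i < m \<Longrightarrow> k < N \<Longrightarrow> _ i k\<close> k by blast
  next
    case 2
    then show ?thesis using 1[of k i] i bil_sym_J[OF i k] by blast
  next
    case 3
    have "bil (row_fun (iota a) i) (row_fun (iota a) k) = bil (unit_fun i) (row_fun (iota a) k)"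
      by (rule bil_cong) (use 3 i in \<open>auto simp: iota_index unit_fun_def\<close>)
    also have "\<dots> = J $$ (i, k)"
      unfolding bil_unit_left[OF i] using 3 i k m_le by (auto simp: iota_index J_index)
    finally show ?thesis .
  next
    case 4
    have "bil (row_fun (iota a) i) (row_fun (iota a) k) =
        (\<Sum>c\<in>{N - m..<N}. eps c * iota a $$ (i, c) * iota a $$ (k, N - 1 - c))"
      by (rule bil_left_supp) (use 4 i m_le in \<open>auto simp: iota_index\<close>)
    also have "\<dots> = 0"
      by (rule sum.neutral) (use 4 k m_le in \<open>auto simp: iota_index\<close>)
    also have "\<dots> = J $$ (i, k)"
      using 4 i k by (auto simp: J_index)
    finally show ?thesis .
  qed
qed

lemma iota_regular:
  assumes "P \<in> polyfun N"
  shows "restr (GL m) (\<lambda>a. P (iota a)) \<in> coord_ring m (GL m)"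
  using assms
proof induction
  case (const c)
  show ?case by (rule coord_ring.const)
next
  case (entry i j)
  consider "i < m \<and> j < m" | "\<not> (i < m \<and> j < m)" "N - m \<le> i \<and> N - m \<le> j"
    | "\<not> (i < m \<and> j < m)" "\<not> (N - m \<le> i \<and> N - m \<le> j)" by blast
  then show ?case
  proof cases
    case 1
    then show ?thesis
      using entry by (simp add: iota_index coord_ring.entry)
  next
    case 2
    then have *: "N - 1 - j < m" "N - 1 - i < m" using entry by auto
    from 2 have "(\<lambda>a. iota a $$ (i, j)) = (\<lambda>a. inv_mat m a $$ (N - 1 - j, N - 1 - i))"
      using entry by (auto simp: iota_index)
    then show ?thesis using inv_mat_regular[OF *] by simp
  next
    case 3
    then have "(\<lambda>a. iota a $$ (i, j)) = (\<lambda>a. if i = j then 1 else 0)"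
      using entry by (auto simp: iota_index)
    then show ?thesis by (simp only: coord_ring.const)
  qed
next
  case (add P Q)
  show ?case unfolding restr_add by (rule coord_ring.add[OF add.IH])
next
  case (mult P Q)
  show ?case unfolding restr_mult by (rule coord_ring.mult[OF mult.IH])
qed

lemma iota_one: "iota (1\<^sub>m m) = 1\<^sub>m N"
proof -
  have GL: "(1\<^sub>m m :: 'k mat) \<in> GL m" by (simp add: GL_iff)
  have "inv_mat m (1\<^sub>m m) = (1\<^sub>m m :: 'k mat)"
    using mult_inv_mat(1)[OF GL] left_mult_one_mat[OF inv_mat_carrier, of m "1\<^sub>m m :: 'k mat"] by metis
  then show ?thesis
    using m_le by (intro eq_matI) (auto simp: iota_def)
qed

text \<open>\<open>det (iota a)\<close> is a regular function with values \<open>\<plusminus>1\<close>; compare it with its value at \<open>1\<close>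
  along a line.\<close>

lemma det_iota:
  assumes a: "a \<in> GL m"
  shows "det (iota a) = 1"
proof -
  have blk: "blk N (iota a) = iota a" for a
    by (rule blk_self) simp
  have "\<exists>P \<in> polyfun m. \<exists>k. \<forall>X \<in> GL m.
      restr (GL m) (\<lambda>a. det (blk N (iota a))) X * det X ^ k = P X"
    by (rule coord_ring_numerator[OF order_refl iota_regular[OF polyfun_det_blk[OF le_refl]]])
  then obtain P k where P: "P \<in> polyfun m" "\<And>X. X \<in> GL m \<Longrightarrow> det (iota X) * det X ^ k = P X"
    by (auto simp: restr_def blk)
  have sq: "det (iota X) * det (iota X) = 1" if "X \<in> GL m" for X
    using G_det_sq[OF iota_carrier iota_isometry[OF that]] .
  let ?a = "\<lambda>s. a + s \<cdot>\<^sub>m (1\<^sub>m m - a)"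
  have ac: "a \<in> carrier_mat m m" using a by (simp add: GL_iff)
  have c: "?a s \<in> carrier_mat m m" for s using ac by auto
  have line: "poly_curve m ?a"
    by (rule poly_curve_line) (use ac in auto)
  have a0: "?a 0 = a" and a1: "?a 1 = 1\<^sub>m m"
    using ac by (auto intro!: eq_matI)
  obtain p d where p: "\<And>s. P (?a s) = poly p s" and d: "\<And>s. det (blk m (?a s)) = poly d s"
    using polyfun_curve[OF P(1) line] polyfun_curve[OF polyfun_det_blk[OF le_refl] line] by blast
  have d': "det (?a s) = poly d s" for s
    using d[of s] blk_self[OF c] by simp
  have d1: "poly d 1 = 1" using d'[of 1] a1 by simp
  then have "d \<noteq> 0" by auto
  \<comment> \<open>The extra factor \<open>d\<close> takes care of the parameters where the line
    meets singular matrices.\<close>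
  have "(p * p - d ^ k * d ^ k) * d = 0"
  proof (rule poly_eqI_infinite[OF inf])
    fix s
    show "poly ((p * p - d ^ k * d ^ k) * d) s = poly 0 s"
    proof (cases "poly d s = 0")
      case False
      then have "?a s \<in> GL m" using d' c by (simp add: GL_iff)
      then have "poly p s = det (iota (?a s)) * poly d s ^ k"
        using P(2)[of "?a s"] p d' by simp
      then have "poly p s * poly p s = (det (iota (?a s)) * det (iota (?a s))) * (poly d s ^ k * poly d s ^ k)"
        by (simp only: ac_simps)
      then show ?thesis
        using sq[OF \<open>?a s \<in> GL m\<close>] by simp
    qed simp
  qed
  then have "(p - d ^ k) * (p + d ^ k) = 0"
    using \<open>d \<noteq> 0\<close> by (simp add: algebra_simps)
  then have pd: "p = d ^ k \<or> p = - (d ^ k)"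
    by (simp add: eq_neg_iff_add_eq_0)
  have GL1: "1\<^sub>m m \<in> GL m" by (simp add: GL_iff)
  have p1: "poly p 1 = 1"
    using P(2)[OF GL1] p[of 1] a1 iota_one by simp
  have "poly p s = poly d s ^ k" for s
    using pd
  proof
    \<comment> \<open>Evaluation at 1, where the matrix is the identity, gives
      \<open>1 = - 1\<close>: in characteristic 2, which the symplectic case allows, the two signs
      coincide.\<close>
    assume "p = - (d ^ k)"
    then have m1: "poly p s = - (poly d s ^ k)" for s by simp
    then have "(1::'k) = - 1" using p1 d1 by simp
    then have "- (poly d s ^ k) = poly d s ^ k"
      by (metis mult_1 mult_minus_left)
    then show ?thesis using m1 by simp
  qed simp
  then have "P a = det a ^ k"
    using p[of 0] d'[of 0] a0 by simp
  then show ?thesis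
    using P(2)[OF a] a by (simp add: GL_iff)
qed

lemma iota_G: "a \<in> GL m \<Longrightarrow> iota a \<in> G"
  using iota_isometry det_iota by (simp add: G_iff)

lemma iota_row: "i < m \<Longrightarrow> j < N \<Longrightarrow> iota a $$ (i, j) = (if j < m then a $$ (i, j) else 0)"
  using m_le by (simp add: iota_index)

lemma iota_lower:
  assumes "lower_tri m b" "det b \<noteq> 0"
  shows "lower_tri N (iota b)"
  unfolding lower_tri_def
proof (intro conjI allI impI)
  fix i j assume ij: "i < N" "j < N" "i < j"
  then show "iota b $$ (i, j) = 0"
    using assms inv_mat_lower_tri[OF assms, of "N - 1 - j" "N - 1 - i"]
    by (auto simp: iota_index lower_tri_def)
qed simp

lemma torus_G:
  assumes "c \<noteq> 0"
  shows "torus_elt N wt c \<in> G"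
proof -
  let ?a = "c \<cdot>\<^sub>m 1\<^sub>m m"
  have a: "?a \<in> GL m" using assms by (simp add: GL_iff)
  have "?a * inv_mat m ?a = c \<cdot>\<^sub>m inv_mat m ?a"
    using mult_smult_assoc_mat[OF one_carrier_mat inv_mat_carrier, of c m ?a]
      left_mult_one_mat[OF inv_mat_carrier, of m ?a] by simp
  then have "inv_mat m ?a = inverse c \<cdot>\<^sub>m (?a * inv_mat m ?a)"
    using assms by (intro eq_matI) (simp_all only: index_smult_mat inv_mat_dim, simp)
  also have "\<dots> = inverse c \<cdot>\<^sub>m 1\<^sub>m m"
    using mult_inv_mat(1)[OF a] by simp
  finally have inv: "inv_mat m ?a = inverse c \<cdot>\<^sub>m 1\<^sub>m m" .
  have "iota ?a = torus_elt N wt c"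
  proof (rule eq_matI)
    fix i j assume "i < dim_row (torus_elt N wt c)" "j < dim_col (torus_elt N wt c)"
    then have ij: "i < N" "j < N" by (auto simp: torus_elt_def)
    have "N - 1 - j = N - 1 - i \<longleftrightarrow> i = j" using ij by auto
    then show "iota ?a $$ (i, j) = torus_elt N wt c $$ (i, j)"
      using ij assms m_le unfolding iota_index[OF ij] inv
      by (auto simp: torus_elt_def wt_def power2_eq_square inverse_eq_divide)
  qed (auto simp: torus_elt_def iota_def)
  then show ?thesis
    using iota_G[OF a] by simp
qed

text \<open>If the \<open>m\<close> isotropic rows \<open>p\<close> start with the identity matrix, \<open>nu p 1\<close> completes them to a
  unipotent isometry, and \<open>nu p s\<close> contracts it to the identity as \<open>s\<close> goes to \<open>0\<close>.\<close>

definition nu :: "(nat \<Rightarrow> nat \<Rightarrow> 'k) \<Rightarrow> 'k \<Rightarrow> 'k mat" where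
  "nu p s = mat N N (\<lambda>(i, j). if i < m then p i j * s ^ (2 - wt j)
    else if i < N - m \<and> N - m \<le> j then - (eps (N - 1 - i) * s * p (N - 1 - j) (N - 1 - i))
    else if i = j then 1 else 0)"

lemma nu_index: "i < N \<Longrightarrow> j < N \<Longrightarrow> nu p s $$ (i, j) = (if i < m then p i j * s ^ (2 - wt j)
    else if i < N - m \<and> N - m \<le> j then - (eps (N - 1 - i) * s * p (N - 1 - j) (N - 1 - i))
    else if i = j then 1 else 0)"
  by (simp add: nu_def)

text \<open>Paired columns carry exponents with constant sum, so scaling the rows multiplies their
  mutual pairings by \<open>s ^ 2\<close>, and isotropic rows stay isotropic.\<close>

lemma wt_dual: "c < N \<Longrightarrow> (2 - wt c) + (2 - wt (N - 1 - c)) = 2"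
  using m_le by (auto simp: wt_def)

lemma nu_isometry:
  assumes p: "\<And>i j. i < m \<Longrightarrow> j < m \<Longrightarrow> p i j = (if i = j then 1 else 0)"
    and iso: "\<And>i k. i < m \<Longrightarrow> k < m \<Longrightarrow> bil (p i) (p k) = 0"
    and i: "i < N" and k: "k < N"
  shows "bil (row_fun (nu p s) i) (row_fun (nu p s) k) = J $$ (i, k)"
proof -
  let ?r = "row_fun (nu p s)"
  have last: "bil x (?r k) = eps (N - 1 - k) * x (N - 1 - k)" if "k < N" "N - m \<le> k" for k x
  proof -
    have "bil x (?r k) = bil x (unit_fun k)"
      by (rule bil_cong) (use that m_le in \<open>auto simp: nu_index unit_fun_def\<close>)
    then show ?thesis using bil_unit_right[OF that(1)] by simp
  qed
  have first: "bil (?r i) (?r k) = J $$ (i, k)" if im: "i < m" and k: "k < N" for i k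
  proof -
    have i: "i < N" using im m_le by simp
    consider "k < m" | "m \<le> k" "k < N - m" | "N - m \<le> k" by linarith
    then show ?thesis
    proof cases
      case 1
      have "bil (?r i) (?r k) = (\<Sum>c<N. s ^ 2 * (eps c * p i c * p k (N - 1 - c)))"
        unfolding bil_def
      proof (rule sum.cong)
        fix c assume "c \<in> {..<N}"
        then have c: "c < N" "N - 1 - c < N" by auto
        have "s ^ (2 - wt c) * s ^ (2 - wt (N - 1 - c)) = s ^ 2"
          by (simp only: power_add[symmetric] wt_dual[OF c(1)])
        then show "eps c * nu p s $$ (i, c) * nu p s $$ (k, N - 1 - c) = s ^ 2 * (eps c * p i c * p k (N - 1 - c))"
          using im 1 i k c by (simp add: nu_index)
      qed simp
      also have "\<dots> = s ^ 2 * bil (p i) (p k)"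
        by (simp add: bil_def sum_distrib_left)
      finally show ?thesis
        using iso[OF im 1] i k im 1 m_le by (auto simp: J_index)
    next
      case 2
      let ?f = "\<lambda>c. eps c * nu p s $$ (i, c) * nu p s $$ (k, N - 1 - c)"
      \<comment> \<open>Two terms survive: the entry of row \<open>i\<close> at the dual of
        \<open>k\<close>, paired with the diagonal entry of row \<open>k\<close>, and the unit entry
        at \<open>i\<close>, paired with the correction in row \<open>k\<close>. The correction is
        chosen so that they cancel.\<close>
      have "bil (?r i) (?r k) = (\<Sum>c<N. (if c = N - 1 - k then eps (N - 1 - k) * (p i (N - 1 - k) * s) else 0) +
          (if c = i then - (eps (N - 1 - k) * s * p i (N - 1 - k)) else 0))"
        unfolding bil_def
      proof (rule sum.cong)
        fix c assume "c \<in> {..<N}"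
        then have c: "c < N" "N - 1 - c < N" by auto
        have nk: "N - 1 - c = k \<longleftrightarrow> c = N - 1 - k" using c k by auto
        consider "c < m" | "m \<le> c" "c < N - m" | "N - m \<le> c" by linarith
        then show "?f c = (if c = N - 1 - k then eps (N - 1 - k) * (p i (N - 1 - k) * s) else 0) +
          (if c = i then - (eps (N - 1 - k) * s * p i (N - 1 - k)) else 0)"
        proof cases
          case 1
          then have "c \<noteq> N - 1 - k" "N - m \<le> N - 1 - c" "N - 1 - (N - 1 - c) = c" using 2 k c by auto
          then show ?thesis
            using 1 2 c i k im p[OF im 1] eps_m[OF 1] by (auto simp: nu_index wt_def)
        next
          case c2: 2
          then have "c \<noteq> i" "\<not> N - m \<le> N - 1 - c" "wt c = 1" using im c by (auto simp: wt_def)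
          then show ?thesis
            using c2 2 c i k im nk by (auto simp: nu_index)
        next
          case 3
          then have "c \<noteq> i" "\<not> N - m \<le> N - 1 - c" "c \<noteq> N - 1 - k" "k \<noteq> N - 1 - c"
            using im c 2 k m_le by auto
          then show ?thesis
            using 3 2 c i k im nk by (auto simp: nu_index)
        qed
      qed simp
      also have "\<dots> = 0"
        using i k by (simp add: sum.distrib)
      also have "\<dots> = J $$ (i, k)"
        using im 2 i k by (auto simp: J_index)
      finally show ?thesis .
    next
      case 3
      then have "N - 1 - k < m" using k by auto
      then show ?thesis
        unfolding last[OF k 3] using im i k p[OF im] eps_m by (auto simp: nu_index J_index wt_def)
    qed
  qed
  consider "i < m" | "k < m" | "m \<le> i" "m \<le> k" "N - m \<le> k" | "m \<le> k" "N - m \<le> i"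
    | "m \<le> i" "m \<le> k" "i < N - m" "k < N - m"
    by linarith
  then show ?thesis
  proof cases
    case 1
    then show ?thesis using first k by blast
  next
    case 2
    then show ?thesis using first[of k i] i bil_sym_J[OF i k] by blast
  next
    case 3
    then show ?thesis
      unfolding last[OF k 3(3)] using i k m_le by (auto simp: nu_index J_index)
  next
    case 4
    have "bil (?r k) (?r i) = J $$ (k, i)"
      unfolding last[OF i 4(2)] using 4 i k m_le by (auto simp: nu_index J_index)
    then show ?thesis by (rule bil_sym_J[OF i k])
  next
    case 5
    have "bil (?r i) (?r k) = (\<Sum>c<N. if c = i then eps i * (if k = N - 1 - i then 1 else 0) else 0)"
      unfolding bil_def
    proof (rule sum.cong)
      fix c assume "c \<in> {..<N}"
      then have c: "c < N" "N - 1 - c < N" by auto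
      have nk: "N - 1 - c = k \<longleftrightarrow> c = N - 1 - k" using c k by auto
      show "eps c * nu p s $$ (i, c) * nu p s $$ (k, N - 1 - c) =
          (if c = i then eps i * (if k = N - 1 - i then 1 else 0) else 0)"
      proof (cases "N - m \<le> c")
        case True
        then have "N - 1 - c < m" using c by auto
        then have "nu p s $$ (k, N - 1 - c) = 0"
          using 5 c k m_le by (auto simp: nu_index)
        then show ?thesis using True 5 by auto
      next
        case False
        then show ?thesis using 5 c i k by (auto simp: nu_index)
      qed
    qed simp
    also have "\<dots> = J $$ (i, k)"
      using i k by (auto simp: J_index)
    finally show ?thesis .
  qed
qed

text \<open>The first \<open>m\<close> rows of \<open>X\<close> factor as \<open>blk m X\<close>
  times rows that begin with the identity matrix. The latter are still isotropic, \<open>nu\<close>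
  contracts them, and \<open>iota (blk m X)\<close> on the left restores the block for all
  \<open>s\<close>.\<close>

lemma cell:
  assumes X: "X \<in> G" and dX: "det (blk m X) \<noteq> 0"
  shows "\<exists>Y. poly_curve N Y \<and> (\<forall>s. Y s \<in> G) \<and> Y 0 = iota (blk m X) \<and>
    (\<forall>s. \<forall>i < m. \<forall>j < N. Y s $$ (i, j) = X $$ (i, j) * s ^ (2 - wt j))"
proof -
  let ?A = "blk m X"
  have A: "?A \<in> GL m" using dX by (simp add: GL_iff)
  define p where "p i j = (\<Sum>k<m. inv_mat m ?A $$ (i, k) * X $$ (k, j))" for i j
  have Xc: "X \<in> carrier_mat N N" using X by (rule G_carrier)
  have p1: "p i j = (if i = j then 1 else 0)" if "i < m" "j < m" for i j
  proof -
    have "p i j = (\<Sum>k<m. inv_mat m ?A $$ (i, k) * ?A $$ (k, j))"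
      unfolding p_def using that by (intro sum.cong) auto
    then show ?thesis using mult_inv_mat_index(2)[OF A that] by simp
  qed
  have piso: "bil (p i) (p k) = 0" if "i < m" "k < m" for i k
  proof -
    have 1: "bil (row_fun X l) (p k) = 0" if "l < m" for l
    proof -
      have "bil (p k) (row_fun X l) = (\<Sum>k'<m. inv_mat m ?A $$ (k, k') * bil (row_fun X k') (row_fun X l))"
        unfolding p_def by (rule bil_sum_left) simp
      also have "\<dots> = 0"
        by (rule sum.neutral) (use G_bil[OF X] that m_le in auto)
      finally show ?thesis using bil_sym[of "row_fun X l" "p k"] by simp
    qed
    have "bil (p i) (p k) = (\<Sum>k'<m. inv_mat m ?A $$ (i, k') * bil (row_fun X k') (p k))"
      unfolding p_def[of i] by (rule bil_sum_left) simp
    then show ?thesis using 1 by simp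
  qed
  have nuc: "nu p s \<in> carrier_mat N N" for s by (simp add: nu_def)
  have curve: "poly_curve N (nu p)"
  proof (rule poly_curveI)
    fix i j assume ij: "i < N" "j < N"
    show "poly_map (\<lambda>s. nu p s $$ (i, j))"
    proof -
      consider "i < m" | "\<not> i < m" "i < N - m \<and> N - m \<le> j" | "\<not> i < m" "\<not> (i < N - m \<and> N - m \<le> j)" by blast
      then show ?thesis
      proof cases
        case 1
        then show ?thesis using ij
          by (simp add: nu_index poly_map_mult poly_map_const poly_map_power poly_map_ident)
      next
        case 2
        have "poly_map (\<lambda>s. (- eps (N - 1 - i)) * s * p (N - 1 - j) (N - 1 - i))"
          by (intro poly_map_mult poly_map_const poly_map_ident)
        then show ?thesis using 2 ij by (simp add: nu_index)
      next
        case 3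
        then have "(\<lambda>s. nu p s $$ (i, j)) = (\<lambda>s. if i = j then 1 else 0)"
          using ij by (auto simp: nu_index)
        then show ?thesis by (simp only: poly_map_const)
      qed
    qed
  qed
  have nu0: "nu p 0 = 1\<^sub>m N"
    using m_le by (intro eq_matI) (auto simp: nu_def wt_def p1)
  have nuG: "nu p s \<in> G" for s
    by (rule isometry_curve_G[OF curve nuc nu0 nu_isometry[OF p1 piso]])
  have iA: "iota ?A \<in> G" by (rule iota_G[OF A])
  have "poly_curve N (\<lambda>s. iota ?A)"
    by (rule poly_curveI) (rule poly_map_const)
  then have 1: "poly_curve N (\<lambda>s. iota ?A * nu p s)"
    by (rule poly_curve_mult[OF _ curve iota_carrier nuc])
  have 2: "iota ?A * nu p s \<in> G" for s
    by (rule mult_G[OF iA nuG])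
  have 3: "iota ?A * nu p 0 = iota ?A"
    unfolding nu0 by (rule right_mult_one_mat[OF iota_carrier])
  have 4: "(iota ?A * nu p s) $$ (i, j) = X $$ (i, j) * s ^ (2 - wt j)" if ij: "i < m" "j < N" for s i j
  proof -
    have i: "i < N" using ij m_le by simp
    have "(iota ?A * nu p s) $$ (i, j) = (\<Sum>k<N. iota ?A $$ (i, k) * nu p s $$ (k, j))"
      by (rule mult_mat_index[OF iota_carrier nuc i ij(2)])
    also have "\<dots> = (\<Sum>k<m. iota ?A $$ (i, k) * nu p s $$ (k, j))"
      by (rule sum.mono_neutral_right) (use m_le ij iota_row in auto)
    also have "\<dots> = (\<Sum>k<m. X $$ (i, k) * p k j) * s ^ (2 - wt j)"
      unfolding sum_distrib_right using ij m_le
      by (intro sum.cong) (auto simp: iota_row nu_index)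
    also have "(\<Sum>k<m. X $$ (i, k) * p k j) = (\<Sum>k<m. \<Sum>l<m. ?A $$ (i, k) * inv_mat m ?A $$ (k, l) * X $$ (l, j))"
      unfolding p_def sum_distrib_left using ij by (intro sum.cong) (auto simp: mult.assoc)
    also have "\<dots> = (\<Sum>l<m. (\<Sum>k<m. ?A $$ (i, k) * inv_mat m ?A $$ (k, l)) * X $$ (l, j))"
      unfolding sum_distrib_right by (rule sum.swap)
    also have "\<dots> = (\<Sum>l<m. if l = i then X $$ (i, j) else 0)"
      using mult_inv_mat_index(1)[OF A ij(1)] by (intro sum.cong) auto
    also have "\<dots> = X $$ (i, j)"
      using ij by simp
    finally show ?thesis .
  qed
  show ?thesis
    by (intro exI[of _ "\<lambda>s. iota ?A * nu p s"] conjI allI impI) (fact 1 2 3 | rule 4; assumption)+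
qed

text \<open>Pairing with the first rows, which are unit vectors, reads off the last \<open>m\<close>
  columns. What remains is the middle block of size \<open>q\<close>, trivial unless
  \<open>q = 2\<close>; then it is an isometry of a hyperbolic plane, either diagonal or
  antidiagonal, and the determinant excludes the latter.\<close>

lemma rigid:
  assumes X: "X \<in> G" and rows: "\<And>i j. i < m \<Longrightarrow> j < N \<Longrightarrow> X $$ (i, j) = (if i = j then 1 else 0)"
  shows "lower_tri N X"
proof -
  have Xc: "X \<in> carrier_mat N N" by (rule G_carrier[OF X])
  have last: "X $$ (i, j) = (if i = j then 1 else 0)" if "i < N" "j < N" "N - m \<le> j" for i j
  proof -
    define k where "k = N - 1 - j"
    have k: "k < m" "k < N" "N - 1 - k = j" using that m_le by (auto simp: k_def)
    have "bil (row_fun X i) (row_fun X k) = bil (row_fun X i) (unit_fun k)"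
      by (rule bil_cong) (use rows[OF k(1)] in \<open>auto simp: unit_fun_def\<close>)
    then have "(if i + k + 1 = N then eps i else 0) = eps j * X $$ (i, j)"
      using G_bil[OF X that(1) k(2)] bil_unit_right[OF k(2)] k(3) by simp
    moreover have "i + k + 1 = N \<longleftrightarrow> i = j" using that k by auto
    moreover have "eps j \<noteq> 0" using eps_sq[OF that(2)] by auto
    ultimately show ?thesis by (auto split: if_splits)
  qed
  have mid: "X $$ (i, j) = 0" if ij: "m \<le> i" "i < j" "j < N - m" for i j
  proof -
    have q: "q = 2" "i = m" "j = m + 1" and two: "(2::'k) \<noteq> 0" "\<And>i. eps i = 1"
      using ij N type by auto
    have NN: "N = 2 * m + 2" using N q by simp
    have bm: "bil (row_fun X m) (row_fun X k) = X $$ (m, m) * X $$ (k, m + 1) + X $$ (m, m + 1) * X $$ (k, m)"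
      if k: "k = m \<or> k = m + 1" for k
    proof -
      have "bil (row_fun X m) (row_fun X k) = (\<Sum>c\<in>{m, m + 1}. eps c * X $$ (m, c) * X $$ (k, N - 1 - c))"
        unfolding bil_def
      proof (rule sum.mono_neutral_right)
        show "\<forall>c \<in> {..<N} - {m, m + 1}. eps c * X $$ (m, c) * X $$ (k, N - 1 - c) = 0"
        proof
          fix c assume c: "c \<in> {..<N} - {m, m + 1}"
          then consider "N - m \<le> c" | "N - m \<le> N - 1 - c" using NN by fastforce
          then show "eps c * X $$ (m, c) * X $$ (k, N - 1 - c) = 0"
          proof cases
            case 1
            then show ?thesis using last[of m c] c NN by auto
          next
            case 2
            then have "k < N" "N - 1 - c < N" "k \<noteq> N - 1 - c" using c NN k by auto
            then show ?thesis using last[of k "N - 1 - c"] 2 by simp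
          qed
        qed
      qed (use NN in auto)
      then show ?thesis using NN two(2) by simp
    qed
    have "2 * (X $$ (m, m) * X $$ (m, m + 1)) = 0"
      using G_bil[OF X, of m m] bm[of m] NN by (simp add: algebra_simps)
    then have "X $$ (m, m) = 0 \<or> X $$ (m, m + 1) = 0"
      using two(1) by simp
    moreover have "X $$ (m, m) \<noteq> 0"
    proof
      assume 0: "X $$ (m, m) = 0"
      then have 1: "X $$ (m, m + 1) * X $$ (m + 1, m) = 1"
        using G_bil[OF X, of m "m + 1"] bm[of "m + 1"] NN two(2) by simp
      \<comment> \<open>Swapping the two middle columns makes the matrix lower triangular with
        determinant 1, so \<open>det X = - 1\<close>, contradicting membership in \<open>G\<close>
        as 2 is nonzero.\<close>
      let ?Y = "swapcols m (m + 1) X"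
      have Yij: "?Y $$ (i, j) = (if m = j then X $$ (i, m + 1) else if m + 1 = j then X $$ (i, m) else X $$ (i, j))"
        if "i < N" "j < N" for i j
        using that Xc by simp
      have lY: "lower_tri N ?Y"
        unfolding lower_tri_def
      proof (intro conjI allI impI)
        show "?Y \<in> carrier_mat N N" using Xc by auto
        fix i j assume ij: "i < N" "j < N" "i < j"
        consider "i < m" | "N - m \<le> j" | "i = m" "j = m + 1"
          using ij NN by linarith
        then show "?Y $$ (i, j) = 0"
        proof cases
          case 1
          then show ?thesis
            unfolding Yij[OF ij(1,2)] using rows[OF 1, of j] rows[OF 1, of m] rows[OF 1, of "m + 1"] ij NN
            by auto
        next
          case 2
          then show ?thesis
            unfolding Yij[OF ij(1,2)] using ij last[of i j] NN by auto
        next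
          case 3
          then show ?thesis
            unfolding Yij[OF ij(1,2)] using 0 by simp
        qed
      qed
      have "det ?Y = (\<Prod>i<N. ?Y $$ (i, i))"
        by (rule det_lower_tri[OF lY])
      also have "\<dots> = (\<Prod>i\<in>{m, m + 1}. ?Y $$ (i, i))"
      proof (rule prod.mono_neutral_right)
        show "\<forall>i \<in> {..<N} - {m, m + 1}. ?Y $$ (i, i) = 1"
        proof
          fix i assume i: "i \<in> {..<N} - {m, m + 1}"
          then have "i < m \<or> N - m \<le> i" using NN by auto
          then show "?Y $$ (i, i) = 1"
            using i rows[of i i] last[of i i] Yij[of i i] by auto
        qed
      qed (use NN in auto)
      also have "\<dots> = 1"
        using 1 NN Yij[of m m] Yij[of "m + 1" "m + 1"] by simp
      finally have "det ?Y = 1" .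
      moreover have "det ?Y = - det X"
        by (rule det_swapcols[of _ N]) (use NN Xc in auto)
      ultimately have "(1::'k) = - 1"
        using X by (simp add: G_iff)
      then have "(2::'k) = 0"
        by (metis add.right_inverse one_add_one)
      then show False using two(1) by simp
    qed
    ultimately show ?thesis using q by simp
  qed
  show ?thesis
    unfolding lower_tri_def
  proof (intro conjI allI impI)
    fix i j assume ij: "i < N" "j < N" "i < j"
    consider "i < m" | "N - m \<le> j" | "m \<le> i" "j < N - m" by linarith
    then show "X $$ (i, j) = 0"
      using ij rows last[of i j] mid[of i j] by cases auto
  qed (rule Xc)
qed

section \<open>Density of the big cell\<close>

text \<open>Acting on row vectors from the right, this is the map that adds \<open>bil x w\<close>
  times \<open>u\<close> and \<open>bil x w'\<close> times \<open>u'\<close> to \<open>x\<close>.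
  One such term gives a transvection, two give an Eichler transformation.\<close>

definition tmat :: "(nat \<Rightarrow> 'k) \<Rightarrow> (nat \<Rightarrow> 'k) \<Rightarrow> (nat \<Rightarrow> 'k) \<Rightarrow> (nat \<Rightarrow> 'k) \<Rightarrow> 'k mat" where
  "tmat w u w' u' = mat N N (\<lambda>(k, c).
    unit_fun k c + bil (unit_fun k) w * u c + bil (unit_fun k) w' * u' c)"

lemma tmat_carrier [simp]: "tmat w u w' u' \<in> carrier_mat N N"
  by (simp add: tmat_def)

lemma bil_expand_left: "bil x w = (\<Sum>k<N. x k * bil (unit_fun k) w)"
proof -
  have "bil x w = bil (\<lambda>c. \<Sum>k<N. x k * unit_fun k c) w"
    by (rule bil_cong) (auto simp: unit_fun_def if_distrib cong: if_cong)
  then show ?thesis by (simp add: bil_sum_left)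
qed

lemma sum_tmat:
  assumes "c < N"
  shows "(\<Sum>k<N. x k * tmat w u w' u' $$ (k, c)) = x c + bil x w * u c + bil x w' * u' c"
proof -
  have "(\<Sum>k<N. x k * tmat w u w' u' $$ (k, c)) =
      (\<Sum>k<N. x k * unit_fun k c) + (\<Sum>k<N. x k * bil (unit_fun k) w) * u c +
      (\<Sum>k<N. x k * bil (unit_fun k) w') * u' c"
    unfolding sum_distrib_right sum.distrib[symmetric] using assms
    by (intro sum.cong) (auto simp: tmat_def algebra_simps)
  moreover have "(\<Sum>k<N. x k * unit_fun k c) = x c"
    using assms by (simp add: unit_fun_def if_distrib cong: if_cong)
  ultimately show ?thesis by (simp add: bil_expand_left[of x w] bil_expand_left[of x w'])
qed

lemma tmat_curve_G:
  assumes w: "\<And>c. poly_map (\<lambda>s. w s c)" "\<And>c. poly_map (\<lambda>s. u s c)"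
    "\<And>c. poly_map (\<lambda>s. w' s c)" "\<And>c. poly_map (\<lambda>s. u' s c)"
    and 0: "tmat (w 0) (u 0) (w' 0) (u' 0) = 1\<^sub>m N"
    and iso: "\<And>s x y. bil (\<lambda>c. x c + bil x (w s) * u s c + bil x (w' s) * u' s c)
        (\<lambda>c. y c + bil y (w s) * u s c + bil y (w' s) * u' s c) = bil x y"
  shows "poly_curve N (\<lambda>s. tmat (w s) (u s) (w' s) (u' s))"
    and "tmat (w s) (u s) (w' s) (u' s) \<in> G"
proof -
  have bilp: "poly_map (\<lambda>s. bil (unit_fun k) (f s))" if "\<And>c. poly_map (\<lambda>s. f s c)" for f k
    unfolding bil_def by (intro poly_map_sum poly_map_mult poly_map_const that)
  show curve: "poly_curve N (\<lambda>s. tmat (w s) (u s) (w' s) (u' s))"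
  proof (rule poly_curveI)
    fix i j assume "i < N" "j < N"
    then show "poly_map (\<lambda>s. tmat (w s) (u s) (w' s) (u' s) $$ (i, j))"
      by (simp add: tmat_def) (intro poly_map_add poly_map_mult poly_map_const bilp w)
  qed
  show "tmat (w s) (u s) (w' s) (u' s) \<in> G"
  proof (rule isometry_curve_G[OF curve tmat_carrier 0])
    fix s i k assume ik: "i < N" "k < N"
    have "bil (row_fun (tmat (w s) (u s) (w' s) (u' s)) i) (row_fun (tmat (w s) (u s) (w' s) (u' s)) k) =
        bil (\<lambda>c. unit_fun i c + bil (unit_fun i) (w s) * u s c + bil (unit_fun i) (w' s) * u' s c)
          (\<lambda>c. unit_fun k c + bil (unit_fun k) (w s) * u s c + bil (unit_fun k) (w' s) * u' s c)"
      by (rule bil_cong) (use ik in \<open>auto simp: tmat_def\<close>)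
    also have "\<dots> = bil (unit_fun i) (unit_fun k)"
      by (rule iso)
    also have "\<dots> = J $$ (i, k)"
      using ik by (auto simp: bil_unit_left J_index unit_fun_def)
    finally show "bil (row_fun (tmat (w s) (u s) (w' s) (u' s)) i)
      (row_fun (tmat (w s) (u s) (w' s) (u' s)) k) = J $$ (i, k)" .
  qed
qed

lemma bil_lin_left: "bil (\<lambda>c. x c + a * u c + b * v c) y = bil x y + a * bil u y + b * bil v y"
  by (simp add: bil_add_left bil_smult_left)

lemma bil_lin_right: "bil y (\<lambda>c. x c + a * u c + b * v c) = bil y x + a * bil y u + b * bil y v"
  by (simp add: bil_add_right bil_smult_right)

text \<open>The terms at \<open>c\<close> and \<open>N - 1 - c\<close> cancel in pairs. Skew
  symmetry alone would give only that twice the value is 0, which is void in characteristic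
  2.\<close>

lemma bil_self_zero:
  assumes "q = 0" "sg = -1"
  shows "bil v v = 0"
proof -
  let ?f = "\<lambda>c. eps c * v c * v (N - 1 - c)"
  have NN: "N = m + m" using N assms by simp
  have "bil v v = (\<Sum>c<m. ?f c) + (\<Sum>c\<in>{m..<N}. ?f c)"
    unfolding bil_def using NN
    by (subst sum.union_disjoint[symmetric]) (auto intro!: sum.cong)
  also have "(\<Sum>c\<in>{m..<N}. ?f c) = (\<Sum>c<m. ?f (N - 1 - c))"
    by (rule sum.reindex_bij_witness[of _ "\<lambda>c. N - 1 - c" "\<lambda>c. N - 1 - c"]) (use NN in auto)
  also have "\<dots> = (\<Sum>c<m. - ?f c)"
  proof (rule sum.cong)
    fix c assume "c \<in> {..<m}"
    then have c: "c < N" "N - 1 - c < N" "N - 1 - (N - 1 - c) = c" "c + (N - 1 - c) + 1 = N" using NN by auto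
    then have "eps (N - 1 - c) = - eps c"
      using eps_swap[OF c(1,2,4)] assms by simp
    then show "?f (N - 1 - c) = - ?f c" using c(3) by simp
  qed simp
  finally show ?thesis by (simp add: sum_negf)
qed

text \<open>Symplectic transvections \<open>x \<mapsto> x + s B(x, v) v\<close>, and for an orthogonal form the Eichler
  transformations \<open>x \<mapsto> x + s B(x, v) e - s B(x, e) v - s\<^sup>2 B(v, v) / 2 B(x, e) e\<close> with \<open>e\<close> isotropic and
  orthogonal to \<open>v\<close>.\<close>

lemma moving_curve:
  assumes j: "j < m" and x0: "x j = 0" and xc: "c0 < N" "j \<le> c0" "c0 < N - j" "x c0 \<noteq> 0"
  shows "\<exists>\<gamma>. poly_curve N \<gamma> \<and> (\<forall>s. \<gamma> s \<in> G) \<and> \<gamma> 0 = 1\<^sub>m N \<and>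
    (\<forall>s y c. c < j \<longrightarrow> (\<Sum>k<N. y k * \<gamma> s $$ (k, c)) = y c) \<and>
    (\<exists>t. (\<Sum>k<N. x k * \<gamma> t $$ (k, j)) \<noteq> 0)"
proof -
  have jN: "j < N" "N - 1 - j < N" "j \<noteq> N - 1 - j" using j m_le by auto
  have one: "tmat (\<lambda>c. 0) u (\<lambda>c. 0) u' = 1\<^sub>m N" for u u'
    by (rule eq_matI) (auto simp: tmat_def unit_fun_def bil_def)
  have one': "tmat (\<lambda>c. 0) u w' (\<lambda>c. 0) = 1\<^sub>m N" for u w'
    by (rule eq_matI) (auto simp: tmat_def unit_fun_def bil_def)
  have c0j: "c0 \<noteq> j" using x0 xc by auto
  from type show ?thesis
  proof
    assume sp: "q = 0 \<and> sg = -1"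
    have eps0: "eps c \<noteq> 0" if "c < N" for c using eps_sq[OF that] by auto
    \<comment> \<open>Vanishing below \<open>j\<close> fixes the columns before \<open>j\<close>;
      \<open>v j = 1\<close> together with a nonzero pairing with \<open>x\<close> makes column
      \<open>j\<close> move. If the unit vector at \<open>j\<close> pairs to zero with
      \<open>x\<close>, the unit vector dual to \<open>c0\<close> is added.\<close>
    have "\<exists>v. (\<forall>c<j. v c = 0) \<and> v j = 1 \<and> bil x v \<noteq> 0"
    proof (cases "x (N - 1 - j) = 0")
      case False
      then show ?thesis
        using jN eps0[OF jN(2)] bil_unit_right[OF jN(1), of x]
        by (intro exI[of _ "unit_fun j"]) (auto simp: unit_fun_def)
    next
      case True
      let ?c = "N - 1 - c0"
      have c: "?c < N" "N - 1 - ?c = c0" "?c \<noteq> j" "j \<le> ?c"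
        using xc c0j True by auto
      have "bil x (\<lambda>c. unit_fun j c + unit_fun ?c c) = eps c0 * x c0"
        unfolding bil_add_right bil_unit_right[OF jN(1)] bil_unit_right[OF c(1)] using True c(2) by simp
      then show ?thesis
        using xc eps0[OF xc(1)] c by (intro exI[of _ "\<lambda>c. unit_fun j c + unit_fun ?c c"]) (auto simp: unit_fun_def)
    qed
    then obtain v where v: "\<And>c. c < j \<Longrightarrow> v c = 0" "v j = 1" "bil x v \<noteq> 0" by blast
    let ?\<gamma> = "\<lambda>s. tmat (\<lambda>c. s * v c) v (\<lambda>c. 0) (\<lambda>c. 0)"
    have iso: "bil (\<lambda>c. x c + bil x (\<lambda>c. s * v c) * v c + bil x (\<lambda>c. 0) * 0)
        (\<lambda>c. y c + bil y (\<lambda>c. s * v c) * v c + bil y (\<lambda>c. 0) * 0) = bil x y" for s x y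
    proof -
      have "bil v y = - bil y v" using bil_sym[of v y] sp by simp
      moreover have "bil z (\<lambda>c. 0) = 0" for z by (simp add: bil_def)
      ultimately show ?thesis
        using bil_self_zero[of v] sp
        unfolding bil_lin_left bil_lin_right bil_smult_right by (simp add: algebra_simps)
    qed
    have p: "poly_map (\<lambda>s. s * v c)" "poly_map (\<lambda>s. v c)" "poly_map (\<lambda>s. 0::'k)" for c
      by (auto intro!: poly_map_mult poly_map_ident poly_map_const)
    have 0: "tmat (\<lambda>c. 0 * v c) v (\<lambda>c. 0) (\<lambda>c. 0) = 1\<^sub>m N"
      using one by simp
    have "poly_curve N ?\<gamma>" "\<And>s. ?\<gamma> s \<in> G"
      by (rule tmat_curve_G[of "\<lambda>s c. s * v c" "\<lambda>s. v" "\<lambda>s c. 0" "\<lambda>s c. 0", OF p(1,2,3,3) 0 iso])+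
    moreover have "(\<Sum>k<N. y k * ?\<gamma> s $$ (k, c)) = y c" if "c < j" for s y c
      using sum_tmat[of c y] that jN v(1) by simp
    moreover have "(\<Sum>k<N. x k * ?\<gamma> 1 $$ (k, j)) \<noteq> 0"
      using sum_tmat[OF jN(1), of x] v(2,3) x0 by simp
    ultimately show ?thesis
      using 0 by (intro exI[of _ ?\<gamma>]) blast
  next
    assume so: "(q = 1 \<or> q = 2) \<and> sg = 1 \<and> (\<forall>i. eps i = 1) \<and> (2 :: 'k) \<noteq> 0"
    let ?j = "N - 1 - j"
    have e1: "eps c = 1" for c using so by simp
    \<comment> \<open>\<open>v\<close> vanishes at \<open>?j\<close> to be orthogonal to the unit
      vector at \<open>j\<close>. Either \<open>x\<close> has a nonzero coordinate strictly between
      \<open>j\<close> and \<open>?j\<close>, seen by the term linear in \<open>s\<close>, or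
      \<open>x ?j\<close> is nonzero and the quadratic term needs an anisotropic \<open>v\<close>,
      taken from the middle block.\<close>
    have "\<exists>v. (\<forall>c\<le>j. v c = 0) \<and> v ?j = 0 \<and> (bil x v \<noteq> 0 \<or> bil v v * x ?j \<noteq> 0)"
    proof (cases "\<exists>c. j < c \<and> c < ?j \<and> x c \<noteq> 0")
      case True
      then obtain c where c: "j < c" "c < ?j" "x c \<noteq> 0" by blast
      let ?c = "N - 1 - c"
      have c': "?c < N" "N - 1 - ?c = c" "j < ?c" "?c < ?j" using c by auto
      then show ?thesis
        using c bil_unit_right[OF c'(1), of x] e1 by (intro exI[of _ "unit_fun ?c"]) (auto simp: unit_fun_def)
    next
      case False
      have "j < c0" using xc c0j by simp
      then have "\<not> c0 < ?j" using False xc(4) by blast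
      then have "c0 = ?j" using xc(3) by simp
      then have xj: "x ?j \<noteq> 0" using xc(4) by simp
      have mN: "m < N" "j < m" "m < ?j" using so N j by auto
      show ?thesis
      proof (cases "q = 1")
        case True
        then have "N - 1 - m = m" using N by simp
        then have "bil (unit_fun m) (unit_fun m) = 1"
          using bil_unit_right[OF mN(1), of "unit_fun m"] e1 by (simp add: unit_fun_def)
        then show ?thesis
          using xj mN by (intro exI[of _ "unit_fun m"]) (auto simp: unit_fun_def)
      next
        case False
        then have q: "N = 2 * m + 2" using so N by auto
        then have m1: "m + 1 < N" "N - 1 - m = m + 1" "N - 1 - (m + 1) = m" "m + 1 < ?j" using j by auto
        have "bil (\<lambda>c. unit_fun m c + unit_fun (m + 1) c) (\<lambda>c. unit_fun m c + unit_fun (m + 1) c) = 2"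
          unfolding bil_add_right bil_unit_right[OF mN(1)] bil_unit_right[OF m1(1)] using m1 e1
          by (simp add: unit_fun_def)
        then show ?thesis
          using xj mN m1 so by (intro exI[of _ "\<lambda>c. unit_fun m c + unit_fun (m + 1) c"]) (auto simp: unit_fun_def)
      qed
    qed
    then obtain v where v: "\<And>c. c \<le> j \<Longrightarrow> v c = 0" "v ?j = 0" "bil x v \<noteq> 0 \<or> bil v v * x ?j \<noteq> 0"
      by blast
    let ?e = "unit_fun j"
    define h where "h = bil v v / 2"
    have h2: "bil v v = 2 * h" using so by (simp add: h_def)
    let ?w = "\<lambda>s c. s * v c - s * s * h * ?e c" and ?u = "\<lambda>s c. - s * v c"
    let ?\<gamma> = "\<lambda>s. tmat (?w s) ?e ?e (?u s)"
    have be: "bil y ?e = y ?j" for y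
      using bil_unit_right[OF jN(1), of y] e1 by simp
    have be': "bil ?e y = y ?j" for y
      using bil_unit_left[OF jN(1), of y] e1 by simp
    have bw: "bil y (?w s) = s * bil y v - s * s * h * y ?j" for y s
    proof -
      have "bil y (?w s) = bil y (\<lambda>c. s * v c + (- (s * s * h)) * ?e c)"
        by simp
      then show ?thesis
        unfolding bil_add_right bil_smult_right be by simp
    qed
    have sym: "bil y z = bil z y" for y z using bil_sym[of y z] so by simp
    have iso: "bil (\<lambda>c. x c + bil x (?w s) * ?e c + bil x ?e * ?u s c)
        (\<lambda>c. y c + bil y (?w s) * ?e c + bil y ?e * ?u s c) = bil x y" for s x y
    proof -
      have ee: "?e ?j = 0" using jN by (simp add: unit_fun_def)
      have u: "bil z (?u s) = - s * bil z v" "bil (?u s) z = - s * bil v z" for z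
        by (rule bil_smult_right bil_smult_left)+
      show ?thesis
        unfolding bil_lin_left bil_lin_right bw be be' u
        using ee v(2) sym[of v y] h2 by (simp add: algebra_simps)
    qed
    have p: "poly_map (\<lambda>s. ?w s c)" "poly_map (\<lambda>s. ?e c)" "poly_map (\<lambda>s. ?u s c)" for c
    proof -
      show "poly_map (\<lambda>s. ?w s c)" "poly_map (\<lambda>s. ?e c)"
        by (intro poly_map_diff poly_map_mult poly_map_ident poly_map_const)+
      have "poly_map (\<lambda>s. s * (- v c))"
        by (intro poly_map_mult poly_map_ident poly_map_const)
      then show "poly_map (\<lambda>s. ?u s c)" by simp
    qed
    have 0: "tmat (?w 0) ?e ?e (?u 0) = 1\<^sub>m N"
      by (rule eq_matI) (auto simp: tmat_def unit_fun_def bil_def)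
    have "poly_curve N ?\<gamma>" "\<And>s. ?\<gamma> s \<in> G"
      by (rule tmat_curve_G[of ?w "\<lambda>s. ?e" "\<lambda>s. ?e" ?u, OF p(1,2,2,3) 0 iso])+
    moreover have "(\<Sum>k<N. y k * ?\<gamma> s $$ (k, c)) = y c" if "c < j" for s y c
    proof -
      have "c < N" "v c = 0" "?e c = 0" using that jN v(1)[of c] by (auto simp: unit_fun_def)
      then show ?thesis using sum_tmat[of c y "?w s" ?e ?e "?u s"] by simp
    qed
    \<comment> \<open>Entry \<open>j\<close> of the image of \<open>x\<close> is a polynomial in
      \<open>s\<close> with coefficients \<open>bil x v\<close> and \<open>- h * x ?j\<close>, not
      both zero.\<close>
    moreover have "\<exists>t. (\<Sum>k<N. x k * ?\<gamma> t $$ (k, j)) \<noteq> 0"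
    proof (rule ccontr)
      assume "\<not> ?thesis"
      then have "(\<Sum>k<N. x k * ?\<gamma> s $$ (k, j)) = 0" for s by blast
      moreover have "(\<Sum>k<N. x k * ?\<gamma> s $$ (k, j)) = s * bil x v - s * s * h * x ?j" for s
        unfolding sum_tmat[OF jN(1)] bw be using x0 v(1)[of j] by (simp add: unit_fun_def)
      ultimately have "s * bil x v - s * s * h * x ?j = 0" for s
        by metis
      moreover have "poly [:0, bil x v, - h * x ?j:] s = s * bil x v - s * s * h * x ?j" for s
        by (simp add: algebra_simps)
      ultimately have "poly [:0, bil x v, - h * x ?j:] s = poly 0 s" for s
        by simp
      then have "[:0, bil x v, - h * x ?j:] = 0"
        by (intro poly_eqI_infinite[OF inf])
      then show False using v(3) h2 so by auto
    qed
    ultimately show ?thesis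
      using 0 by (intro exI[of _ ?\<gamma>]) blast
  qed
qed

text \<open>Subtracting from row \<open>j\<close> the combination of earlier rows with coefficients
  \<open>t\<close> clears its first \<open>j\<close> columns; the remainder \<open>x\<close> decides
  the larger minor through its entry at \<open>j\<close>. If that is zero, a curve moves a nonzero
  coordinate of \<open>x\<close> into column \<open>j\<close> without touching the earlier
  columns.\<close>

lemma dense_step:
  assumes X: "X \<in> G" and j: "j < m" and D: "det (blk j X) \<noteq> 0"
  shows "\<exists>\<gamma>. poly_curve N \<gamma> \<and> (\<forall>s. \<gamma> s \<in> G) \<and> \<gamma> 0 = 1\<^sub>m N \<and> (\<exists>t. det (blk (Suc j) (X * \<gamma> t)) \<noteq> 0)"
proof -
  let ?B = "blk j X"
  have B: "?B \<in> GL j" using D by (simp add: GL_iff)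
  have Xc: "X \<in> carrier_mat N N" by (rule G_carrier[OF X])
  have jN: "j < N" "Suc j \<le> N" using j m_le by auto
  define t where "t l = (\<Sum>c<j. X $$ (j, c) * inv_mat j ?B $$ (c, l))" for l
  define x where "x c = X $$ (j, c) - (\<Sum>l<j. t l * X $$ (l, c))" for c
  have xz: "x c = 0" if "c < j" for c
  proof -
    have "(\<Sum>l<j. t l * X $$ (l, c)) = (\<Sum>l<j. \<Sum>d<j. X $$ (j, d) * inv_mat j ?B $$ (d, l) * ?B $$ (l, c))"
      unfolding t_def sum_distrib_right using that by (intro sum.cong) auto
    also have "\<dots> = (\<Sum>d<j. X $$ (j, d) * (\<Sum>l<j. inv_mat j ?B $$ (d, l) * ?B $$ (l, c)))"
      unfolding sum_distrib_left by (subst sum.swap) (simp add: mult.assoc)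
    also have "\<dots> = (\<Sum>d<j. if d = c then X $$ (j, c) else 0)"
      using mult_inv_mat_index(2)[OF B _ that] by (intro sum.cong) auto
    finally show ?thesis using that by (simp add: x_def)
  qed
  have comb: "v i = - v j * t i" if v: "\<And>c. c < j \<Longrightarrow> (\<Sum>i<Suc j. v i * X $$ (i, c)) = 0" and "i < j" for v i
  proof (rule ccontr)
    assume ne: "v i \<noteq> - v j * t i"
    have "(\<Sum>i<j. (v i + v j * t i) * ?B $$ (i, c)) = 0" if c: "c < j" for c
    proof -
      have "(\<Sum>i<j. (v i + v j * t i) * ?B $$ (i, c)) = (\<Sum>i<j. v i * X $$ (i, c)) + v j * (\<Sum>i<j. t i * X $$ (i, c))"
        unfolding sum_distrib_left sum.distrib[symmetric] using c by (intro sum.cong) (auto simp: algebra_simps)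
      also have "(\<Sum>i<j. t i * X $$ (i, c)) = X $$ (j, c)"
        using xz[OF c] by (simp add: x_def)
      finally show ?thesis using v[OF c] by simp
    qed
    moreover have "v i + v j * t i \<noteq> 0"
      using ne by (simp add: eq_neg_iff_add_eq_0)
    ultimately have "det ?B = 0"
      unfolding det_zero_iff_left[OF blk_carrier] using \<open>i < j\<close>
      by (intro exI[of _ "\<lambda>i. v i + v j * t i"]) blast
    then show False using D by simp
  qed
  have lead: "det (blk (Suc j) (X * \<gamma>)) \<noteq> 0"
    if \<gamma>: "\<gamma> \<in> carrier_mat N N" and fixc: "\<And>y c. c < j \<Longrightarrow> (\<Sum>k<N. y k * \<gamma> $$ (k, c)) = y c"
      and mv: "(\<Sum>k<N. x k * \<gamma> $$ (k, j)) \<noteq> 0" for \<gamma>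
  proof
    assume "det (blk (Suc j) (X * \<gamma>)) = 0"
    then obtain v i0 where i0: "i0 < Suc j" "v i0 \<noteq> 0"
      and v: "\<And>c. c < Suc j \<Longrightarrow> (\<Sum>i<Suc j. v i * blk (Suc j) (X * \<gamma>) $$ (i, c)) = 0"
      unfolding det_zero_iff_left[OF blk_carrier] by blast
    have v': "(\<Sum>i<Suc j. v i * (\<Sum>k<N. X $$ (i, k) * \<gamma> $$ (k, c))) = 0" if c: "c < Suc j" for c
    proof -
      have "(\<Sum>i<Suc j. v i * (\<Sum>k<N. X $$ (i, k) * \<gamma> $$ (k, c))) = (\<Sum>i<Suc j. v i * blk (Suc j) (X * \<gamma>) $$ (i, c))"
      proof (rule sum.cong)
        fix i assume "i \<in> {..<Suc j}"
        then have "i < Suc j" "i < N" "c < N" using c jN by auto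
        then show "v i * (\<Sum>k<N. X $$ (i, k) * \<gamma> $$ (k, c)) = v i * blk (Suc j) (X * \<gamma>) $$ (i, c)"
          using c mult_mat_index[OF Xc \<gamma>, of i c] by simp
      qed simp
      then show ?thesis using v[OF c] by simp
    qed
    have vt: "v i = - v j * t i" if "i < j" for i
    proof (rule comb[OF _ that])
      fix c assume "c < j"
      then show "(\<Sum>i<Suc j. v i * X $$ (i, c)) = 0"
        using v'[of c] fixc[of c] by simp
    qed
    have "(\<Sum>i<Suc j. v i * X $$ (i, k)) = v j * x k" for k
    proof -
      have "(\<Sum>i<j. v i * X $$ (i, k)) = (\<Sum>i<j. - (v j * (t i * X $$ (i, k))))"
        using vt by (intro sum.cong) auto
      then show ?thesis
        by (simp add: x_def sum_negf sum_distrib_left algebra_simps)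
    qed
    then have "v j * (\<Sum>k<N. x k * \<gamma> $$ (k, j)) = (\<Sum>k<N. (\<Sum>i<Suc j. v i * X $$ (i, k)) * \<gamma> $$ (k, j))"
      by (simp only: sum_distrib_left mult.assoc)
    also have "\<dots> = (\<Sum>i<Suc j. v i * (\<Sum>k<N. X $$ (i, k) * \<gamma> $$ (k, j)))"
      unfolding sum_distrib_left sum_distrib_right by (subst sum.swap) (simp only: mult.assoc)
    also have "\<dots> = 0" by (rule v') simp
    finally have "v j = 0" using mv by simp
    then show False using i0 vt by (metis less_Suc_eq minus_zero mult_zero_left)
  qed
  show ?thesis
  proof (cases "x j = 0")
    case False
    have fix1: "(\<Sum>k<N. y k * 1\<^sub>m N $$ (k, c)) = y c" if "c < N" for y :: "nat \<Rightarrow> 'k" and c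
    proof -
      have "(\<Sum>k<N. y k * 1\<^sub>m N $$ (k, c)) = (\<Sum>k<N. if k = c then y c else 0)"
        using that by (intro sum.cong) auto
      then show ?thesis using that by simp
    qed
    have "det (blk (Suc j) (X * 1\<^sub>m N)) \<noteq> 0"
      by (rule lead) (use fix1 jN False in auto)
    moreover have "poly_curve N (\<lambda>s. 1\<^sub>m N :: 'k mat)"
      by (rule poly_curveI) (rule poly_map_const)
    ultimately show ?thesis
      using one_G by (intro exI[of _ "\<lambda>s. 1\<^sub>m N"]) simp
  next
    case True
    \<comment> \<open>Otherwise \<open>x\<close> is supported on the last \<open>j\<close>
      coordinates, which pair with the first \<open>j\<close> columns of the earlier rows. Rows up
      to \<open>j\<close> are mutually orthogonal, so invertibility of \<open>?B\<close> forces
      \<open>x\<close> to vanish, and then row \<open>j\<close> depends on the earlier ones, against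
      \<open>det X = 1\<close>.\<close>
    have "\<exists>c0 < N. j \<le> c0 \<and> c0 < N - j \<and> x c0 \<noteq> 0"
    proof (rule ccontr)
      assume "\<not> ?thesis"
      then have x0: "x c = 0" if "c < N - j" for c
        using that xz[of c] by (cases "c < j") auto
      have orth: "bil x (row_fun X l) = 0" if l: "l < j" for l
      proof -
        have z: "bil (row_fun X i) (row_fun X l) = 0" if "i \<le> j" for i
          using G_bil[OF X, of i l] that l j m_le by auto
        have "x = (\<lambda>c. X $$ (j, c) + (-1) * (\<Sum>k<j. t k * X $$ (k, c)))"
          by (simp add: x_def fun_eq_iff)
        then have "bil x (row_fun X l) = bil (\<lambda>c. X $$ (j, c) + (-1) * (\<Sum>k<j. t k * X $$ (k, c))) (row_fun X l)"
          by simp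
        also have "\<dots> = bil (row_fun X j) (row_fun X l) + (-1) * (\<Sum>k<j. t k * bil (row_fun X k) (row_fun X l))"
          unfolding bil_add_left bil_smult_left by (simp add: bil_sum_left)
        finally show ?thesis using z by simp
      qed
      define y where "y d = eps (N - 1 - d) * x (N - 1 - d)" for d
      have By: "(\<Sum>d<j. ?B $$ (l, d) * y d) = 0" if l: "l < j" for l
      proof -
        have "bil x (row_fun X l) = (\<Sum>c\<in>{N - j..<N}. eps c * x c * X $$ (l, N - 1 - c))"
          by (rule bil_left_supp) (use x0 in auto)
        also have "\<dots> = (\<Sum>d<j. ?B $$ (l, d) * y d)"
          by (rule sum.reindex_bij_witness[of _ "\<lambda>c. N - 1 - c" "\<lambda>c. N - 1 - c"])
            (use l jN in \<open>auto simp: y_def\<close>)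
        finally show ?thesis using orth[OF l] by simp
      qed
      have "y d = 0" if "d < j" for d
        using D By that unfolding det_zero_iff_right[OF blk_carrier] by blast
      then have "x c = 0" if "c < N" for c
      proof (cases "c < N - j")
        case False
        then have "N - 1 - c < j" "N - 1 - (N - 1 - c) = c" using that jN by auto
        then have "eps c * x c = 0" using \<open>\<And>d. d < j \<Longrightarrow> y d = 0\<close>[of "N - 1 - c"] by (simp add: y_def)
        then show ?thesis using eps_sq[OF that] by auto
      qed (rule x0)
      then have xall: "X $$ (j, c) = (\<Sum>l<j. t l * X $$ (l, c))" if "c < N" for c
        using that by (simp add: x_def)
      have "det X = 0"
        unfolding det_zero_iff_left[OF Xc]
      proof (intro exI[of _ "\<lambda>i. if i = j then 1 else if i < j then - t i else 0"] conjI allI impI)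
        let ?v = "\<lambda>i. if i = j then 1 else if i < j then - t i else 0"
        show "\<exists>i<N. ?v i \<noteq> 0" using jN by (intro exI[of _ j]) auto
        fix c assume c: "c < N"
        have "(\<Sum>i<N. ?v i * X $$ (i, c)) = (\<Sum>i<Suc j. ?v i * X $$ (i, c))"
          by (rule sum.mono_neutral_right) (use jN in auto)
        also have "\<dots> = X $$ (j, c) - (\<Sum>i<j. t i * X $$ (i, c))"
          by (simp add: sum_negf)
        finally show "(\<Sum>i<N. ?v i * X $$ (i, c)) = 0"
          using xall[OF c] by simp
      qed
      then show False using X by (simp add: G_iff)
    qed
    then obtain c0 where c0: "c0 < N" "j \<le> c0" "c0 < N - j" "x c0 \<noteq> 0" by blast
    obtain \<gamma> t where \<gamma>: "poly_curve N \<gamma>" "\<And>s. \<gamma> s \<in> G" "\<gamma> 0 = 1\<^sub>m N"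
      "\<And>s y c. c < j \<Longrightarrow> (\<Sum>k<N. y k * \<gamma> s $$ (k, c)) = y c"
      "(\<Sum>k<N. x k * \<gamma> t $$ (k, j)) \<noteq> 0"
      using moving_curve[OF j True c0] by blast
    have "det (blk (Suc j) (X * \<gamma> t)) \<noteq> 0"
      by (rule lead[OF G_carrier[OF \<gamma>(2)] \<gamma>(4,5)])
    then show ?thesis using \<gamma>(1,2,3) by blast
  qed
qed

text \<open>Leading minors are made nonzero one size at a time, from \<open>j\<close> to
  \<open>Suc j\<close> along the curves of \<open>dense_step\<close>; for \<open>j = 0\<close> the
  condition is empty, so all of \<open>G\<close> is reached.\<close>

lemma dense:
  assumes P: "P \<in> polyfun N" and "\<And>X. X \<in> G \<Longrightarrow> det (blk m X) \<noteq> 0 \<Longrightarrow> P X = 0" and "X \<in> G"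
  shows "P X = 0"
proof -
  have "\<forall>X \<in> G. P X = 0" if "j \<le> m" "\<forall>X \<in> G. det (blk j X) \<noteq> 0 \<longrightarrow> P X = 0" for j
    using that
  proof (induction j)
    case 0
    have "det (blk 0 X) = 1" for X :: "'k mat"
      by (rule det_dim_zero) simp
    then show ?case using 0 by simp
  next
    case (Suc j)
    have "P X = 0" if X: "X \<in> G" and D: "det (blk j X) \<noteq> 0" for X
    proof -
      obtain \<gamma> t where \<gamma>: "poly_curve N \<gamma>" "\<And>s. \<gamma> s \<in> G" "\<gamma> 0 = 1\<^sub>m N"
        "det (blk (Suc j) (X * \<gamma> t)) \<noteq> 0"
        using dense_step[OF X _ D] Suc.prems by auto
      have "poly_curve N (\<lambda>s. X)"
        by (rule poly_curveI) (rule poly_map_const)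
      then have curve: "poly_curve N (\<lambda>s. X * \<gamma> s)"
        by (rule poly_curve_mult[OF _ \<gamma>(1) G_carrier[OF X] G_carrier[OF \<gamma>(2)]])
      have "P (X * \<gamma> 0) = 0"
      proof (rule polyfun_zero_on_curve[OF inf P polyfun_det_blk curve \<gamma>(4)])
        show "Suc j \<le> N" using Suc.prems m_le by simp
        fix s assume "det (blk (Suc j) (X * \<gamma> s)) \<noteq> 0"
        then show "P (X * \<gamma> s) = 0"
          using Suc.prems(2) mult_G[OF X \<gamma>(2)] by blast
      qed
      then show ?thesis
        using G_carrier[OF X] by (simp add: \<gamma>(3))
    qed
    then show ?case using Suc by auto
  qed
  then show ?thesis using assms(2,3) by blast
qed

lemma levi: "levi_group N m G iota wt"
proof (unfold_locales, goal_cases)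
  case 1 show ?case by (rule inf)
next
  case 2 show ?case by (rule m_le)
next
  case 3 show ?case by (auto simp: G)
next
  case 4 show ?case by (rule one_G)
next
  case (5 X Y) then show ?case by (rule mult_G)
next
  case (6 X) then show ?case by (rule inv_G)
next
  case (7 a) from 7(1) show ?case by (rule iota_G)
next
  case (8 a i j) from 8(2,3) show ?case by (rule iota_row)
next
  case (9 b) then show ?case by (rule iota_lower)
next
  case (10 P) then show ?case by (rule iota_regular)
next
  case (11 X) then show ?case by (rule rigid)
next
  case (12 c) then show ?case by (rule torus_G)
next
  case (13 j) then show ?case by (simp add: wt_def)
next
  case (14 X) then show ?case by (rule cell)
next
  case (15 j) show ?case by (simp add: wt_def)
next
  case (16 P X) show ?case by (rule dense[OF 16(1) _ 16(3)]) (rule 16(2))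
qed

end

section \<open>The classical groups\<close>

lemma antidiag_form_mat: "antidiag N = form_mat N (\<lambda>i. 1)"
  by (simp add: antidiag_def form_mat_def)

lemma symp_form_form_mat: "symp_form n = form_mat (2 * n) (\<lambda>i. if i < n then 1 else - 1)"
  by (rule eq_matI) (auto simp: symp_form_def antidiag_def form_mat_def)

theorem proposition7p2:
  fixes p n r N :: nat and ty :: classical_type and G :: "'k::field mat set"
    and lam mu :: "nat list"
  assumes "infinite (UNIV :: 'k set)"
    and "CHAR('k) = p" and "p > 0"
    and "n \<ge> 1"
    and "N = classical_dim ty n" and "G = classical_group ty n"
    and "lam \<in> partitions n r" and "mu \<in> partitions n r"
    and a: "ty = Odd_SO \<or> ty = Even_SO \<Longrightarrow> p > 2"
    and b: "ty = Even_SO \<Longrightarrow> lam ! (n - 1) = 0 \<and> mu ! (n - 1) = 0"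
  shows "(\<forall>\<phi> \<in> Hom_mod (GL N) (nabla N (GL N) lam) (nabla N (GL N) mu).
            \<exists>!\<psi>. is_induced_hom N G lam mu \<phi> \<psi>) \<and>
         inj_on (induced_hom N G lam mu)
           (Hom_mod (GL N) (nabla N (GL N) lam) (nabla N (GL N) mu))"
proof -
  define m where "m = (if ty = Even_SO then n - 1 else n)"
  define q :: nat where "q = (case ty of Odd_SO \<Rightarrow> 1 | Symplectic \<Rightarrow> 0 | Even_SO \<Rightarrow> 2)"
  define eps :: "nat \<Rightarrow> 'k" where "eps i = (if ty = Symplectic \<and> n \<le> i then - 1 else 1)" for i
  define sg :: 'k where "sg = (if ty = Symplectic then - 1 else 1)"
  have two: "(2 :: 'k) \<noteq> 0" if "ty \<noteq> Symplectic"
  proof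
    assume "(2 :: 'k) = 0"
    then have "of_nat 2 = (0 :: 'k)" by simp
    then have "CHAR('k) dvd 2" by (simp only: of_nat_eq_0_iff_char_dvd)
    then show False
      using that a assms(2) by (cases ty) (auto dest: dvd_imp_le)
  qed
  have form: "form_group N m q eps sg G"
  proof
    show "infinite (UNIV :: 'k set)" by fact
    show "N = 2 * m + q"
      using assms(4,5) by (cases ty) (auto simp: m_def q_def)
    show "eps i = 1" if "i < m" for i
      using that by (auto simp: eps_def m_def)
    show "eps i * eps (N - 1 - i) = sg" if "i < N" for i
      using that assms(5) by (cases ty) (auto simp: eps_def sg_def)
    show "eps i * eps i = 1" for i
      by (simp add: eps_def)
    show "sg * sg = 1" by (simp add: sg_def)
    show "q = 0 \<and> sg = - 1 \<or> (q = 1 \<or> q = 2) \<and> sg = 1 \<and> (\<forall>i. eps i = 1) \<and> (2 :: 'k) \<noteq> 0"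
      using two by (cases ty) (auto simp: q_def sg_def eps_def)
    have "form_mat N eps = (if ty = Symplectic then symp_form n else antidiag N)"
      unfolding antidiag_form_mat symp_form_form_mat using assms(5)
      by (auto simp: form_mat_def eps_def intro!: eq_matI)
    then show "G = {X \<in> SL N. transpose_mat X * form_mat N eps * X = form_mat N eps}"
      using assms(5,6) by (cases ty) (auto simp: SO_def Sp_def)
  qed
  interpret form_group N m q eps sg G by (rule form)
  interpret levi_group N m G iota wt by (rule levi)
  have upto: "weight_upto N m lam r" if lam: "lam \<in> partitions n r" and z: "ty = Even_SO \<Longrightarrow> lam ! (n - 1) = 0" for lam
  proof -
    have len: "length lam = n" and r: "sum_list lam = r"
      using lam by (auto simp: partitions_def)
    \<comment> \<open>Beyond the list this is the padding in \<open>wexp\<close>; at index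
      \<open>n - 1\<close> in the even orthogonal case it is the assumption on the last
      part.\<close>
    have 0: "wexp lam i = 0" if "m \<le> i" for i
      using that z len by (cases "i = n - 1") (auto simp: wexp_def m_def split: if_splits)
    have "(\<Sum>i<m. wexp lam i) = (\<Sum>i<n. wexp lam i)"
      by (rule sum.mono_neutral_left) (use 0 in \<open>auto simp: m_def\<close>)
    also have "\<dots> = sum_list lam"
      by (simp add: wexp_def len sum_list_sum_nth atLeast0LessThan)
    finally show ?thesis
      using 0 len r assms(5) by (cases ty) (auto simp: weight_upto_def)
  qed
  show ?thesis
    by (rule induced_hom_bij) (use upto assms(7,8) b in auto)
qed

end
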